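(* Let $d\ge1$ and let $G$ be a symmorphic magnetic space group in $\mathbb{R}^d$ (spinless, or double in the spinful case). A simple band cannot be localizable topological: every simple band with $G$ symmetry that is localizable is a band representation of $G$. Equivalently, a localizable topological band with $G$ symmetry has rank at least two; in particular, any simple band with $G$ symmetry that has analytic projection and is not a band representation of $G$ has nonvanishing first Chern class.
   Context: Groups. $BL\subset\mathbb{R}^d$ is a full-rank lattice (Bravais lattice), $RL=\{K: K\cdot R\in2\pi\mathbb{Z}\ \forall R\in BL\}$, $T^d=\mathbb{R}^d/RL$ the Brillouin torus. The point group $\mathcal P$ is a finite group with a homomorphism $p\mapsto(\check p,s_p)\in O(d)\times\{\pm1\}$ such that $\check p\,BL=BL$ ($s_p=-1$ means $p$ involves time reversal). $G=\{(p|R):p\in\mathcal P,R\in BL\}$ with $(q|R')(p|R)=(qp|\check qR+R')$ is the symmorphic magnetic space group, acting by $(p|R)\circ r=\check pr+R$. Wavefunctions take values in $V_0^{\oplus m}$ ($m\ge1$ arbitrary), where $V_0$ is a finite-dimensional complex Hilbert space on which $\mathcal P$ acts by operators $D_p$ with $D_qD_p=D_{qp}$, $D_p$ unitary if $s_p=1$ and antiunitary if $s_p=-1$. Spinless case: $p\mapsto(\check p,s_p)$ is injective, $V_0=\mathbb{C}$, and $D_p$ is the identity or complex conjugation according to $s_p=1$ or $-1$. Spinful case: $G$ is a double group, i.e. the kernel of $p\mapsto(\check p,s_p)$ is $\{E,\bar E\}$ with $\bar E$ the $2\pi$ rotation, $V_0$ is the spinor space and $D_{\bar E}=-1$. For $g=(p|R)$,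 $(\hat gf)(r)=D_pf(g^{-1}\circ r)$. Bands. A Bloch function with wavevector $k$ is a locally square-integrable function with $\psi(r+R)=e^{ik\cdot R}\psi(r)$ for $R\in BL$. A rank-$N$ band with $G$ symmetry assigns to each $k\in\mathbb{R}^d$ an $N$-dimensional space $\mathcal E_k$ of Bloch functions with wavevector $k$, with orthogonal projection $P(k)$ (inner product over a unit cell), such that $P(k+K)=P(k)$ for $K\in RL$ and $\hat g\mathcal E_k=\mathcal E_{s_p\check pk}$ for all $g=(p|R)\in G$. Its projection is analytic if $e^{-ik\cdot r}P(k)e^{ik\cdot r}$ is real-analytic in $k\in\mathbb{R}^d$. A simple band is a band of rank $N=1$. The first Chern class is that of the complex vector bundle over $T^d$ with fibre $\mathcal E_k$ at $k$. Localizable. An orthonormal frame $\psi_{1,k},\dots,\psi_{N,k}$ of $\mathcal E_k$ is analytic if $e^{-ik\cdot r}\psi_{j,k}$ is real-analytic in $k$, and periodic if $\psi_{j,k+K}=\psi_{j,k}$ for $K\in RL$. The band is localizable if it has an analytic periodic orthonormal frame; equivalently it is spanned by the exponentially localized Wannier functions $w_{j,R}(r)=|T^d|^{-1/2}\int_{T^d}e^{-ik\cdot R}\psi_{j,k}(r)\,dk$, $R\in BL$. Band representation. A band with $G$ symmetry is a band representation of $G$ if there are points $\varpi_1,\dots,\varpi_M\in\mathbb{R}^d$, pairwise distinct modulo $BL$, with $X=\{\varpi_n+R\}_{n,R\in BL}$ invariant under $G$, and an analytic periodic orthonormal frame $\psi^\alpha_{n,k}$ indexed by $n$ and $\alpha$,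 such that, with $W_{\varpi_n+R}$ the span over $\alpha$ of the Wannier functions $w^\alpha_{n,R}$, one has $\hat gW_x=W_{g\circ x}$ for all $g\in G$, $x\in X$ (that is, the Wannier functions at each site $x$ represent its stabilizer and the whole representation is induced from site stabilizers). For a simple band this says: for some $\varpi$ with $g\circ\varpi-\varpi\in BL$ for all $g\in G$, each Wannier function $w_R$ forms a representation of $G_{\varpi+R}=\{g\in G:g\circ(\varpi+R)=\varpi+R\}$. Localizable topological. A band with $G$ symmetry is localizable topological if it is localizable but not a band representation of $G$. *)

theory Defs
  imports
    "HOL-Analysis.Analysis"
    "HOL-Algebra.Group"
    "HOL-Library.Function_Algebras"
begin

section \<open>Lattices, Brillouin torus, cells\<close>

definition full_rank_lattice :: "(real^'d) set \<Rightarrow> bool" where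
  "full_rank_lattice L \<longleftrightarrow>
     (\<exists>B. independent B \<and> span B = UNIV \<and>
          L = {(\<Sum>b\<in>B. of_int (n b) *\<^sub>R b) | n :: real^'d \<Rightarrow> int. True})"

definition reciprocal_lattice :: "(real^'d) set \<Rightarrow> (real^'d) set" where
  "reciprocal_lattice BL = {K. \<forall>R\<in>BL. \<exists>n::int. K \<bullet> R = 2 * pi * of_int n}"

text \<open>The Wigner-Seitz cell is used as the unit cell of a lattice. It is a fundamental domain up
  to a null set, so integrals of periodic functions over it are integrals over the torus; the
  torus \<open>T\<^sup>d\<close> is represented by the Wigner-Seitz cell of the reciprocal lattice
  (the first Brillouin zone).\<close>

definition unit_cell :: "(real^'d) set \<Rightarrow> (real^'d) set" where
  "unit_cell L = {r. \<forall>R\<in>L. norm r \<le> norm (r - R)}"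


section \<open>Wavefunctions\<close>

text \<open>\<open>V\<^sub>0\<close> is \<open>\<complex>\<^sup>v\<close> with its standard Hermitian form, and the values lie in
  \<open>V\<^sub>0\<^sup>m\<close>.\<close>

type_synonym ('d, 'v, 'm) wavefun = "(real, 'd) vec \<Rightarrow> ((complex, 'v) vec, 'm) vec"

definition herm :: "complex^'v \<Rightarrow> complex^'v \<Rightarrow> complex" where
  "herm u v = (\<Sum>i\<in>UNIV. cnj (u $ i) * v $ i)"

definition unitary_op :: "(complex^'v \<Rightarrow> complex^'v) \<Rightarrow> bool" where
  "unitary_op U \<longleftrightarrow> bij U \<and> (\<forall>u v. U (u + v) = U u + U v) \<and> (\<forall>c u. U (c *s u) = c *s U u) \<and>
     (\<forall>u v. herm (U u) (U v) = herm u v)"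

definition antiunitary_op :: "(complex^'v \<Rightarrow> complex^'v) \<Rightarrow> bool" where
  "antiunitary_op U \<longleftrightarrow> bij U \<and> (\<forall>u v. U (u + v) = U u + U v) \<and> (\<forall>c u. U (c *s u) = cnj c *s U u) \<and>
     (\<forall>u v. herm (U u) (U v) = cnj (herm u v))"

definition val_scale :: "complex \<Rightarrow> complex^'v^'m \<Rightarrow> complex^'v^'m"  (infixr \<open>*\<^sub>v\<close> 75) where
  "c *\<^sub>v x = (\<chi> a. c *s (x $ a))"

definition val_inner :: "complex^'v^'m \<Rightarrow> complex^'v^'m \<Rightarrow> complex" where
  "val_inner x y = (\<Sum>a\<in>UNIV. herm (x $ a) (y $ a))"

text \<open>Elements of \<open>L\<^sup>2\<^sub>l\<^sub>o\<^sub>c\<close> are represented by Borel functions. Almost everywhere equal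
  functions represent the same element, and a subspace is represented by the set of all
  representatives of its elements; all conditions below respect this.\<close>

definition l2loc :: "('d::finite, 'v::finite, 'm::finite) wavefun set" where
  "l2loc = {f \<in> borel_measurable lborel.
     \<forall>C. compact C \<longrightarrow> set_integrable lborel C (\<lambda>r. (norm (f r))\<^sup>2)}"

definition lspan :: "'j set \<Rightarrow> ('j \<Rightarrow> ('d::finite, 'v::finite, 'm::finite) wavefun)
    \<Rightarrow> ('d, 'v, 'm) wavefun set" where
  "lspan J e = {f \<in> l2loc. \<exists>c. AE r in lborel. f r = (\<Sum>j\<in>J. c j *\<^sub>v e j r)}"

definition has_cdim :: "nat \<Rightarrow> ('d::finite, 'v::finite, 'm::finite) wavefun set \<Rightarrow> bool" where
  "has_cdim N S \<longleftrightarrow> (\<exists>e. (\<forall>j<N. e j \<in> l2loc) \<and>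
     (\<forall>c. (AE r in lborel. (\<Sum>j<N. c j *\<^sub>v e j r) = 0) \<longrightarrow> (\<forall>j<N. c j = 0)) \<and>
     S = lspan {..<N} e)"

definition bloch :: "(real^'d) set \<Rightarrow> real^'d
    \<Rightarrow> ('d::finite, 'v::finite, 'm::finite) wavefun set" where
  "bloch BL k = {\<psi> \<in> l2loc. \<forall>R\<in>BL. AE r in lborel. \<psi> (r + R) = cis (k \<bullet> R) *\<^sub>v \<psi> r}"

definition cell_inner :: "(real^'d) set \<Rightarrow> ('d::finite, 'v::finite, 'm::finite) wavefun
    \<Rightarrow> ('d, 'v, 'm) wavefun \<Rightarrow> complex" where
  "cell_inner BL f g = (LINT r:unit_cell BL|lborel. val_inner (f r) (g r))"

definition cell_norm :: "(real^'d) set \<Rightarrow> ('d::finite, 'v::finite, 'm::finite) wavefun \<Rightarrow> real" where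
  "cell_norm BL f = sqrt (LINT r:unit_cell BL|lborel. (norm (f r))\<^sup>2)"

definition phase :: "real^'d \<Rightarrow> ('d::finite, 'v::finite, 'm::finite) wavefun
    \<Rightarrow> ('d, 'v, 'm) wavefun" where
  "phase k f = (\<lambda>r. cis (k \<bullet> r) *\<^sub>v f r)"


section \<open>Symmorphic magnetic space groups\<close>

definition space_group :: "('p, 'b) monoid_scheme \<Rightarrow> (real^'d) set \<Rightarrow> ('p \<Rightarrow> real^'d \<Rightarrow> real^'d)
    \<Rightarrow> ('p \<times> (real^'d)) monoid" where
  "space_group P BL pc = \<lparr>carrier = carrier P \<times> BL,
     mult = (\<lambda>(q, R') (p, R). (q \<otimes>\<^bsub>P\<^esub> p, pc q R + R')), one = (\<one>\<^bsub>P\<^esub>, 0)\<rparr>"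

definition act :: "('p \<Rightarrow> real^'d \<Rightarrow> real^'d) \<Rightarrow> 'p \<times> (real^'d) \<Rightarrow> real^'d \<Rightarrow> real^'d" where
  "act pc g r = pc (fst g) r + snd g"

definition ghat :: "('p, 'b) monoid_scheme \<Rightarrow> (real^'d) set \<Rightarrow> ('p \<Rightarrow> real^'d \<Rightarrow> real^'d)
    \<Rightarrow> ('p \<Rightarrow> complex^'v \<Rightarrow> complex^'v) \<Rightarrow> 'p \<times> (real^'d)
    \<Rightarrow> ('d::finite, 'v::finite, 'm::finite) wavefun \<Rightarrow> ('d, 'v, 'm) wavefun" where
  "ghat P BL pc D g f =
     (\<lambda>r. \<chi> a. D (fst g) (f (act pc (inv\<^bsub>space_group P BL pc\<^esub> g) r) $ a))"

text \<open>Here \<open>pc p\<close> and \<open>s p\<close> are the spatial part and the time-reversal sign of \<open>p\<close>, and \<open>D p\<close>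
  is its action on \<open>V\<^sub>0\<close>.\<close>

locale magnetic_space_group = group P
  for P :: "('p, 'b) monoid_scheme" (structure) +
  fixes BL :: "(real^'d) set"
    and pc :: "'p \<Rightarrow> real^'d \<Rightarrow> real^'d"
    and s :: "'p \<Rightarrow> real"
    and D :: "'p \<Rightarrow> complex^'v \<Rightarrow> complex^'v"
  assumes finite_point_group: "finite (carrier P)"
    and lattice: "full_rank_lattice BL"
    and pc_orthogonal: "p \<in> carrier P \<Longrightarrow> orthogonal_transformation (pc p)"
    and s_sign: "p \<in> carrier P \<Longrightarrow> s p = 1 \<or> s p = -1"
    and pc_hom: "\<lbrakk>q \<in> carrier P; p \<in> carrier P\<rbrakk> \<Longrightarrow> pc (q \<otimes> p) = pc q \<circ> pc p"
    and s_hom: "\<lbrakk>q \<in> carrier P; p \<in> carrier P\<rbrakk> \<Longrightarrow> s (q \<otimes> p) = s q * s p"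
    and pc_lattice: "p \<in> carrier P \<Longrightarrow> pc p ` BL = BL"
    and D_hom: "\<lbrakk>q \<in> carrier P; p \<in> carrier P\<rbrakk> \<Longrightarrow> D q \<circ> D p = D (q \<otimes> p)"
    and D_unitary: "\<lbrakk>p \<in> carrier P; s p = 1\<rbrakk> \<Longrightarrow> unitary_op (D p)"
    and D_antiunitary: "\<lbrakk>p \<in> carrier P; s p = -1\<rbrakk> \<Longrightarrow> antiunitary_op (D p)"

definition spinless :: "('p, 'b) monoid_scheme \<Rightarrow> ('p \<Rightarrow> real^'d \<Rightarrow> real^'d) \<Rightarrow> ('p \<Rightarrow> real)
    \<Rightarrow> ('p \<Rightarrow> complex^'v \<Rightarrow> complex^'v) \<Rightarrow> bool" where
  "spinless P pc s D \<longleftrightarrow> CARD('v) = 1 \<and> inj_on (\<lambda>p. (pc p, s p)) (carrier P) \<and>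
     (\<forall>p\<in>carrier P. D p = (if s p = 1 then (\<lambda>v. v) else (\<lambda>v. \<chi> i. cnj (v $ i))))"

text \<open>The only property of the spinor space \<open>V\<^sub>0\<close> that is imposed is that the \<open>2\<pi>\<close> rotation
  \<open>Eb\<close>, which is the nontrivial element of the kernel, acts on it as \<open>-1\<close>.\<close>

definition spinful :: "('p, 'b) monoid_scheme \<Rightarrow> ('p \<Rightarrow> real^'d \<Rightarrow> real^'d) \<Rightarrow> ('p \<Rightarrow> real)
    \<Rightarrow> ('p \<Rightarrow> complex^'v \<Rightarrow> complex^'v) \<Rightarrow> bool" where
  "spinful P pc s D \<longleftrightarrow> (\<exists>Eb. Eb \<noteq> \<one>\<^bsub>P\<^esub> \<and>
     {p \<in> carrier P. pc p = id \<and> s p = 1} = {\<one>\<^bsub>P\<^esub>, Eb} \<and> (\<forall>v. D Eb v = - v))"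

context magnetic_space_group
begin

lemma lattice_add: "R \<in> BL \<Longrightarrow> R' \<in> BL \<Longrightarrow> R + R' \<in> BL"
proof -
  obtain B where BL: "BL = {(\<Sum>b\<in>B. of_int (n b) *\<^sub>R b) | n :: real^'d \<Rightarrow> int. True}"
    using lattice unfolding full_rank_lattice_def by blast
  assume "R \<in> BL" "R' \<in> BL"
  then obtain n n' :: "real^'d \<Rightarrow> int" where
    "R = (\<Sum>b\<in>B. of_int (n b) *\<^sub>R b)" "R' = (\<Sum>b\<in>B. of_int (n' b) *\<^sub>R b)"
    unfolding BL by blast
  then have "R + R' = (\<Sum>b\<in>B. of_int (n b + n' b) *\<^sub>R b)"
    by (simp add: sum.distrib scaleR_add_left)
  then show "R + R' \<in> BL"
    unfolding BL by (intro CollectI exI[of _ "\<lambda>b. n b + n' b"]) simp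
qed

lemma lattice_uminus: "R \<in> BL \<Longrightarrow> - R \<in> BL"
proof -
  obtain B where BL: "BL = {(\<Sum>b\<in>B. of_int (n b) *\<^sub>R b) | n :: real^'d \<Rightarrow> int. True}"
    using lattice unfolding full_rank_lattice_def by blast
  assume "R \<in> BL"
  then obtain n :: "real^'d \<Rightarrow> int" where "R = (\<Sum>b\<in>B. of_int (n b) *\<^sub>R b)"
    unfolding BL by blast
  then have "- R = (\<Sum>b\<in>B. of_int (- n b) *\<^sub>R b)"
    by (simp add: sum_negf)
  then show "- R \<in> BL"
    unfolding BL by (intro CollectI exI[of _ "\<lambda>b. - n b"]) simp
qed

lemma lattice_zero: "0 \<in> BL"
proof -
  obtain B where BL: "BL = {(\<Sum>b\<in>B. of_int (n b) *\<^sub>R b) | n :: real^'d \<Rightarrow> int. True}"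
    using lattice unfolding full_rank_lattice_def by blast
  show ?thesis
    unfolding BL by (intro CollectI exI[of _ "\<lambda>b. 0"]) simp
qed

lemma pc_one: "pc \<one> = id"
proof -
  have "pc \<one> \<circ> pc \<one> = pc \<one>"
    using pc_hom[of \<one> \<one>] by simp
  moreover have "inj (pc \<one>)"
    using pc_orthogonal[of \<one>] orthogonal_transformation_inj by blast
  ultimately show ?thesis
    by (metis fun.inj_map_strong injD comp_apply eq_id_iff)
qed

lemma group_space_group: "group (space_group P BL pc)"
proof (rule groupI)
  fix x y assume "x \<in> carrier (space_group P BL pc)" "y \<in> carrier (space_group P BL pc)"
  then show "x \<otimes>\<^bsub>space_group P BL pc\<^esub> y \<in> carrier (space_group P BL pc)"
    using pc_lattice lattice_add by (auto simp: space_group_def)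
next
  show "\<one>\<^bsub>space_group P BL pc\<^esub> \<in> carrier (space_group P BL pc)"
    using lattice_zero by (simp add: space_group_def)
next
  fix x y z
  assume "x \<in> carrier (space_group P BL pc)" "y \<in> carrier (space_group P BL pc)"
    "z \<in> carrier (space_group P BL pc)"
  then show "x \<otimes>\<^bsub>space_group P BL pc\<^esub> y \<otimes>\<^bsub>space_group P BL pc\<^esub> z =
      x \<otimes>\<^bsub>space_group P BL pc\<^esub> (y \<otimes>\<^bsub>space_group P BL pc\<^esub> z)"
    using pc_hom pc_orthogonal
    by (auto simp: space_group_def m_assoc orthogonal_transformation linear_add)
next
  fix x assume "x \<in> carrier (space_group P BL pc)"
  then show "\<one>\<^bsub>space_group P BL pc\<^esub> \<otimes>\<^bsub>space_group P BL pc\<^esub> x = x"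
    by (auto simp: space_group_def pc_one)
next
  fix x assume "x \<in> carrier (space_group P BL pc)"
  then obtain p R where x: "x = (p, R)" "p \<in> carrier P" "R \<in> BL"
    by (auto simp: space_group_def)
  then have "pc (inv p) R \<in> BL"
    using pc_lattice[of "inv p"] by auto
  then show "\<exists>y\<in>carrier (space_group P BL pc).
      y \<otimes>\<^bsub>space_group P BL pc\<^esub> x = \<one>\<^bsub>space_group P BL pc\<^esub>"
    using x lattice_uminus by (intro bexI[of _ "(inv p, - pc (inv p) R)"]) (auto simp: space_group_def)
qed

end


section \<open>Bands\<close>

definition band :: "('p, 'b) monoid_scheme \<Rightarrow> (real^'d) set \<Rightarrow> ('p \<Rightarrow> real^'d \<Rightarrow> real^'d)
    \<Rightarrow> ('p \<Rightarrow> real) \<Rightarrow> ('p \<Rightarrow> complex^'v \<Rightarrow> complex^'v) \<Rightarrow> nat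
    \<Rightarrow> (real^'d \<Rightarrow> ('d::finite, 'v::finite, 'm::finite) wavefun set) \<Rightarrow> bool" where
  "band P BL pc s D N E \<longleftrightarrow>
     (\<forall>k. E k \<subseteq> bloch BL k \<and> has_cdim N (E k)) \<and>
     (\<forall>k. \<forall>K\<in>reciprocal_lattice BL. E (k + K) = E k) \<and>
     (\<forall>g\<in>carrier (space_group P BL pc). \<forall>k.
        ghat P BL pc D g ` E k = E (s (fst g) *\<^sub>R pc (fst g) k))"

abbreviation simple_band where
  "simple_band P BL pc s D E \<equiv> band P BL pc s D 1 E"

text \<open>The orthogonal projection onto \<open>E k\<close>, unique up to almost everywhere equality.\<close>

definition band_proj :: "(real^'d) set \<Rightarrow> (real^'d \<Rightarrow> ('d::finite, 'v::finite, 'm::finite) wavefun set)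
    \<Rightarrow> real^'d \<Rightarrow> ('d, 'v, 'm) wavefun \<Rightarrow> ('d, 'v, 'm) wavefun" where
  "band_proj BL E k f =
     (SOME g. g \<in> E k \<and> (\<forall>h\<in>E k. cell_inner BL h (\<lambda>r. f r - g r) = 0))"


section \<open>Real-analytic maps\<close>

instantiation "fun" :: (type, real_vector) real_vector
begin

definition scaleR_fun :: "real \<Rightarrow> ('a \<Rightarrow> 'b) \<Rightarrow> 'a \<Rightarrow> 'b" where
  "scaleR_fun t f = (\<lambda>x. t *\<^sub>R f x)"

instance
  by standard (auto simp: scaleR_fun_def fun_eq_iff algebra_simps)

end

text \<open>Real-analyticity of a map on \<open>\<real>\<^sup>d\<close> with values in the space \<open>S\<close> (seminormed by \<open>nrm\<close>):
  near each point it is the sum of a normally convergent power series with coefficients in \<open>S\<close>.\<close>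

definition real_analytic_in :: "'f::real_vector set \<Rightarrow> ('f \<Rightarrow> real) \<Rightarrow> (real^'d \<Rightarrow> 'f) \<Rightarrow> bool" where
  "real_analytic_in S nrm u \<longleftrightarrow>
     (\<forall>k0. \<exists>\<rho>>0. \<exists>a :: ('d \<Rightarrow> nat) \<Rightarrow> 'f. (\<forall>\<alpha>. a \<alpha> \<in> S) \<and>
        (\<lambda>\<alpha>. nrm (a \<alpha>) * \<rho> ^ (\<Sum>i\<in>UNIV. \<alpha> i)) summable_on UNIV \<and>
        (\<forall>k. (\<forall>i. \<bar>k $ i - k0 $ i\<bar> < \<rho>) \<longrightarrow>
          ((\<lambda>F. nrm (u k - (\<Sum>\<alpha>\<in>F. (\<Prod>i\<in>UNIV. (k $ i - k0 $ i) ^ \<alpha> i) *\<^sub>R a \<alpha>))) \<longlongrightarrow> 0)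
            (finite_subsets_at_top UNIV)))"

text \<open>Periodic functions are the Bloch functions with wavevector \<open>0\<close>.\<close>

definition bounded_ops :: "(real^'d) set
    \<Rightarrow> (('d::finite, 'v::finite, 'm::finite) wavefun \<Rightarrow> ('d, 'v, 'm) wavefun) set" where
  "bounded_ops BL = {A.
     (\<forall>f\<in>bloch BL 0. A f \<in> bloch BL 0) \<and>
     (\<forall>f\<in>bloch BL 0. \<forall>g\<in>bloch BL 0. AE r in lborel. A (\<lambda>x. f x + g x) r = A f r + A g r) \<and>
     (\<forall>c. \<forall>f\<in>bloch BL 0. AE r in lborel. A (\<lambda>x. c *\<^sub>v f x) r = c *\<^sub>v A f r) \<and>
     (\<exists>C. \<forall>f\<in>bloch BL 0. cell_norm BL (A f) \<le> C * cell_norm BL f)}"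

definition op_norm :: "(real^'d) set
    \<Rightarrow> (('d::finite, 'v::finite, 'm::finite) wavefun \<Rightarrow> ('d, 'v, 'm) wavefun) \<Rightarrow> real" where
  "op_norm BL A = (SUP f\<in>{f \<in> bloch BL 0. cell_norm BL f \<le> 1}. cell_norm BL (A f))"

definition analytic_projection :: "(real^'d) set
    \<Rightarrow> (real^'d \<Rightarrow> ('d::finite, 'v::finite, 'm::finite) wavefun set) \<Rightarrow> bool" where
  "analytic_projection BL E \<longleftrightarrow>
     real_analytic_in (bounded_ops BL) (op_norm BL)
       (\<lambda>k f. phase (- k) (band_proj BL E k (phase k f)))"


section \<open>Frames, localizability, Wannier functions\<close>

definition orthonormal_frame :: "(real^'d) set
    \<Rightarrow> (real^'d \<Rightarrow> ('d::finite, 'v::finite, 'm::finite) wavefun set)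
    \<Rightarrow> 'j set \<Rightarrow> ('j \<Rightarrow> real^'d \<Rightarrow> ('d, 'v, 'm) wavefun) \<Rightarrow> bool" where
  "orthonormal_frame BL E J \<psi> \<longleftrightarrow> (\<forall>k.
     (\<forall>j\<in>J. \<psi> j k \<in> E k) \<and>
     (\<forall>i\<in>J. \<forall>j\<in>J. cell_inner BL (\<psi> i k) (\<psi> j k) = (if i = j then 1 else 0)) \<and>
     E k = lspan J (\<lambda>j. \<psi> j k))"

definition analytic_frame :: "(real^'d) set \<Rightarrow> 'j set
    \<Rightarrow> ('j \<Rightarrow> real^'d \<Rightarrow> ('d::finite, 'v::finite, 'm::finite) wavefun) \<Rightarrow> bool" where
  "analytic_frame BL J \<psi> \<longleftrightarrow>
     (\<forall>j\<in>J. real_analytic_in (bloch BL 0) (cell_norm BL) (\<lambda>k. phase (- k) (\<psi> j k)))"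

definition periodic_frame :: "(real^'d) set \<Rightarrow> 'j set
    \<Rightarrow> ('j \<Rightarrow> real^'d \<Rightarrow> ('d::finite, 'v::finite, 'm::finite) wavefun) \<Rightarrow> bool" where
  "periodic_frame BL J \<psi> \<longleftrightarrow>
     (\<forall>j\<in>J. \<forall>k. \<forall>K\<in>reciprocal_lattice BL. AE r in lborel. \<psi> j (k + K) r = \<psi> j k r)"

definition localizable :: "(real^'d) set \<Rightarrow> nat
    \<Rightarrow> (real^'d \<Rightarrow> ('d::finite, 'v::finite, 'm::finite) wavefun set) \<Rightarrow> bool" where
  "localizable BL N E \<longleftrightarrow>
     (\<exists>\<psi>. orthonormal_frame BL E {..<N} \<psi> \<and> analytic_frame BL {..<N} \<psi> \<and> periodic_frame BL {..<N} \<psi>)"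

text \<open>\<open>wannier BL \<psi> R w\<close> says that \<open>w\<close> is the Wannier function at \<open>R\<close> of \<open>\<psi>\<close>. As each
  \<open>\<psi> k\<close> is only given almost everywhere, the integral over the Brillouin torus is that of an
  \<open>L\<^sup>2\<^sub>l\<^sub>o\<^sub>c\<close>-valued map; it is characterized by pairing with square-integrable functions of
  bounded support.\<close>

definition wannier :: "(real^'d) set \<Rightarrow> (real^'d \<Rightarrow> ('d::finite, 'v::finite, 'm::finite) wavefun)
    \<Rightarrow> real^'d \<Rightarrow> ('d, 'v, 'm) wavefun \<Rightarrow> bool" where
  "wannier BL \<psi> R w \<longleftrightarrow> w \<in> l2loc \<and>
     (\<forall>h\<in>l2loc. bounded {r. h r \<noteq> 0} \<longrightarrow>
        (LINT r|lborel. val_inner (h r) (w r)) =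
          of_real (1 / sqrt (measure lborel (unit_cell (reciprocal_lattice BL)))) *
          (LINT k:unit_cell (reciprocal_lattice BL)|lborel.
             cis (- (k \<bullet> R)) * (LINT r|lborel. val_inner (h r) (\<psi> k r))))"


section \<open>Band representations\<close>

definition sites :: "(real^'d) set \<Rightarrow> nat \<Rightarrow> (nat \<Rightarrow> real^'d) \<Rightarrow> (real^'d) set" where
  "sites BL M \<omega> = {\<omega> n + R | n R. n < M \<and> R \<in> BL}"

text \<open>The space \<open>W\<^sub>x\<close> of a site \<open>x = \<omega> n + R\<close>, where site \<open>n\<close> of the unit cell carries the
  Wannier functions indexed by \<open>\<alpha> < A n\<close>.\<close>

definition site_space :: "(real^'d) set \<Rightarrow> nat \<Rightarrow> (nat \<Rightarrow> real^'d) \<Rightarrow> (nat \<Rightarrow> nat)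
    \<Rightarrow> (nat \<times> nat \<Rightarrow> real^'d \<Rightarrow> ('d::finite, 'v::finite, 'm::finite) wavefun)
    \<Rightarrow> real^'d \<Rightarrow> ('d, 'v, 'm) wavefun set" where
  "site_space BL M \<omega> A \<psi> x = {f. \<exists>n<M. \<exists>R\<in>BL. x = \<omega> n + R \<and>
     (\<exists>w. (\<forall>\<alpha><A n. wannier BL (\<psi> (n, \<alpha>)) R (w \<alpha>)) \<and> f \<in> lspan {..<A n} w)}"

definition band_representation :: "('p, 'b) monoid_scheme \<Rightarrow> (real^'d) set
    \<Rightarrow> ('p \<Rightarrow> real^'d \<Rightarrow> real^'d) \<Rightarrow> ('p \<Rightarrow> complex^'v \<Rightarrow> complex^'v)
    \<Rightarrow> (real^'d \<Rightarrow> ('d::finite, 'v::finite, 'm::finite) wavefun set) \<Rightarrow> bool" where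
  "band_representation P BL pc D E \<longleftrightarrow>
     (\<exists>M \<omega> A \<psi>.
        (\<forall>n<M. 0 < A n) \<and>
        (\<forall>n<M. \<forall>n'<M. \<omega> n - \<omega> n' \<in> BL \<longrightarrow> n = n') \<and>
        (\<forall>g\<in>carrier (space_group P BL pc). act pc g ` sites BL M \<omega> = sites BL M \<omega>) \<and>
        orthonormal_frame BL E (SIGMA n:{..<M}. {..<A n}) \<psi> \<and>
        analytic_frame BL (SIGMA n:{..<M}. {..<A n}) \<psi> \<and>
        periodic_frame BL (SIGMA n:{..<M}. {..<A n}) \<psi> \<and>
        (\<forall>g\<in>carrier (space_group P BL pc). \<forall>x\<in>sites BL M \<omega>.
           ghat P BL pc D g ` site_space BL M \<omega> A \<psi> x = site_space BL M \<omega> A \<psi> (act pc g x)))"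

definition localizable_topological :: "('p, 'b) monoid_scheme \<Rightarrow> (real^'d) set
    \<Rightarrow> ('p \<Rightarrow> real^'d \<Rightarrow> real^'d) \<Rightarrow> ('p \<Rightarrow> real) \<Rightarrow> ('p \<Rightarrow> complex^'v \<Rightarrow> complex^'v)
    \<Rightarrow> nat \<Rightarrow> (real^'d \<Rightarrow> ('d::finite, 'v::finite, 'm::finite) wavefun set) \<Rightarrow> bool" where
  "localizable_topological P BL pc s D N E \<longleftrightarrow>
     band P BL pc s D N E \<and> localizable BL N E \<and> \<not> band_representation P BL pc D E"


section \<open>First Chern class of a simple band\<close>

text \<open>The torus \<open>\<real>\<^sup>d / L\<close> is an Eilenberg-MacLane space for \<open>L\<close>, so its integral second
  cohomology is the group cohomology \<open>H\<^sup>2(L; \<int>)\<close>, the 2-cocycles on \<open>L\<close> modulo the following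
  2-coboundaries. A class is represented by the set of its cocycles, so the zero class is the set
  of coboundaries. (Values of cochains off \<open>L\<close> are irrelevant.)\<close>

definition coboundaries2 :: "(real^'d) set \<Rightarrow> (real^'d \<Rightarrow> real^'d \<Rightarrow> int) set" where
  "coboundaries2 L = {c. \<exists>b. \<forall>K\<in>L. \<forall>K'\<in>L. c K K' = b K' - b (K + K') + b K}"

text \<open>The first Chern class of a line bundle is the image of its transition functions under the
  connecting homomorphism of \<open>0 \<rightarrow> \<int> \<rightarrow> C \<rightarrow> C\<^sup>* \<rightarrow> 0\<close>. For the line bundle over
  \<open>\<real>\<^sup>d / L\<close> with fibre \<open>E k\<close> at \<open>k\<close>, where \<open>L\<close> is the reciprocal lattice, this is computed on the
  universal cover: for a continuous normalized section \<open>\<sigma>\<close> over \<open>\<real>\<^sup>d\<close> write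
  \<open>\<sigma> (k + K) = exp (2\<pi>i f K k) \<sigma> k\<close> with \<open>f K\<close> real and continuous; the class is that of the
  integer-valued group coboundary of \<open>f\<close>. For a continuous rank-one band the choices of
  \<open>\<sigma>\<close> and \<open>f\<close> range precisely over the representatives of one class.
  The sign is such that \<open>c K K' - c K' K\<close> is the degree of the bundle
  over the 2-torus oriented by \<open>(K, K')\<close>.\<close>

definition first_chern_class :: "(real^'d) set
    \<Rightarrow> (real^'d \<Rightarrow> ('d::finite, 'v::finite, 'm::finite) wavefun set)
    \<Rightarrow> (real^'d \<Rightarrow> real^'d \<Rightarrow> int) set" where
  "first_chern_class BL E = {c. \<exists>\<sigma> f.
     (\<forall>k. \<sigma> k \<in> E k \<and> cell_norm BL (\<sigma> k) = 1) \<and>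
     (\<forall>k0. ((\<lambda>k. cell_norm BL (phase (- k) (\<sigma> k) - phase (- k0) (\<sigma> k0))) \<longlongrightarrow> 0) (at k0)) \<and>
     (\<forall>K\<in>reciprocal_lattice BL. continuous_on UNIV (f K) \<and>
        (\<forall>k. AE r in lborel. \<sigma> (k + K) r = cis (2 * pi * f K k) *\<^sub>v \<sigma> k r)) \<and>
     (\<forall>K\<in>reciprocal_lattice BL. \<forall>K'\<in>reciprocal_lattice BL. \<forall>k.
        real_of_int (c K K') = f K' (k + K) - f (K + K') k + f K k)}"

end

theory Submission
  imports Defs "HOL-Complex_Analysis.Cauchy_Integral_Formula"
begin

text \<open>For a localizable simple band with section \<open>\<psi>\<close>, a point operation \<open>p\<close> multiplies \<open>\<psi>\<close> by an
  analytic periodic phase \<open>exp (i \<theta>\<^sub>p)\<close>, and the \<open>\<theta>\<^sub>p\<close> form a cocycle up to constants in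
  \<open>2\<pi>\<int>\<close>. Averaging it over the finite point group gives \<open>\<chi> = - |P|\<^sup>-\<^sup>1 \<Sum>\<^sub>q s\<^sub>q \<theta>\<^sub>q\<close>, which
  trivializes it and satisfies \<open>\<chi> (k + K) = \<chi> k + w \<bullet> K\<close> for some vector \<open>w\<close>. In the periodic gauge
  \<open>exp (i (\<chi> k - w \<bullet> k)) \<psi> k\<close> only constants and the phases of translations by the
  lattice vectors \<open>p w - w\<close> remain, so the Wannier functions are induced from the site \<open>w\<close>.

  If the first Chern class vanishes, the quasi-periodicity phases of a continuous section are
  removed by averaging over translates of a compactly supported weight, which leaves a continuous
  periodic section \<open>\<psi>\<close>. Projecting finitely many analytic periodic families of functions onto
  the band gives analytic periodic sections \<open>c\<^sub>j \<psi>\<close> without common zero; combining them with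
  trigonometric polynomials close to the conjugates of \<open>c\<^sub>j\<close> and normalizing gives an analytic
  periodic frame.\<close>

unbundle no fps_syntax

text \<open>Rank one enters through scalars: on a line each point operation is a nonvanishing
  factor, and such a factor has a continuous logarithm because the space of wavevectors is
  contractible. Logarithms are real-valued and can be divided by the group order, an average that
  has no meaning for the phases themselves. What survives of integrality is one constant per
  operation, carried by the Wannier function as a phase, and the winding numbers of the phases along
  reciprocal vectors. Averages of these windings determine \<open>site\<close>, which is how a point
  off the lattice can arise.

  Two obstacles shape the rest. Wavefunctions are representatives of almost-everywhere classes, so
  norms are seminorms and operators are linear only up to null functions; power series are developed
  in that generality. And a vanishing Chern class yields no more than a continuous section, whereas
  analyticity is given for the projection. Analytic sections therefore come from projecting analytic
  vectors, and the continuous section enters only through open conditions such as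
  nonvanishing.\<close>

lemma eventually_at_top_witness:
  assumes "\<forall>\<^sub>F F in finite_subsets_at_top UNIV. P F"
  obtains F where "finite F" "P F"
  using assms unfolding eventually_finite_subsets_at_top by auto

section \<open>Monomials and degrees of multi-indices\<close>

definition mpow :: "real^'d \<Rightarrow> ('d \<Rightarrow> nat) \<Rightarrow> real" where
  "mpow x \<alpha> = (\<Prod>i\<in>UNIV. (x $ i) ^ \<alpha> i)"

definition deg :: "('d::finite \<Rightarrow> nat) \<Rightarrow> nat" where
  "deg \<alpha> = (\<Sum>i\<in>UNIV. \<alpha> i)"

lemma mpow_add: "mpow x (\<alpha> + \<beta>) = mpow x \<alpha> * mpow x \<beta>"
  by (simp add: mpow_def power_add prod.distrib)

lemma deg_add: "deg (\<alpha> + \<beta>) = deg \<alpha> + deg \<beta>"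
  by (simp add: deg_def sum.distrib)

lemma mpow_zero: "mpow x 0 = 1" and deg_zero: "deg 0 = 0"
  by (simp_all add: mpow_def deg_def)

lemma abs_mpow_le:
  assumes "\<And>i. \<bar>x $ i\<bar> < \<rho>"
  shows "\<bar>mpow x \<alpha>\<bar> \<le> \<rho> ^ deg \<alpha>"
proof -
  have "\<bar>mpow x \<alpha>\<bar> = (\<Prod>i\<in>UNIV. \<bar>x $ i\<bar> ^ \<alpha> i)"
    by (simp add: mpow_def abs_prod power_abs)
  also have "\<dots> \<le> (\<Prod>i\<in>UNIV. \<rho> ^ \<alpha> i)"
    using assms by (intro prod_mono) (simp add: power_mono less_imp_le)
  finally show ?thesis by (simp add: deg_def power_sum)
qed

lemma mpow_origin: "mpow 0 \<alpha> = (if \<alpha> = 0 then 1 else 0)"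
proof (cases "\<alpha> = 0")
  case False
  then obtain i where "\<alpha> i \<noteq> 0" by (auto simp: fun_eq_iff)
  then have "(0::real) ^ \<alpha> i = 0" by simp
  then have "mpow 0 \<alpha> = 0" unfolding mpow_def by (intro prod_zero) (auto intro!: exI[of _ i])
  with False show ?thesis by simp
qed (simp add: mpow_zero)

lemma finite_le_multiindex: "finite {\<alpha>::'d::finite \<Rightarrow> nat. \<alpha> \<le> \<gamma>}"
proof -
  have "{\<alpha>. \<alpha> \<le> \<gamma>} = (\<Pi>\<^sub>E i\<in>UNIV. {..\<gamma> i})" by (auto simp: le_fun_def PiE_iff)
  then show ?thesis by (simp add: finite_PiE)
qed

subsection \<open>Seminormed spaces and bilinear maps modulo null vectors\<close>

text \<open>Wavefunctions and operators are kept as representatives, so a nonzero element may have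
  norm 0, and \<open>S\<close> cuts the admissible elements out of a full function type. The
  inequality \<open>nrm_scale\<close> yields equality for \<open>r \<noteq> 0\<close> when it is
  also applied to \<open>1 / r\<close>.\<close>

locale seminormed =
  fixes S :: "'f::real_vector set" and nrm :: "'f \<Rightarrow> real"
  assumes zero: "0 \<in> S"
    and add: "x \<in> S \<Longrightarrow> y \<in> S \<Longrightarrow> x + y \<in> S"
    and scale: "x \<in> S \<Longrightarrow> r *\<^sub>R x \<in> S"
    and nrm_nonneg: "x \<in> S \<Longrightarrow> 0 \<le> nrm x"
    and nrm_add: "x \<in> S \<Longrightarrow> y \<in> S \<Longrightarrow> nrm (x + y) \<le> nrm x + nrm y"
    and nrm_scale: "x \<in> S \<Longrightarrow> nrm (r *\<^sub>R x) \<le> \<bar>r\<bar> * nrm x"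
begin

lemma nrm_zero: "nrm 0 = 0"
  using nrm_scale[of 0 0] nrm_nonneg[OF zero] zero by simp

lemma diff: "x \<in> S \<Longrightarrow> y \<in> S \<Longrightarrow> x - y \<in> S"
  using add[of x "(-1) *\<^sub>R y"] scale[of y "-1"] by simp

lemma nrm_diff: "x \<in> S \<Longrightarrow> y \<in> S \<Longrightarrow> nrm (x - y) \<le> nrm x + nrm y"
  using nrm_add[of x "(-1) *\<^sub>R y"] nrm_scale[of y "-1"] scale[of y "-1"] by simp

lemma nrm_triangle: "x \<in> S \<Longrightarrow> y \<in> S \<Longrightarrow> z \<in> S \<Longrightarrow> nrm (x - z) \<le> nrm (x - y) + nrm (y - z)"
  using nrm_add[of "x - y" "y - z"] diff by simp

lemma nrm_le_diff: "x \<in> S \<Longrightarrow> y \<in> S \<Longrightarrow> nrm x \<le> nrm (x - y) + nrm y"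
  using nrm_triangle[of x y 0] zero by simp

lemma nrm_minus_commute: "x \<in> S \<Longrightarrow> y \<in> S \<Longrightarrow> nrm (x - y) = nrm (y - x)"
  using nrm_scale[of "x - y" "-1"] nrm_scale[of "y - x" "-1"] diff[of x y] diff[of y x] by simp

lemma sum_mem: "(\<And>i. i \<in> I \<Longrightarrow> f i \<in> S) \<Longrightarrow> sum f I \<in> S"
  by (induction I rule: infinite_finite_induct) (auto intro: zero add)

lemma nrm_sum: "(\<And>i. i \<in> I \<Longrightarrow> f i \<in> S) \<Longrightarrow> nrm (sum f I) \<le> (\<Sum>i\<in>I. nrm (f i))"
proof (induction I rule: infinite_finite_induct)
  case (insert i I)
  have "nrm (f i + sum f I) \<le> nrm (f i) + nrm (sum f I)"
    using insert.prems by (intro nrm_add sum_mem) auto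
  then show ?case using insert by fastforce
qed (simp_all add: nrm_zero)

end

text \<open>The slots are treated differently because of operator application: sums of operators act
  pointwise, so the left slot is additive on the nose, whereas \<open>T (f + g)\<close> and
  \<open>T f + T g\<close> agree only almost everywhere. The other instances are the cell inner
  product and multiplication by complex scalars; linearity is over the reals, so that
  conjugate-linear slots qualify.\<close>

locale null_bilinear =
  S1: seminormed S1 n1 + S2: seminormed S2 n2 + S3: seminormed S3 n3
  for S1 :: "'f::real_vector set" and n1 and S2 :: "'g::real_vector set" and n2
    and S3 :: "'h::real_vector set" and n3 +
  fixes B :: "'f \<Rightarrow> 'g \<Rightarrow> 'h" and C :: real
  assumes C_nonneg: "0 \<le> C"
    and mem: "x \<in> S1 \<Longrightarrow> y \<in> S2 \<Longrightarrow> B x y \<in> S3"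
    and bound: "x \<in> S1 \<Longrightarrow> y \<in> S2 \<Longrightarrow> n3 (B x y) \<le> C * n1 x * n2 y"
    and add_left: "x \<in> S1 \<Longrightarrow> x' \<in> S1 \<Longrightarrow> y \<in> S2 \<Longrightarrow> B (x + x') y = B x y + B x' y"
    and scale_left: "x \<in> S1 \<Longrightarrow> y \<in> S2 \<Longrightarrow> B (r *\<^sub>R x) y = r *\<^sub>R B x y"
    and add_right: "x \<in> S1 \<Longrightarrow> y \<in> S2 \<Longrightarrow> y' \<in> S2 \<Longrightarrow> n3 (B x (y + y') - (B x y + B x y')) = 0"
    and scale_right: "x \<in> S1 \<Longrightarrow> y \<in> S2 \<Longrightarrow> n3 (B x (r *\<^sub>R y) - r *\<^sub>R B x y) = 0"
begin

lemma zero_left: "y \<in> S2 \<Longrightarrow> B 0 y = 0"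
  using scale_left[of 0 y 0] S1.zero by simp

lemma sum_left: "(\<And>i. i \<in> I \<Longrightarrow> f i \<in> S1) \<Longrightarrow> y \<in> S2 \<Longrightarrow>
    B (\<Sum>i\<in>I. t i *\<^sub>R f i) y = (\<Sum>i\<in>I. t i *\<^sub>R B (f i) y)"
proof (induction I rule: infinite_finite_induct)
  case (insert i I)
  then show ?case
    by (auto simp: add_left scale_left S1.scale S1.sum_mem)
qed (auto simp: zero_left)

lemma sum_right: "(\<And>i. i \<in> I \<Longrightarrow> f i \<in> S2) \<Longrightarrow> x \<in> S1 \<Longrightarrow>
    n3 (B x (\<Sum>i\<in>I. t i *\<^sub>R f i) - (\<Sum>i\<in>I. t i *\<^sub>R B x (f i))) = 0"
proof (induction I rule: infinite_finite_induct)
  case (infinite I)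
  then show ?case using scale_right[of x 0 0] S2.zero by simp
next
  case empty
  then show ?case using scale_right[of x 0 0] S2.zero by simp
next
  case (insert i I)
  let ?s = "\<Sum>i\<in>I. t i *\<^sub>R f i" and ?r = "\<Sum>i\<in>I. t i *\<^sub>R B x (f i)"
  have m: "?s \<in> S2" "f i \<in> S2" "t i *\<^sub>R f i \<in> S2"
    using insert.prems by (auto intro!: S2.sum_mem S2.scale)
  have m3: "B x ?s \<in> S3" "B x (t i *\<^sub>R f i) \<in> S3" "B x (t i *\<^sub>R f i + ?s) \<in> S3"
    "t i *\<^sub>R B x (f i) \<in> S3" "?r \<in> S3"
    using m insert.prems by (auto intro!: mem S2.add S3.sum_mem S3.scale)
  \<comment> \<open>The defect of the enlarged sum splits into three defects, null by
    \<open>add_right\<close>, by \<open>scale_right\<close> and by the induction hypothesis.\<close>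
  have "B x (t i *\<^sub>R f i + ?s) - (t i *\<^sub>R B x (f i) + ?r) =
     (B x (t i *\<^sub>R f i + ?s) - (B x (t i *\<^sub>R f i) + B x ?s)) +
     ((B x (t i *\<^sub>R f i) - t i *\<^sub>R B x (f i)) + (B x ?s - ?r))" by simp
  also have "n3 \<dots> \<le> n3 (B x (t i *\<^sub>R f i + ?s) - (B x (t i *\<^sub>R f i) + B x ?s)) +
     (n3 (B x (t i *\<^sub>R f i) - t i *\<^sub>R B x (f i)) + n3 (B x ?s - ?r))"
    using m3 by (intro order_trans[OF S3.nrm_add] add_mono order_refl S3.nrm_add S3.diff S3.add) auto
  also have "\<dots> = 0"
    using add_right[of x "t i *\<^sub>R f i" ?s] scale_right[of x "f i" "t i"] m insert by auto
  finally have "n3 (B x (t i *\<^sub>R f i + ?s) - (t i *\<^sub>R B x (f i) + ?r)) \<le> 0" .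
  moreover have "0 \<le> n3 (B x (t i *\<^sub>R f i + ?s) - (t i *\<^sub>R B x (f i) + ?r))"
    using m3 by (intro S3.nrm_nonneg S3.diff S3.add) auto
  ultimately show ?case using insert by simp
qed

lemma sum_both:
  assumes "\<And>i. i \<in> I \<Longrightarrow> f i \<in> S1" "\<And>j. j \<in> J \<Longrightarrow> g j \<in> S2"
  shows "n3 (B (\<Sum>i\<in>I. t i *\<^sub>R f i) (\<Sum>j\<in>J. u j *\<^sub>R g j) -
     (\<Sum>(i,j)\<in>I \<times> J. (t i * u j) *\<^sub>R B (f i) (g j))) = 0" (is "n3 (?l - ?r) = 0")
proof -
  let ?g = "\<Sum>j\<in>J. u j *\<^sub>R g j"
  let ?h = "\<lambda>i. t i *\<^sub>R (B (f i) ?g - (\<Sum>j\<in>J. u j *\<^sub>R B (f i) (g j)))"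
  have g: "?g \<in> S2" using assms by (auto intro!: S2.sum_mem S2.scale)
  have d: "B (f i) ?g - (\<Sum>j\<in>J. u j *\<^sub>R B (f i) (g j)) \<in> S3" if "i \<in> I" for i
    using assms that g by (auto intro!: S3.sum_mem S3.diff mem S3.scale)
  have h: "?h i \<in> S3" if "i \<in> I" for i using d that by (auto intro: S3.scale)
  have "?r = (\<Sum>i\<in>I. \<Sum>j\<in>J. (t i * u j) *\<^sub>R B (f i) (g j))"
    by (simp add: sum.cartesian_product)
  also have "\<dots> = (\<Sum>i\<in>I. t i *\<^sub>R (\<Sum>j\<in>J. u j *\<^sub>R B (f i) (g j)))"
    by (simp add: scaleR_sum_right)
  finally have "?l - ?r = (\<Sum>i\<in>I. ?h i)"
    using sum_left[of I f ?g t] assms g by (simp add: sum_subtractf scaleR_diff_right)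
  moreover have "n3 (\<Sum>i\<in>I. ?h i) \<le> (\<Sum>i\<in>I. n3 (?h i))"
    using h by (rule S3.nrm_sum)
  moreover have "n3 (?h i) \<le> 0" if "i \<in> I" for i
    using S3.nrm_scale[OF d[OF that], of "t i"] sum_right[of J g "f i" u] assms that by simp
  moreover have "0 \<le> n3 (\<Sum>i\<in>I. ?h i)" using h by (intro S3.nrm_nonneg S3.sum_mem)
  ultimately show ?thesis using sum_nonpos[of I "\<lambda>i. n3 (?h i)"] by simp
qed

text \<open>One slot is varied at a time; varying the right one costs an extra defect, which is null
  by \<open>add_right\<close>.\<close>

lemma diff_bound:
  assumes "x \<in> S1" "x' \<in> S1" "y \<in> S2" "y' \<in> S2"
  shows "n3 (B x y - B x' y') \<le> C * (n1 (x - x') * n2 y + n1 x' * n2 (y - y'))"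
proof -
  have "B x y = B (x - x') y + B x' y"
    using add_left[of "x - x'" x' y] assms S1.diff by simp
  then have 1: "n3 (B x y - B x' y) \<le> C * (n1 (x - x') * n2 y)"
    using bound[of "x - x'" y] assms S1.diff by (simp add: mult.assoc)
  have "n3 (B x' y - (B x' y' + B x' (y - y'))) = 0"
    using add_right[of x' y' "y - y'"] assms S2.diff by simp
  moreover have "n3 (B x' y - B x' y') \<le>
      n3 (B x' y - (B x' y' + B x' (y - y'))) + n3 (B x' (y - y'))"
    using S3.nrm_add[of "B x' y - (B x' y' + B x' (y - y'))" "B x' (y - y')"] assms
    by (simp add: mem S2.diff S3.diff S3.add)
  moreover have "n3 (B x' (y - y')) \<le> C * (n1 x' * n2 (y - y'))"
    using bound[of x' "y - y'"] assms S2.diff by (simp add: mult.assoc)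
  ultimately have 2: "n3 (B x' y - B x' y') \<le> C * (n1 x' * n2 (y - y'))" by simp
  have "n3 (B x y - B x' y') \<le> n3 (B x y - B x' y) + n3 (B x' y - B x' y')"
    using assms by (intro S3.nrm_triangle mem)
  with 1 2 show ?thesis by (simp add: distrib_left)
qed

end

subsection \<open>Normally convergent power series\<close>

definition expansion :: "'f::real_vector set \<Rightarrow> ('f \<Rightarrow> real) \<Rightarrow> real \<Rightarrow> (real^'d \<Rightarrow> 'f) \<Rightarrow> (('d \<Rightarrow> nat) \<Rightarrow> 'f) \<Rightarrow> bool" where
  "expansion S nrm \<rho> f a \<longleftrightarrow>
     (\<forall>\<alpha>. a \<alpha> \<in> S) \<and> (\<lambda>\<alpha>. nrm (a \<alpha>) * \<rho> ^ deg \<alpha>) summable_on UNIV \<and>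
     (\<forall>x. (\<forall>i. \<bar>x $ i\<bar> < \<rho>) \<longrightarrow>
       ((\<lambda>F. nrm (f x - (\<Sum>\<alpha>\<in>F. mpow x \<alpha> *\<^sub>R a \<alpha>))) \<longlongrightarrow> 0) (finite_subsets_at_top UNIV))"

text \<open>\<open>M\<close> dominates the majorant norm of the coefficients on the cube of
  half-side \<open>\<rho>\<close>. Under a bilinear map these bounds multiply, which makes
  substitution into an infinite series controllable.\<close>

definition normal_series :: "'f::real_vector set \<Rightarrow> ('f \<Rightarrow> real) \<Rightarrow> real \<Rightarrow> real \<Rightarrow> (real^'d \<Rightarrow> 'f) \<Rightarrow> bool" where
  "normal_series S nrm \<rho> M f \<longleftrightarrow>
     (\<exists>a. expansion S nrm \<rho> f a \<and> (\<Sum>\<^sub>\<infinity>\<alpha>. nrm (a \<alpha>) * \<rho> ^ deg \<alpha>) \<le> M)"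

definition analytic_near :: "'f::real_vector set \<Rightarrow> ('f \<Rightarrow> real) \<Rightarrow> (real^'d \<Rightarrow> 'f) \<Rightarrow> real^'d \<Rightarrow> bool" where
  "analytic_near S nrm u k0 \<longleftrightarrow> (\<exists>\<rho>>0. \<exists>M. normal_series S nrm \<rho> M (\<lambda>x. u (k0 + x)))"

lemma expansionD:
  assumes "expansion S nrm \<rho> f a"
  shows "a \<alpha> \<in> S" "(\<lambda>\<alpha>. nrm (a \<alpha>) * \<rho> ^ deg \<alpha>) summable_on UNIV"
    "(\<And>i. \<bar>x $ i\<bar> < \<rho>) \<Longrightarrow>
       ((\<lambda>F. nrm (f x - (\<Sum>\<alpha>\<in>F. mpow x \<alpha> *\<^sub>R a \<alpha>))) \<longlongrightarrow> 0) (finite_subsets_at_top UNIV)"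
  using assms unfolding expansion_def by simp_all

lemma expansionI:
  assumes "\<And>\<alpha>. a \<alpha> \<in> S" "(\<lambda>\<alpha>. nrm (a \<alpha>) * \<rho> ^ deg \<alpha>) summable_on UNIV"
    "\<And>x. (\<And>i. \<bar>x $ i\<bar> < \<rho>) \<Longrightarrow>
       ((\<lambda>F. nrm (f x - (\<Sum>\<alpha>\<in>F. mpow x \<alpha> *\<^sub>R a \<alpha>))) \<longlongrightarrow> 0) (finite_subsets_at_top UNIV)"
  shows "expansion S nrm \<rho> f a"
  using assms unfolding expansion_def by simp

text \<open>Moves the centre of each expansion to the origin, where all computations with series
  take place.\<close>

lemma real_analytic_in_iff: "real_analytic_in S nrm u \<longleftrightarrow> (\<forall>k0. analytic_near S nrm u k0)"
proof -
  have shift: "(\<forall>k. (\<forall>i. \<bar>k $ i - k0 $ i\<bar> < \<rho>) \<longrightarrow> P k) \<longleftrightarrow> (\<forall>x. (\<forall>i. \<bar>x $ i\<bar> < \<rho>) \<longrightarrow> P (k0 + x))"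
    for P \<rho> and k0 :: "real^'d"
  proof (intro iffI allI impI)
    fix k assume "\<forall>x. (\<forall>i. \<bar>x $ i\<bar> < \<rho>) \<longrightarrow> P (k0 + x)" "\<forall>i. \<bar>k $ i - k0 $ i\<bar> < \<rho>"
    then show "P k" by (drule_tac x="k - k0" in spec) simp
  qed (auto dest: spec[of _ "k0 + _"])
  have "(\<exists>a. (\<forall>\<alpha>. a \<alpha> \<in> S) \<and>
        (\<lambda>\<alpha>. nrm (a \<alpha>) * \<rho> ^ (\<Sum>i\<in>UNIV. \<alpha> i)) summable_on UNIV \<and>
        (\<forall>k. (\<forall>i. \<bar>k $ i - k0 $ i\<bar> < \<rho>) \<longrightarrow>
          ((\<lambda>F. nrm (u k - (\<Sum>\<alpha>\<in>F. (\<Prod>i\<in>UNIV. (k $ i - k0 $ i) ^ \<alpha> i) *\<^sub>R a \<alpha>))) \<longlongrightarrow> 0)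
            (finite_subsets_at_top UNIV))) \<longleftrightarrow> (\<exists>M. normal_series S nrm \<rho> M (\<lambda>x. u (k0 + x)))" for \<rho> k0
  proof -
    have "(\<forall>k. (\<forall>i. \<bar>k $ i - k0 $ i\<bar> < \<rho>) \<longrightarrow>
          ((\<lambda>F. nrm (u k - (\<Sum>\<alpha>\<in>F. (\<Prod>i\<in>UNIV. (k $ i - k0 $ i) ^ \<alpha> i) *\<^sub>R a \<alpha>))) \<longlongrightarrow> 0)
            (finite_subsets_at_top UNIV)) \<longleftrightarrow>
      (\<forall>x. (\<forall>i. \<bar>x $ i\<bar> < \<rho>) \<longrightarrow>
          ((\<lambda>F. nrm (u (k0 + x) - (\<Sum>\<alpha>\<in>F. mpow x \<alpha> *\<^sub>R a \<alpha>))) \<longlongrightarrow> 0)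
            (finite_subsets_at_top UNIV))" for a
      by (subst shift) (simp add: mpow_def)
    then show ?thesis
      unfolding normal_series_def expansion_def deg_def by auto
  qed
  then show ?thesis
    unfolding real_analytic_in_def analytic_near_def by simp
qed

lemma normal_series_shrink:
  assumes "seminormed S nrm" "normal_series S nrm \<rho> M f" "0 \<le> \<rho>'" "\<rho>' \<le> \<rho>"
  shows "normal_series S nrm \<rho>' M f"
proof -
  interpret seminormed S nrm by fact
  obtain a where e: "expansion S nrm \<rho> f a" and M: "(\<Sum>\<^sub>\<infinity>\<alpha>. nrm (a \<alpha>) * \<rho> ^ deg \<alpha>) \<le> M"
    using assms(2) unfolding normal_series_def by blast
  note a = expansionD[OF e]
  have le: "nrm (a \<alpha>) * \<rho>' ^ deg \<alpha> \<le> nrm (a \<alpha>) * \<rho> ^ deg \<alpha>" for \<alpha>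
    using assms a(1) by (intro mult_left_mono power_mono nrm_nonneg)
  have s: "(\<lambda>\<alpha>. nrm (a \<alpha>) * \<rho>' ^ deg \<alpha>) summable_on UNIV"
    using a(1) le assms by (intro summable_on_comparison_test[OF a(2)]) (auto intro!: mult_nonneg_nonneg nrm_nonneg)
  have "(\<Sum>\<^sub>\<infinity>\<alpha>. nrm (a \<alpha>) * \<rho>' ^ deg \<alpha>) \<le> (\<Sum>\<^sub>\<infinity>\<alpha>. nrm (a \<alpha>) * \<rho> ^ deg \<alpha>)"
    using le by (intro infsum_mono s a(2))
  with M have "(\<Sum>\<^sub>\<infinity>\<alpha>. nrm (a \<alpha>) * \<rho>' ^ deg \<alpha>) \<le> M" by simp
  moreover have "expansion S nrm \<rho>' f a"
    using a s assms(4) by (intro expansionI) (auto intro: order_less_le_trans)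
  ultimately show ?thesis
    unfolding normal_series_def by blast
qed

text \<open>The Cauchy product; its majorant is the convolution of the two majorants. No
  completeness is at hand and \<open>B\<close> respects sums in the right slot only up to null
  vectors, so convergence is obtained by direct comparison with \<open>B\<close> of finite partial
  sums.\<close>

lemma (in null_bilinear) normal_series_bilinear:
  fixes f :: "real^'d \<Rightarrow> 'f" and g :: "real^'d \<Rightarrow> 'g"
  assumes f: "normal_series S1 n1 \<rho> M1 f" and g: "normal_series S2 n2 \<rho> M2 g"
    and \<rho>: "0 \<le> \<rho>" and fS: "\<And>x. f x \<in> S1" and gS: "\<And>x. g x \<in> S2"
  shows "normal_series S3 n3 \<rho> (C * (M1 * M2)) (\<lambda>x. B (f x) (g x))"
proof -
  obtain a where ea: "expansion S1 n1 \<rho> f a" and aM: "(\<Sum>\<^sub>\<infinity>\<alpha>. n1 (a \<alpha>) * \<rho> ^ deg \<alpha>) \<le> M1"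
    using f unfolding normal_series_def by blast
  obtain b where eb: "expansion S2 n2 \<rho> g b" and bM: "(\<Sum>\<^sub>\<infinity>\<alpha>. n2 (b \<alpha>) * \<rho> ^ deg \<alpha>) \<le> M2"
    using g unfolding normal_series_def by blast
  note a = expansionD(1,2)[OF ea] and b = expansionD(1,2)[OF eb]
  define N where "N \<alpha> = n1 (a \<alpha>) * \<rho> ^ deg \<alpha>" for \<alpha>
  define N' where "N' \<alpha> = n2 (b \<alpha>) * \<rho> ^ deg \<alpha>" for \<alpha>
  define c where "c \<gamma> = (\<Sum>\<alpha>\<in>{\<alpha>. \<alpha> \<le> \<gamma>}. B (a \<alpha>) (b (\<gamma> - \<alpha>)))" for \<gamma>
  have N0: "0 \<le> N \<alpha>" "0 \<le> N' \<alpha>" for \<alpha>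
    using \<rho> a b by (auto simp: N_def N'_def S1.nrm_nonneg S2.nrm_nonneg)
  let ?T = "infsum N UNIV * infsum N' UNIV"
  have N: "(N has_sum infsum N UNIV) UNIV" "(N' has_sum infsum N' UNIV) UNIV"
    using a(2) b(2) has_sum_infsum unfolding N_def[abs_def] N'_def[abs_def] by blast+
  have inner: "((\<lambda>\<beta>. N \<alpha> * N' \<beta>) has_sum N \<alpha> * infsum N' UNIV) UNIV" for \<alpha>
    using N by (intro has_sum_cmult_right)
  have outer: "((\<lambda>\<alpha>. N \<alpha> * infsum N' UNIV) has_sum ?T) UNIV"
    using N by (intro has_sum_cmult_left)
  have "(\<lambda>(\<alpha>,\<beta>). N \<alpha> * N' \<beta>) summable_on (UNIV \<times> UNIV)"
    using inner outer N0 by (intro summable_on_SigmaI[where g="\<lambda>\<alpha>. N \<alpha> * infsum N' UNIV"])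
       (auto simp: has_sum_imp_summable)
  then have pair: "((\<lambda>(\<alpha>,\<beta>). N \<alpha> * N' \<beta>) has_sum ?T) (UNIV \<times> UNIV)"
    using inner outer by (intro has_sum_SigmaI[where g="\<lambda>\<alpha>. N \<alpha> * infsum N' UNIV"]) auto
  \<comment> \<open>The pairs \<open>(\<alpha>, \<beta>)\<close> are regrouped by their sum
    \<open>\<gamma>\<close>; for each \<open>\<gamma>\<close> only the finitely many
    \<open>\<alpha> \<le> \<gamma>\<close> occur.\<close>
  have "((\<lambda>(\<gamma>,\<alpha>). N \<alpha> * N' (\<gamma> - \<alpha>)) has_sum ?T) (SIGMA \<gamma>:UNIV. {\<alpha>. \<alpha> \<le> \<gamma>}) \<longleftrightarrow>
      ((\<lambda>(\<alpha>,\<beta>). N \<alpha> * N' \<beta>) has_sum ?T) (UNIV \<times> UNIV)"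
    by (rule has_sum_reindex_bij_witness[where i="\<lambda>(\<alpha>,\<beta>). (\<alpha> + \<beta>, \<alpha>)" and j="\<lambda>(\<gamma>,\<alpha>). (\<alpha>, \<gamma> - \<alpha>)"])
      (auto simp: le_fun_def fun_eq_iff)
  then have "((\<lambda>(\<gamma>,\<alpha>). N \<alpha> * N' (\<gamma> - \<alpha>)) has_sum ?T) (SIGMA \<gamma>:UNIV. {\<alpha>. \<alpha> \<le> \<gamma>})"
    using pair by blast
  then have conv: "((\<lambda>\<gamma>. \<Sum>\<alpha>\<in>{\<alpha>. \<alpha> \<le> \<gamma>}. N \<alpha> * N' (\<gamma> - \<alpha>)) has_sum ?T) UNIV"
    by (rule has_sum_SigmaD) (auto intro!: has_sum_finite finite_le_multiindex)
  have cS: "c \<gamma> \<in> S3" for \<gamma>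
    unfolding c_def by (intro S3.sum_mem mem a b)
  have cN: "n3 (c \<gamma>) * \<rho> ^ deg \<gamma> \<le> C * (\<Sum>\<alpha>\<in>{\<alpha>. \<alpha> \<le> \<gamma>}. N \<alpha> * N' (\<gamma> - \<alpha>))" for \<gamma>
  proof -
    have "n3 (c \<gamma>) \<le> (\<Sum>\<alpha>\<in>{\<alpha>. \<alpha> \<le> \<gamma>}. n3 (B (a \<alpha>) (b (\<gamma> - \<alpha>))))"
      unfolding c_def by (intro S3.nrm_sum mem a b)
    also have "\<dots> \<le> (\<Sum>\<alpha>\<in>{\<alpha>. \<alpha> \<le> \<gamma>}. C * n1 (a \<alpha>) * n2 (b (\<gamma> - \<alpha>)))"
      by (intro sum_mono bound a b)
    finally have "n3 (c \<gamma>) * \<rho> ^ deg \<gamma> \<le> (\<Sum>\<alpha>\<in>{\<alpha>. \<alpha> \<le> \<gamma>}. C * n1 (a \<alpha>) * n2 (b (\<gamma> - \<alpha>))) * \<rho> ^ deg \<gamma>"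
      using \<rho> by (intro mult_right_mono) auto
    also have "\<dots> = (\<Sum>\<alpha>\<in>{\<alpha>. \<alpha> \<le> \<gamma>}. C * (N \<alpha> * N' (\<gamma> - \<alpha>)))"
      unfolding sum_distrib_right
    proof (intro sum.cong refl)
      fix \<alpha> assume "\<alpha> \<in> {\<alpha>. \<alpha> \<le> \<gamma>}"
      then have "\<gamma> = \<alpha> + (\<gamma> - \<alpha>)" by (auto simp: le_fun_def fun_eq_iff)
      then have "deg \<gamma> = deg \<alpha> + deg (\<gamma> - \<alpha>)" using deg_add by metis
      then show "C * n1 (a \<alpha>) * n2 (b (\<gamma> - \<alpha>)) * \<rho> ^ deg \<gamma> = C * (N \<alpha> * N' (\<gamma> - \<alpha>))"
        by (simp add: N_def N'_def power_add)
    qed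
    finally show ?thesis by (simp add: sum_distrib_left)
  qed
  have conv': "((\<lambda>\<gamma>. C * (\<Sum>\<alpha>\<in>{\<alpha>. \<alpha> \<le> \<gamma>}. N \<alpha> * N' (\<gamma> - \<alpha>))) has_sum C * ?T) UNIV"
    by (intro has_sum_cmult_right conv)
  have sc: "(\<lambda>\<gamma>. n3 (c \<gamma>) * \<rho> ^ deg \<gamma>) summable_on UNIV"
    using cN cS \<rho> by (intro summable_on_comparison_test[OF has_sum_imp_summable[OF conv']])
       (auto intro!: mult_nonneg_nonneg S3.nrm_nonneg)
  have "(\<Sum>\<^sub>\<infinity>\<gamma>. n3 (c \<gamma>) * \<rho> ^ deg \<gamma>) \<le> C * ?T"
    using has_sum_mono[OF has_sum_infsum[OF sc] conv'] cN by simp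
  also have "?T \<le> M1 * M2"
  proof -
    have "infsum N UNIV \<le> M1" "infsum N' UNIV \<le> M2"
      using aM bM unfolding N_def[abs_def] N'_def[abs_def] by simp_all
    moreover have "0 \<le> infsum N UNIV" "0 \<le> infsum N' UNIV"
      using N0 by (auto intro: infsum_nonneg)
    ultimately show ?thesis by (intro mult_mono) auto
  qed
  finally have le: "(\<Sum>\<^sub>\<infinity>\<gamma>. n3 (c \<gamma>) * \<rho> ^ deg \<gamma>) \<le> C * (M1 * M2)"
    using C_nonneg by (simp add: mult_left_mono)
  have lim: "((\<lambda>Y. n3 (B (f x) (g x) - (\<Sum>\<gamma>\<in>Y. mpow x \<gamma> *\<^sub>R c \<gamma>))) \<longlongrightarrow> 0) (finite_subsets_at_top UNIV)"
    if x: "\<forall>i. \<bar>x $ i\<bar> < \<rho>" for x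
  proof -
    let ?m = "mpow x"
    define fG where "fG G = (\<Sum>\<alpha>\<in>G. ?m \<alpha> *\<^sub>R a \<alpha>)" for G
    define gG where "gG G = (\<Sum>\<alpha>\<in>G. ?m \<alpha> *\<^sub>R b \<alpha>)" for G
    have fGS: "fG G \<in> S1" "gG G \<in> S2" for G
      unfolding fG_def gG_def using a b by (auto intro!: S1.sum_mem S2.sum_mem S1.scale S2.scale)
    \<comment> \<open>The first part bounds the replacement of \<open>f x\<close> and
      \<open>g x\<close> by partial sums over \<open>G\<close>; the second is the majorant mass of
      the pairs outside \<open>G \<times> G\<close>.\<close>
    define err where "err G = C * (n1 (f x - fG G) * n2 (g x) + (n1 (f x - fG G) + n1 (f x)) * n2 (g x - gG G))
       + C * (?T - sum N G * sum N' G)" for G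
    have "((\<lambda>G. n1 (f x - fG G)) \<longlongrightarrow> 0) (finite_subsets_at_top UNIV)"
      "((\<lambda>G. n2 (g x - gG G)) \<longlongrightarrow> 0) (finite_subsets_at_top UNIV)"
      unfolding fG_def gG_def using expansionD(3)[OF ea] expansionD(3)[OF eb] x by auto
    moreover have "(sum N \<longlongrightarrow> infsum N UNIV) (finite_subsets_at_top UNIV)"
      "(sum N' \<longlongrightarrow> infsum N' UNIV) (finite_subsets_at_top UNIV)"
      using N by (auto simp: has_sum_def)
    ultimately have "(err \<longlongrightarrow> C * (0 * n2 (g x) + (0 + n1 (f x)) * 0) + C * (?T - ?T)) (finite_subsets_at_top UNIV)"
      unfolding err_def by (intro tendsto_intros)
    then have err0: "(err \<longlongrightarrow> 0) (finite_subsets_at_top UNIV)" by simp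
    \<comment> \<open>When \<open>Y\<close> contains all sums of two members of \<open>G\<close>,
      the partial sum over \<open>Y\<close> contains every product of terms of the two partial sums
      over \<open>G\<close>. The excess consists of pairs outside
      \<open>G \<times> G\<close>.\<close>
    have main: "n3 (B (f x) (g x) - (\<Sum>\<gamma>\<in>Y. ?m \<gamma> *\<^sub>R c \<gamma>)) \<le> err G"
      if fin: "finite G" "finite Y" and sub: "(\<lambda>(\<alpha>,\<beta>). \<alpha> + \<beta>) ` (G \<times> G) \<subseteq> Y" for G Y
    proof -
      let ?Z = "\<lambda>(\<alpha>,\<beta>). (?m \<alpha> * ?m \<beta>) *\<^sub>R B (a \<alpha>) (b \<beta>)"
      \<comment> \<open>The pairs of exponents that contribute to the coefficients indexed by
        \<open>Y\<close>.\<close>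
      define TY where "TY = (\<lambda>(\<gamma>,\<alpha>). (\<alpha>, \<gamma> - \<alpha>)) ` (SIGMA \<gamma>:Y. {\<alpha>. \<alpha> \<le> \<gamma>})"
      have finT: "finite TY" unfolding TY_def using fin by (auto intro!: finite_SigmaI finite_le_multiindex)
      have subT: "G \<times> G \<subseteq> TY"
      proof
        fix z assume "z \<in> G \<times> G"
        then obtain \<alpha> \<beta> where z: "z = (\<alpha>, \<beta>)" "\<alpha> \<in> G" "\<beta> \<in> G" by auto
        then have "(\<alpha> + \<beta>, \<alpha>) \<in> (SIGMA \<gamma>:Y. {\<alpha>. \<alpha> \<le> \<gamma>})" using sub by (auto simp: le_fun_def)
        moreover have "z = (\<lambda>(\<gamma>,\<alpha>). (\<alpha>, \<gamma> - \<alpha>)) (\<alpha> + \<beta>, \<alpha>)" using z by (auto simp: fun_eq_iff)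
        ultimately show "z \<in> TY" unfolding TY_def by blast
      qed
      have "(\<Sum>\<gamma>\<in>Y. ?m \<gamma> *\<^sub>R c \<gamma>) = (\<Sum>\<gamma>\<in>Y. \<Sum>\<alpha>\<in>{\<alpha>. \<alpha> \<le> \<gamma>}. ?Z (\<alpha>, \<gamma> - \<alpha>))"
        unfolding c_def scaleR_sum_right
      proof (intro sum.cong refl, goal_cases)
        case (1 \<gamma> \<alpha>)
        then have "\<gamma> = \<alpha> + (\<gamma> - \<alpha>)" by (auto simp: le_fun_def fun_eq_iff)
        then have "?m \<gamma> = ?m \<alpha> * ?m (\<gamma> - \<alpha>)" using mpow_add by metis
        then show ?case by simp
      qed
      also have "\<dots> = (\<Sum>(\<gamma>,\<alpha>)\<in>(SIGMA \<gamma>:Y. {\<alpha>. \<alpha> \<le> \<gamma>}). ?Z (\<alpha>, \<gamma> - \<alpha>))"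
        using fin by (subst sum.Sigma) (auto simp: finite_le_multiindex)
      also have "\<dots> = sum ?Z TY"
        unfolding TY_def
        by (subst sum.reindex) (auto simp: inj_on_def le_fun_def fun_eq_iff case_prod_beta intro!: sum.cong, metis le_add_diff_inverse)
      finally have e1: "(\<Sum>\<gamma>\<in>Y. ?m \<gamma> *\<^sub>R c \<gamma>) = sum ?Z (TY - G \<times> G) + sum ?Z (G \<times> G)"
        using sum.subset_diff[OF subT finT] by simp
      have ZS: "?Z z \<in> S3" for z using a b by (auto intro!: S3.scale mem split: prod.split)
      have Zn: "n3 (?Z z) \<le> C * (N (fst z) * N' (snd z))" for z
      proof -
        obtain \<alpha> \<beta> where z: "z = (\<alpha>, \<beta>)" by fastforce
        have "n3 (?Z z) \<le> \<bar>?m \<alpha> * ?m \<beta>\<bar> * n3 (B (a \<alpha>) (b \<beta>))"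
          using S3.nrm_scale mem a b z by auto
        also have "\<dots> \<le> (\<rho> ^ deg \<alpha> * \<rho> ^ deg \<beta>) * (C * n1 (a \<alpha>) * n2 (b \<beta>))"
          using abs_mpow_le[of x \<rho>] x a b \<rho>
          by (intro mult_mono bound) (auto simp: abs_mult intro!: mult_mono S3.nrm_nonneg mem)
        finally show ?thesis by (simp add: z N_def N'_def mult_ac)
      qed
      have "n3 (sum ?Z (TY - G \<times> G)) \<le> (\<Sum>z\<in>TY - G \<times> G. C * (N (fst z) * N' (snd z)))"
        using ZS Zn by (intro order_trans[OF S3.nrm_sum] sum_mono) auto
      also have "\<dots> = C * ((\<Sum>z\<in>TY. N (fst z) * N' (snd z)) - (\<Sum>z\<in>G \<times> G. N (fst z) * N' (snd z)))"
        using finT subT by (simp add: sum_diff sum_distrib_left[symmetric])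
      also have "\<dots> \<le> C * (?T - sum N G * sum N' G)"
      proof (intro mult_left_mono diff_mono C_nonneg)
        show "(\<Sum>z\<in>TY. N (fst z) * N' (snd z)) \<le> ?T"
          using finite_sum_le_has_sum[OF pair, of TY] finT N0 by (auto simp: case_prod_beta)
        show "sum N G * sum N' G \<le> (\<Sum>z\<in>G \<times> G. N (fst z) * N' (snd z))"
          by (simp add: sum_product sum.cartesian_product case_prod_beta)
      qed
      finally have t: "n3 (sum ?Z (TY - G \<times> G)) \<le> C * (?T - sum N G * sum N' G)" .
      have "B (f x) (g x) - (\<Sum>\<gamma>\<in>Y. ?m \<gamma> *\<^sub>R c \<gamma>) =
          (B (f x) (g x) - B (fG G) (gG G)) + ((B (fG G) (gG G) - sum ?Z (G \<times> G)) - sum ?Z (TY - G \<times> G))"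
        by (simp add: e1)
      also have "n3 \<dots> \<le> n3 (B (f x) (g x) - B (fG G) (gG G)) +
          (n3 (B (fG G) (gG G) - sum ?Z (G \<times> G)) + n3 (sum ?Z (TY - G \<times> G)))"
      proof -
        have m: "B (f x) (g x) - B (fG G) (gG G) \<in> S3" "B (fG G) (gG G) - sum ?Z (G \<times> G) \<in> S3"
          "sum ?Z (TY - G \<times> G) \<in> S3"
          using ZS fGS fS gS by (auto intro!: S3.diff mem S3.sum_mem)
        show ?thesis
          using S3.nrm_add[OF m(1) S3.diff[OF m(2,3)]] S3.nrm_diff[OF m(2,3)] by linarith
      qed
      also have "n3 (B (fG G) (gG G) - sum ?Z (G \<times> G)) = 0"
        unfolding fG_def gG_def by (intro sum_both a b)
      also have "n3 (B (f x) (g x) - B (fG G) (gG G)) \<le>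
         C * (n1 (f x - fG G) * n2 (g x) + n1 (fG G) * n2 (g x - gG G))"
        by (intro diff_bound fS gS fGS)
      also have "\<dots> \<le> C * (n1 (f x - fG G) * n2 (g x) + (n1 (f x - fG G) + n1 (f x)) * n2 (g x - gG G))"
      proof (intro mult_left_mono add_left_mono mult_right_mono C_nonneg)
        show "n1 (fG G) \<le> n1 (f x - fG G) + n1 (f x)"
          using S1.nrm_le_diff[of "fG G" "f x"] S1.nrm_minus_commute[of "f x" "fG G"] fS fGS by simp
        show "0 \<le> n2 (g x - gG G)" by (intro S2.nrm_nonneg S2.diff gS fGS)
      qed
      finally show ?thesis using t unfolding err_def by linarith
    qed
    show ?thesis
    proof (rule tendstoI)
      fix e :: real assume "0 < e"
      then have "\<forall>\<^sub>F G in finite_subsets_at_top UNIV. err G < e"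
        using err0 order_tendstoD(2) by blast
      then obtain G where G: "finite G" "err G < e" by (rule eventually_at_top_witness)
      have "0 \<le> n3 (B (f x) (g x) - (\<Sum>\<gamma>\<in>Y. ?m \<gamma> *\<^sub>R c \<gamma>))" for Y
        by (intro S3.nrm_nonneg S3.diff S3.sum_mem S3.scale mem fS gS cS)
      then have "dist (n3 (B (f x) (g x) - (\<Sum>\<gamma>\<in>Y. ?m \<gamma> *\<^sub>R c \<gamma>))) 0 < e"
        if "finite Y" "(\<lambda>(\<alpha>,\<beta>). \<alpha> + \<beta>) ` (G \<times> G) \<subseteq> Y" for Y
        using main[OF G(1) that] G(2) unfolding dist_real_def by simp
      then show "\<forall>\<^sub>F Y in finite_subsets_at_top UNIV.
          dist (n3 (B (f x) (g x) - (\<Sum>\<gamma>\<in>Y. ?m \<gamma> *\<^sub>R c \<gamma>))) 0 < e"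
        unfolding eventually_finite_subsets_at_top
        using G(1) by (intro exI[of _ "(\<lambda>(\<alpha>,\<beta>). \<alpha> + \<beta>) ` (G \<times> G)"]) simp
    qed
  qed
  have "expansion S3 n3 \<rho> (\<lambda>x. B (f x) (g x)) c"
    using cS sc lim by (intro expansionI) auto
  with le show ?thesis
    unfolding normal_series_def by blast
qed

lemma normal_series_le: "normal_series S nrm \<rho> M f \<Longrightarrow> M \<le> M' \<Longrightarrow> normal_series S nrm \<rho> M' f"
  unfolding normal_series_def by (meson order_trans)

lemma normal_series_cong:
  assumes "\<And>x. (\<And>i. \<bar>x $ i\<bar> < \<rho>) \<Longrightarrow> f x = g x"
  shows "normal_series S nrm \<rho> M f \<longleftrightarrow> normal_series S nrm \<rho> M g"
  unfolding normal_series_def expansion_def using assms by simp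

lemma (in seminormed) normal_series_monomial:
  fixes \<beta> :: "'d::finite \<Rightarrow> nat"
  assumes "v \<in> S"
  shows "normal_series S nrm \<rho> (nrm v * \<rho> ^ deg \<beta>) (\<lambda>x. mpow x \<beta> *\<^sub>R v)"
proof -
  define a where "a \<alpha> = (if \<alpha> = \<beta> then v else 0)" for \<alpha>
  have h: "((\<lambda>\<alpha>. nrm (a \<alpha>) * \<rho> ^ deg \<alpha>) has_sum (nrm v * \<rho> ^ deg \<beta>)) UNIV"
    by (rule has_sum_finite_neutralI[of "{\<beta>}"]) (auto simp: a_def nrm_zero)
  have "expansion S nrm \<rho> (\<lambda>x. mpow x \<beta> *\<^sub>R v) a"
  proof (rule expansionI)
    fix x :: "real^'d"
    have "(\<Sum>\<alpha>\<in>F. mpow x \<alpha> *\<^sub>R a \<alpha>) = mpow x \<beta> *\<^sub>R v" if "finite F" "{\<beta>} \<subseteq> F" for F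
    proof -
      have "(\<Sum>\<alpha>\<in>F. mpow x \<alpha> *\<^sub>R a \<alpha>) = (\<Sum>\<alpha>\<in>F. if \<alpha> = \<beta> then mpow x \<beta> *\<^sub>R v else 0)"
        by (intro sum.cong) (auto simp: a_def)
      then show ?thesis using that by simp
    qed
    then have "\<forall>\<^sub>F F in finite_subsets_at_top UNIV. nrm (mpow x \<beta> *\<^sub>R v - (\<Sum>\<alpha>\<in>F. mpow x \<alpha> *\<^sub>R a \<alpha>)) = 0"
      unfolding eventually_finite_subsets_at_top
      by (intro exI[of _ "{\<beta>}"]) (simp add: nrm_zero)
    then show "((\<lambda>F. nrm (mpow x \<beta> *\<^sub>R v - (\<Sum>\<alpha>\<in>F. mpow x \<alpha> *\<^sub>R a \<alpha>))) \<longlongrightarrow> 0) (finite_subsets_at_top UNIV)"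
      by (rule tendsto_eventually)
  qed (use assms zero h in \<open>auto simp: a_def has_sum_imp_summable\<close>)
  then show ?thesis unfolding normal_series_def using infsumI[OF h] by auto
qed

lemma (in seminormed) normal_series_const: "v \<in> S \<Longrightarrow> normal_series S nrm \<rho> (nrm v) (\<lambda>x. v)"
  using normal_series_monomial[of v \<rho> 0] by (simp add: mpow_zero deg_zero)

lemma (in seminormed) normal_series_add:
  fixes f g :: "real^'d \<Rightarrow> 'f"
  assumes "normal_series S nrm \<rho> M f" "normal_series S nrm \<rho> M' g" "0 \<le> \<rho>"
    and fS: "\<And>x. f x \<in> S" "\<And>x. g x \<in> S"
  shows "normal_series S nrm \<rho> (M + M') (\<lambda>x. f x + g x)"
proof -
  obtain a where ea: "expansion S nrm \<rho> f a" and aM: "(\<Sum>\<^sub>\<infinity>\<alpha>. nrm (a \<alpha>) * \<rho> ^ deg \<alpha>) \<le> M"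
    using assms unfolding normal_series_def by blast
  obtain b where eb: "expansion S nrm \<rho> g b" and bM: "(\<Sum>\<^sub>\<infinity>\<alpha>. nrm (b \<alpha>) * \<rho> ^ deg \<alpha>) \<le> M'"
    using assms unfolding normal_series_def by blast
  note a = expansionD(1,2)[OF ea] and b = expansionD(1,2)[OF eb]
  let ?ab = "\<lambda>\<alpha>. nrm (a \<alpha>) * \<rho> ^ deg \<alpha> + nrm (b \<alpha>) * \<rho> ^ deg \<alpha>"
  have le: "nrm (a \<alpha> + b \<alpha>) * \<rho> ^ deg \<alpha> \<le> ?ab \<alpha>" for \<alpha>
    unfolding distrib_right[symmetric] using a b assms(3) by (intro mult_right_mono nrm_add) auto
  have s': "?ab summable_on UNIV" by (intro summable_on_add a(2) b(2))
  have s: "(\<lambda>\<alpha>. nrm (a \<alpha> + b \<alpha>) * \<rho> ^ deg \<alpha>) summable_on UNIV"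
    using le a b assms(3) by (intro summable_on_comparison_test[OF s'])
       (auto intro!: mult_nonneg_nonneg nrm_nonneg add)
  have "(\<Sum>\<^sub>\<infinity>\<alpha>. nrm (a \<alpha> + b \<alpha>) * \<rho> ^ deg \<alpha>) \<le> infsum ?ab UNIV"
    by (intro infsum_mono s s' le)
  then have M: "(\<Sum>\<^sub>\<infinity>\<alpha>. nrm (a \<alpha> + b \<alpha>) * \<rho> ^ deg \<alpha>) \<le> M + M'"
    using aM bM by (simp add: infsum_add[OF a(2) b(2)])
  have "expansion S nrm \<rho> (\<lambda>x. f x + g x) (\<lambda>\<alpha>. a \<alpha> + b \<alpha>)"
  proof (rule expansionI)
    fix x :: "real^'d" assume x: "\<And>i. \<bar>x $ i\<bar> < \<rho>"
    let ?A = "\<lambda>F. \<Sum>\<alpha>\<in>F. mpow x \<alpha> *\<^sub>R a \<alpha>" and ?B = "\<lambda>F. \<Sum>\<alpha>\<in>F. mpow x \<alpha> *\<^sub>R b \<alpha>"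
    have m: "?A F \<in> S" "?B F \<in> S" for F using a b by (auto intro!: sum_mem scale)
    have lim: "((\<lambda>F. nrm (f x - ?A F) + nrm (g x - ?B F)) \<longlongrightarrow> 0 + 0) (finite_subsets_at_top UNIV)"
      by (intro tendsto_add expansionD(3)[OF ea] expansionD(3)[OF eb] x)
    have eq: "f x + g x - (\<Sum>\<alpha>\<in>F. mpow x \<alpha> *\<^sub>R (a \<alpha> + b \<alpha>)) = (f x - ?A F) + (g x - ?B F)" for F
      by (simp add: scaleR_add_right sum.distrib)
    show "((\<lambda>F. nrm (f x + g x - (\<Sum>\<alpha>\<in>F. mpow x \<alpha> *\<^sub>R (a \<alpha> + b \<alpha>)))) \<longlongrightarrow> 0) (finite_subsets_at_top UNIV)"
      unfolding eq
    proof (rule tendsto_sandwich[OF _ _ tendsto_const])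
      show "((\<lambda>F. nrm (f x - ?A F) + nrm (g x - ?B F)) \<longlongrightarrow> 0) (finite_subsets_at_top UNIV)" using lim by simp
    qed (use m fS in \<open>auto intro!: always_eventually nrm_nonneg nrm_add add diff\<close>)
  qed (use a b s in \<open>auto intro: add\<close>)
  then show ?thesis unfolding normal_series_def using M by blast
qed

text \<open>On the cube shrunk by \<open>t\<close> each monomial of positive degree gains a factor
  \<open>t ^ deg \<alpha> \<le> t\<close>, and the constant term cancels in the difference. Both
  continuity and the smallness needed for substitution come from this estimate.\<close>

lemma (in seminormed) normal_series_bound:
  fixes f :: "real^'d \<Rightarrow> 'f"
  assumes "normal_series S nrm \<rho> M f" "0 < \<rho>" "0 \<le> t" "t < 1" "\<And>x. f x \<in> S"
    and x: "\<And>i. \<bar>x $ i\<bar> \<le> t * \<rho>"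
  shows "nrm (f x - f 0) \<le> t * M"
proof -
  obtain a where ea: "expansion S nrm \<rho> f a" and aM: "(\<Sum>\<^sub>\<infinity>\<alpha>. nrm (a \<alpha>) * \<rho> ^ deg \<alpha>) \<le> M"
    using assms unfolding normal_series_def by blast
  note a = expansionD(1,2)[OF ea]
  let ?s = "\<lambda>x F. \<Sum>\<alpha>\<in>F. mpow x \<alpha> *\<^sub>R a \<alpha>"
  have t: "\<bar>x $ i\<bar> < \<rho>" for i
    using order_le_less_trans[OF x[of i]] mult_strict_right_mono[OF assms(4,2)] by simp
  have m: "?s x F \<in> S" for x F using a by (auto intro!: sum_mem scale)
  have z: "?s 0 F = a 0" if "0 \<in> F" "finite F" for F
  proof -
    have "?s 0 F = (\<Sum>\<alpha>\<in>F. if \<alpha> = 0 then a 0 else 0)"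
      by (intro sum.cong) (auto simp: mpow_origin)
    then show ?thesis using that by simp
  qed
  have "((\<lambda>F. nrm (f x - ?s x F) + (t * M + nrm (f 0 - ?s 0 F))) \<longlongrightarrow> 0 + (t * M + 0)) (finite_subsets_at_top UNIV)"
    using assms(2) t by (intro tendsto_add tendsto_const expansionD(3)[OF ea]) auto
  moreover have "nrm (f x - f 0) \<le> nrm (f x - ?s x F) + (t * M + nrm (f 0 - ?s 0 F))"
    if F: "finite F" "{0} \<subseteq> F" for F
  proof -
    have "?s x F - a 0 = ?s x (F - {0})"
      using F by (simp add: sum_diff1 mpow_zero)
    also have "nrm \<dots> \<le> (\<Sum>\<alpha>\<in>F - {0}. nrm (mpow x \<alpha> *\<^sub>R a \<alpha>))"
      by (intro nrm_sum scale a)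
    also have "\<dots> \<le> (\<Sum>\<alpha>\<in>F - {0}. t * (nrm (a \<alpha>) * \<rho> ^ deg \<alpha>))"
    proof (intro sum_mono)
      fix \<alpha> :: "'d \<Rightarrow> nat" assume "\<alpha> \<in> F - {0}"
      then obtain i where i: "\<alpha> i \<noteq> 0" by (auto simp: fun_eq_iff)
      then have d: "deg \<alpha> \<noteq> 0" by (auto simp: deg_def)
      have "\<bar>mpow x \<alpha>\<bar> = (\<Prod>i\<in>UNIV. \<bar>x $ i\<bar> ^ \<alpha> i)"
        by (simp add: mpow_def abs_prod power_abs)
      also have "\<dots> \<le> (\<Prod>i\<in>UNIV. (t * \<rho>) ^ \<alpha> i)"
        using x by (intro prod_mono) (simp add: power_mono)
      finally have "\<bar>mpow x \<alpha>\<bar> \<le> (t * \<rho>) ^ deg \<alpha>" by (simp add: deg_def power_sum)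
      also have "\<dots> \<le> t * \<rho> ^ deg \<alpha>"
        unfolding power_mult_distrib using d assms(2-4) power_decreasing[of 1 "deg \<alpha>" t]
        by (intro mult_right_mono) auto
      finally have "\<bar>mpow x \<alpha>\<bar> * nrm (a \<alpha>) \<le> t * \<rho> ^ deg \<alpha> * nrm (a \<alpha>)"
        by (intro mult_right_mono nrm_nonneg a)
      then show "nrm (mpow x \<alpha> *\<^sub>R a \<alpha>) \<le> t * (nrm (a \<alpha>) * \<rho> ^ deg \<alpha>)"
        using nrm_scale[OF a(1), of "mpow x \<alpha>" \<alpha>] by (simp add: mult_ac)
    qed
    also have "\<dots> \<le> t * (\<Sum>\<^sub>\<infinity>\<alpha>. nrm (a \<alpha>) * \<rho> ^ deg \<alpha>)"
      unfolding sum_distrib_left[symmetric] using assms F a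
      by (intro mult_left_mono finite_sum_le_infsum) (auto intro!: mult_nonneg_nonneg nrm_nonneg)
    also have "\<dots> \<le> t * M" using aM assms by (intro mult_left_mono)
    finally have 1: "nrm (?s x F - a 0) \<le> t * M" .
    have "nrm (f x - f 0) \<le> nrm (f x - ?s x F) + nrm (?s x F - f 0)"
      by (intro nrm_triangle assms m)
    also have "nrm (?s x F - f 0) \<le> nrm (?s x F - a 0) + nrm (a 0 - f 0)"
      by (intro nrm_triangle assms m a)
    \<comment> \<open>\<open>f 0\<close> agrees with \<open>a 0\<close> only up to a null vector, so
      the error of the expansion at 0 is kept and disappears in the limit.\<close>
    also have "nrm (a 0 - f 0) = nrm (f 0 - ?s 0 F)"
      using z[of F] F nrm_minus_commute[OF a(1) assms(5)] by simp
    finally show ?thesis using 1 by linarith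
  qed
  then have "\<forall>\<^sub>F F in finite_subsets_at_top UNIV. nrm (f x - f 0) \<le> nrm (f x - ?s x F) + (t * M + nrm (f 0 - ?s 0 F))"
    unfolding eventually_finite_subsets_at_top by (intro exI[of _ "{0}"]) simp
  ultimately show ?thesis
    using tendsto_lowerbound[of _ _ "finite_subsets_at_top UNIV" "nrm (f x - f 0)"] by force
qed

text \<open>The choice \<open>t = dist k k0 / \<rho>\<close> in \<open>normal_series_bound\<close>
  gives a Lipschitz estimate at \<open>k0\<close>.\<close>

lemma (in seminormed) analytic_near_continuous:
  assumes "analytic_near S nrm u k0" "\<And>k. u k \<in> S"
  shows "((\<lambda>k. nrm (u k - u k0)) \<longlongrightarrow> 0) (nhds k0)"
proof -
  obtain \<rho> M where \<rho>: "0 < \<rho>" and n: "normal_series S nrm \<rho> M (\<lambda>x. u (k0 + x))"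
    using assms unfolding analytic_near_def by blast
  have b: "nrm (u k - u k0) \<le> dist k k0 / \<rho> * M" if "dist k k0 < \<rho>" for k
    using normal_series_bound[OF n \<rho>, of "dist k k0 / \<rho>" "k - k0"] that assms(2) \<rho> component_le_norm_cart[of "k - k0"]
    by (simp add: dist_norm)
  have "((\<lambda>k. dist k k0 / \<rho> * M) \<longlongrightarrow> dist k0 k0 / \<rho> * M) (nhds k0)"
    using \<rho> by (intro tendsto_intros filterlim_ident) auto
  moreover have "\<forall>\<^sub>F k in nhds k0. nrm (u k - u k0) \<le> dist k k0 / \<rho> * M"
    unfolding eventually_nhds_metric using b \<rho> by blast
  moreover have "\<forall>\<^sub>F k in nhds k0. 0 \<le> nrm (u k - u k0)"
    by (intro always_eventually allI nrm_nonneg diff assms)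
  ultimately show ?thesis
    using tendsto_sandwich[of "\<lambda>k. 0" "\<lambda>k. nrm (u k - u k0)" "nhds k0" "\<lambda>k. dist k k0 / \<rho> * M" 0] by simp
qed

lemma (in seminormed) analytic_near_cong:
  fixes u v :: "real^'d \<Rightarrow> 'f"
  assumes "\<forall>\<^sub>F k in nhds k0. u k = v k"
  shows "analytic_near S nrm u k0 \<longleftrightarrow> analytic_near S nrm v k0"
proof -
  have *: "analytic_near S nrm v k0" if ev: "\<forall>\<^sub>F k in nhds k0. u k = v k" and u: "analytic_near S nrm u k0" for u v
  proof -
    obtain \<rho> M where \<rho>: "0 < \<rho>" and n: "normal_series S nrm \<rho> M (\<lambda>x. u (k0 + x))"
      using u unfolding analytic_near_def by blast
    obtain d where d: "0 < d" "\<And>k. dist k k0 < d \<Longrightarrow> u k = v k"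
      using ev unfolding eventually_nhds_metric by blast
    \<comment> \<open>A vector in the cube of half-side \<open>d / (2 * CARD('d))\<close> has l1
      norm at most \<open>d / 2\<close>, so the cube lies in the ball of radius
      \<open>d\<close>.\<close>
    define r where "r = min \<rho> (d / (2 * CARD('d)))"
    have r: "0 < r" "r \<le> \<rho>" using \<rho> d by (auto simp: r_def)
    have "u (k0 + x) = v (k0 + x)" if "\<And>i. \<bar>x $ i\<bar> < r" for x :: "real^'d"
    proof (rule d(2))
      have "norm x \<le> (\<Sum>i\<in>UNIV. \<bar>x $ i\<bar>)" by (rule norm_le_l1_cart)
      also have "\<dots> \<le> (\<Sum>i\<in>(UNIV::'d set). d / (2 * CARD('d)))"
      proof (intro sum_mono)
        fix i :: 'd show "\<bar>x $ i\<bar> \<le> d / (2 * CARD('d))" using that[of i] by (simp add: r_def)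
      qed
      also have "\<dots> < d" using d by simp
      finally show "dist (k0 + x) k0 < d" by (simp add: dist_norm)
    qed
    then have "normal_series S nrm r M (\<lambda>x. u (k0 + x)) \<longleftrightarrow> normal_series S nrm r M (\<lambda>x. v (k0 + x))"
      by (rule normal_series_cong)
    then have "normal_series S nrm r M (\<lambda>x. v (k0 + x))"
      using normal_series_shrink[OF seminormed_axioms n, of r] r by simp
    then show ?thesis unfolding analytic_near_def using r by blast
  qed
  have "\<forall>\<^sub>F k in nhds k0. v k = u k" using assms by eventually_elim simp
  then show ?thesis using *[of u v] *[of v u] assms by blast
qed

lemma (in null_bilinear) analytic_near_bilinear:
  assumes "analytic_near S1 n1 u k0" "analytic_near S2 n2 v k0" "\<And>k. u k \<in> S1" "\<And>k. v k \<in> S2"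
  shows "analytic_near S3 n3 (\<lambda>k. B (u k) (v k)) k0"
proof -
  obtain \<rho> M where \<rho>: "0 < \<rho>" and n: "normal_series S1 n1 \<rho> M (\<lambda>x. u (k0 + x))"
    using assms unfolding analytic_near_def by blast
  obtain \<rho>' M' where \<rho>': "0 < \<rho>'" and n': "normal_series S2 n2 \<rho>' M' (\<lambda>x. v (k0 + x))"
    using assms unfolding analytic_near_def by blast
  let ?r = "min \<rho> \<rho>'"
  have "normal_series S3 n3 ?r (C * (M * M')) (\<lambda>x. B (u (k0 + x)) (v (k0 + x)))"
    using \<rho> \<rho>' normal_series_shrink[OF S1.seminormed_axioms n, of ?r]
      normal_series_shrink[OF S2.seminormed_axioms n', of ?r] assms(3,4)
    by (intro normal_series_bilinear) auto
  then show ?thesis unfolding analytic_near_def using \<rho> \<rho>' by (intro exI[of _ ?r]) auto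
qed

lemma (in seminormed) analytic_near_const: "v \<in> S \<Longrightarrow> analytic_near S nrm (\<lambda>k. v) k0"
  unfolding analytic_near_def using normal_series_const zero_less_one by blast

lemma (in seminormed) analytic_near_add:
  assumes "analytic_near S nrm u k0" "analytic_near S nrm v k0" "\<And>k. u k \<in> S" "\<And>k. v k \<in> S"
  shows "analytic_near S nrm (\<lambda>k. u k + v k) k0"
proof -
  obtain \<rho> M where \<rho>: "0 < \<rho>" and n: "normal_series S nrm \<rho> M (\<lambda>x. u (k0 + x))"
    using assms unfolding analytic_near_def by blast
  obtain \<rho>' M' where \<rho>': "0 < \<rho>'" and n': "normal_series S nrm \<rho>' M' (\<lambda>x. v (k0 + x))"
    using assms unfolding analytic_near_def by blast
  let ?r = "min \<rho> \<rho>'"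
  have "normal_series S nrm ?r (M + M') (\<lambda>x. u (k0 + x) + v (k0 + x))"
    using \<rho> \<rho>' normal_series_shrink[OF seminormed_axioms n, of ?r]
      normal_series_shrink[OF seminormed_axioms n', of ?r] assms(3,4)
    by (intro normal_series_add) auto
  then show ?thesis unfolding analytic_near_def using \<rho> \<rho>' by (intro exI[of _ ?r]) auto
qed

lemma (in seminormed) analytic_near_sum:
  assumes "\<And>i. i \<in> I \<Longrightarrow> analytic_near S nrm (u i) k0" "\<And>i k. i \<in> I \<Longrightarrow> u i k \<in> S"
  shows "analytic_near S nrm (\<lambda>k. \<Sum>i\<in>I. u i k) k0"
  using assms
proof (induction I rule: infinite_finite_induct)
  case (insert i I)
  then show ?case by (auto intro!: analytic_near_add sum_mem)
qed (simp_all add: analytic_near_const zero)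

subsection \<open>Complex-valued analytic functions\<close>

lemma seminormed_norm: "seminormed (UNIV :: 'a::real_normed_vector set) norm"
  by standard (auto simp: norm_triangle_ineq)

abbreviation cseries :: "real \<Rightarrow> real \<Rightarrow> (real^'d \<Rightarrow> complex) \<Rightarrow> bool" where
  "cseries \<equiv> normal_series UNIV norm"

abbreviation canalytic :: "(real^'d \<Rightarrow> complex) \<Rightarrow> real^'d \<Rightarrow> bool" where
  "canalytic \<equiv> analytic_near UNIV norm"

interpretation cnorm: seminormed "UNIV :: complex set" norm
  by (rule seminormed_norm)

interpretation cmult: null_bilinear "UNIV :: complex set" norm "UNIV :: complex set" norm
    "UNIV :: complex set" norm "(*)" 1
  by standard (auto simp: norm_mult algebra_simps)

text \<open>For complex values the seminorm condition is ordinary convergence, so the calculus of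
  \<open>has_sum\<close> becomes available.\<close>

lemma cseries_iff:
  "cseries \<rho> M f \<longleftrightarrow> (\<exists>a. (\<lambda>\<alpha>. norm (a \<alpha>) * \<rho> ^ deg \<alpha>) summable_on UNIV \<and>
     (\<Sum>\<^sub>\<infinity>\<alpha>. norm (a \<alpha>) * \<rho> ^ deg \<alpha>) \<le> M \<and>
     (\<forall>x. (\<forall>i. \<bar>x $ i\<bar> < \<rho>) \<longrightarrow> ((\<lambda>\<alpha>. mpow x \<alpha> *\<^sub>R a \<alpha>) has_sum f x) UNIV))"
proof -
  have "((\<lambda>\<alpha>. mpow x \<alpha> *\<^sub>R a \<alpha>) has_sum f x) UNIV \<longleftrightarrow>
      ((\<lambda>F. norm (f x - (\<Sum>\<alpha>\<in>F. mpow x \<alpha> *\<^sub>R a \<alpha>))) \<longlongrightarrow> 0) (finite_subsets_at_top UNIV)" for a x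
    unfolding has_sum_def norm_minus_commute[of "f x"] tendsto_norm_zero_iff
    by (rule LIM_zero_iff[symmetric])
  then show ?thesis unfolding normal_series_def expansion_def by auto
qed

text \<open>Weierstrass's theorem in majorant form: the bounds \<open>M n\<close> make the double
  family of terms absolutely summable, so it may be summed over \<open>n\<close> first within each
  multi-index. It serves to insert one series into another, with the outer exponent as index
  \<open>n\<close>.\<close>

lemma cseries_infsum:
  assumes f: "\<And>n. n \<in> I \<Longrightarrow> cseries \<rho> (M n) (f n)" and M: "M summable_on I" and \<rho>: "0 < \<rho>"
    and g: "\<And>x. (\<And>i. \<bar>x $ i\<bar> < \<rho>) \<Longrightarrow> ((\<lambda>n. f n x) has_sum g x) I"
  shows "cseries \<rho> (infsum M I) g"
proof -
  have "\<forall>n\<in>I. \<exists>a. (\<lambda>\<alpha>. norm (a \<alpha>) * \<rho> ^ deg \<alpha>) summable_on UNIV \<and>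
     (\<Sum>\<^sub>\<infinity>\<alpha>. norm (a \<alpha>) * \<rho> ^ deg \<alpha>) \<le> M n \<and>
     (\<forall>x. (\<forall>i. \<bar>x $ i\<bar> < \<rho>) \<longrightarrow> ((\<lambda>\<alpha>. mpow x \<alpha> *\<^sub>R a \<alpha>) has_sum f n x) UNIV)"
    using f unfolding cseries_iff by simp
  from bchoice[OF this] obtain a where "\<forall>n\<in>I. (\<lambda>\<alpha>. norm (a n \<alpha>) * \<rho> ^ deg \<alpha>) summable_on UNIV \<and>
     (\<Sum>\<^sub>\<infinity>\<alpha>. norm (a n \<alpha>) * \<rho> ^ deg \<alpha>) \<le> M n \<and>
     (\<forall>x. (\<forall>i. \<bar>x $ i\<bar> < \<rho>) \<longrightarrow> ((\<lambda>\<alpha>. mpow x \<alpha> *\<^sub>R a n \<alpha>) has_sum f n x) UNIV)"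
    by (elim exE)
  then have a: "\<And>n. n \<in> I \<Longrightarrow> (\<lambda>\<alpha>. norm (a n \<alpha>) * \<rho> ^ deg \<alpha>) summable_on UNIV"
    "\<And>n. n \<in> I \<Longrightarrow> (\<Sum>\<^sub>\<infinity>\<alpha>. norm (a n \<alpha>) * \<rho> ^ deg \<alpha>) \<le> M n"
    "\<And>n x. n \<in> I \<Longrightarrow> (\<forall>i. \<bar>x $ i\<bar> < \<rho>) \<Longrightarrow> ((\<lambda>\<alpha>. mpow x \<alpha> *\<^sub>R a n \<alpha>) has_sum f n x) UNIV"
    by simp_all
  let ?N = "\<lambda>n \<alpha>. norm (a n \<alpha>) * \<rho> ^ deg \<alpha>"
  let ?m = "\<lambda>n. \<Sum>\<^sub>\<infinity>\<alpha>. ?N n \<alpha>"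
  have N0: "0 \<le> ?N n \<alpha>" for n \<alpha> using \<rho> by simp
  have m0: "0 \<le> ?m n" for n by (intro infsum_nonneg N0)
  have ms: "?m summable_on I"
    using a(2) m0 by (intro summable_on_comparison_test[OF M]) auto
  have inner: "(?N n has_sum ?m n) UNIV" if "n \<in> I" for n using a(1)[OF that] by simp
  have s: "(\<lambda>(n,\<alpha>). ?N n \<alpha>) summable_on (I \<times> UNIV)"
    using inner N0 ms by (intro summable_on_SigmaI[where g="?m"]) auto
  then have pair: "((\<lambda>(n,\<alpha>). ?N n \<alpha>) has_sum infsum ?m I) (I \<times> UNIV)"
    using inner ms by (intro has_sum_SigmaI[where g="?m"]) auto
  then have pair': "((\<lambda>(\<alpha>,n). ?N n \<alpha>) has_sum infsum ?m I) (UNIV \<times> I)"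
    using has_sum_swap[where f="\<lambda>(n,\<alpha>). ?N n \<alpha>" and A=I and B=UNIV] by simp
  have col: "(\<lambda>n. ?N n \<alpha>) summable_on I" for \<alpha>
    using summable_on_SigmaD1[of "\<lambda>\<alpha> n. ?N n \<alpha>" UNIV "\<lambda>_. I" \<alpha>] has_sum_imp_summable[OF pair'] by simp
  have colabs: "(\<lambda>n. norm (a n \<alpha>)) summable_on I" for \<alpha>
    using col[of \<alpha>] \<rho> summable_on_cmult_left'[of "\<rho> ^ deg \<alpha>" "\<lambda>n. norm (a n \<alpha>)" I] by simp
  then have coln: "(\<lambda>n. a n \<alpha>) summable_on I" for \<alpha>
    by (rule abs_summable_summable)
  define A where "A \<alpha> = (\<Sum>\<^sub>\<infinity>n\<in>I. a n \<alpha>)" for \<alpha>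
  let ?c = "\<lambda>\<alpha>. \<Sum>\<^sub>\<infinity>n\<in>I. ?N n \<alpha>"
  have c: "(?c has_sum infsum ?m I) UNIV"
    by (rule has_sum_SigmaD[OF pair']) (use col in auto)
  have Ac: "norm (A \<alpha>) * \<rho> ^ deg \<alpha> \<le> ?c \<alpha>" for \<alpha>
  proof -
    have "norm (A \<alpha>) \<le> (\<Sum>\<^sub>\<infinity>n\<in>I. norm (a n \<alpha>))"
      unfolding A_def by (intro norm_infsum_bound colabs)
    then show ?thesis
      using \<rho> by (simp add: infsum_cmult_left')
  qed
  have s1: "(\<lambda>\<alpha>. norm (A \<alpha>) * \<rho> ^ deg \<alpha>) summable_on UNIV"
    using Ac \<rho> by (intro summable_on_comparison_test[OF has_sum_imp_summable[OF c]]) auto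
  have "(\<Sum>\<^sub>\<infinity>\<alpha>. norm (A \<alpha>) * \<rho> ^ deg \<alpha>) \<le> infsum ?m I"
    using has_sum_mono[OF has_sum_infsum[OF s1] c] Ac by simp
  also have "\<dots> \<le> infsum M I"
    using a(2) by (intro infsum_mono ms M)
  finally have le: "(\<Sum>\<^sub>\<infinity>\<alpha>. norm (A \<alpha>) * \<rho> ^ deg \<alpha>) \<le> infsum M I" .
  have "((\<lambda>\<alpha>. mpow x \<alpha> *\<^sub>R A \<alpha>) has_sum g x) UNIV" if x: "\<forall>i. \<bar>x $ i\<bar> < \<rho>" for x
  proof -
    have "norm (mpow x \<alpha> *\<^sub>R a n \<alpha>) \<le> ?N n \<alpha>" for n \<alpha>
      using abs_mpow_le[of x \<rho> \<alpha>] x by (simp add: mult.commute[of "norm _"] mult_right_mono)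
    then have "(\<lambda>(n,\<alpha>). mpow x \<alpha> *\<^sub>R a n \<alpha>) summable_on (I \<times> UNIV)"
      using \<rho> by (intro abs_summable_summable[OF summable_on_comparison_test[OF s]]) (auto split: prod.splits)
    then have "((\<lambda>(n,\<alpha>). mpow x \<alpha> *\<^sub>R a n \<alpha>) has_sum g x) (I \<times> UNIV)"
      using a(3) x g by (intro has_sum_SigmaI[where g="\<lambda>n. f n x"]) auto
    then have "((\<lambda>(\<alpha>,n). mpow x \<alpha> *\<^sub>R a n \<alpha>) has_sum g x) (UNIV \<times> I)"
      using has_sum_swap[where f="\<lambda>(n,\<alpha>). mpow x \<alpha> *\<^sub>R a n \<alpha>" and A=I and B=UNIV] by simp
    then show ?thesis
      unfolding A_def
      by (rule has_sum_SigmaD) (use coln in \<open>auto intro!: has_sum_scaleR\<close>)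
  qed
  with s1 le show ?thesis unfolding cseries_iff by blast
qed

text \<open>Without a constant term every monomial gains a factor \<open>t\<close>, so shrinking the
  cube makes the majorant as small as desired. This brings an inner function into the disc of
  convergence of an outer series.\<close>

lemma cseries_vanishing:
  assumes "cseries \<rho> M f" "f 0 = 0" "0 < \<rho>" "0 \<le> t" "t \<le> 1"
  shows "cseries (t * \<rho>) (t * M) f"
proof -
  obtain a where a: "(\<lambda>\<alpha>. norm (a \<alpha>) * \<rho> ^ deg \<alpha>) summable_on UNIV"
     "(\<Sum>\<^sub>\<infinity>\<alpha>. norm (a \<alpha>) * \<rho> ^ deg \<alpha>) \<le> M"
     "\<And>x. (\<forall>i. \<bar>x $ i\<bar> < \<rho>) \<Longrightarrow> ((\<lambda>\<alpha>. mpow x \<alpha> *\<^sub>R a \<alpha>) has_sum f x) UNIV"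
    using assms(1) unfolding cseries_iff by auto
  have "((\<lambda>\<alpha>. mpow 0 \<alpha> *\<^sub>R a \<alpha>) has_sum a 0) UNIV"
    by (rule has_sum_finite_neutralI[of "{0}"]) (auto simp: mpow_origin)
  moreover have "((\<lambda>\<alpha>. mpow 0 \<alpha> *\<^sub>R a \<alpha>) has_sum 0) UNIV"
    using a(3)[of 0] assms by simp
  ultimately have a0: "a 0 = 0" by (rule has_sum_unique)
  have le: "norm (a \<alpha>) * (t * \<rho>) ^ deg \<alpha> \<le> t * (norm (a \<alpha>) * \<rho> ^ deg \<alpha>)" for \<alpha>
  proof (cases "\<alpha> = 0")
    case False
    then obtain i where i: "\<alpha> i \<noteq> 0" by (auto simp: fun_eq_iff)
    then have "deg \<alpha> \<noteq> 0" by (auto simp: deg_def)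
    then have "t ^ deg \<alpha> \<le> t" using power_decreasing[of 1 "deg \<alpha>" t] assms by auto
    then have "t ^ deg \<alpha> * (norm (a \<alpha>) * \<rho> ^ deg \<alpha>) \<le> t * (norm (a \<alpha>) * \<rho> ^ deg \<alpha>)"
      using assms by (intro mult_right_mono) auto
    then show ?thesis by (simp add: power_mult_distrib mult_ac)
  qed (simp add: a0)
  have s: "(\<lambda>\<alpha>. norm (a \<alpha>) * (t * \<rho>) ^ deg \<alpha>) summable_on UNIV"
    using le assms by (intro summable_on_comparison_test[OF summable_on_cmult_right[OF a(1), of t]]) auto
  have "(\<Sum>\<^sub>\<infinity>\<alpha>. norm (a \<alpha>) * (t * \<rho>) ^ deg \<alpha>) \<le> (\<Sum>\<^sub>\<infinity>\<alpha>. t * (norm (a \<alpha>) * \<rho> ^ deg \<alpha>))"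
    by (intro infsum_mono s summable_on_cmult_right a le)
  also have "\<dots> \<le> t * M" using a(2) assms by (simp add: infsum_cmult_right' mult_left_mono)
  finally have "(\<Sum>\<^sub>\<infinity>\<alpha>. norm (a \<alpha>) * (t * \<rho>) ^ deg \<alpha>) \<le> t * M" .
  moreover have "t * \<rho> \<le> \<rho>" using assms by (simp add: mult_left_le_one_le)
  ultimately show ?thesis
    unfolding cseries_iff using s a(3) by (intro exI[of _ a]) (auto intro: order_less_le_trans)
qed

lemma cseries_power:
  assumes "cseries \<rho> M f" "0 \<le> \<rho>"
  shows "cseries \<rho> (M ^ n) (\<lambda>x. f x ^ n)"
proof (induction n)
  case 0
  show ?case using cnorm.normal_series_const[of 1] by simp
next
  case (Suc n)
  show ?case using cmult.normal_series_bilinear[OF assms(1) Suc] assms by simp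
qed

lemma cseries_mpow:
  fixes T :: "real^'d \<Rightarrow> real^'e"
  assumes "\<And>i. cseries \<rho> r (\<lambda>x. of_real (T x $ i))" "0 \<le> \<rho>"
  shows "cseries \<rho> (r ^ deg \<alpha>) (\<lambda>x. of_real (mpow (T x) \<alpha>))"
proof -
  have "cseries \<rho> (\<Prod>i\<in>I. r ^ \<alpha> i) (\<lambda>x. \<Prod>i\<in>I. of_real (T x $ i) ^ \<alpha> i)" for I :: "'e set"
  proof (induction I rule: infinite_finite_induct)
    case (insert i I)
    show ?case
      using cmult.normal_series_bilinear[OF cseries_power[OF assms(1)[of i] assms(2)] insert.IH] insert assms(2) by simp
  qed (use cnorm.normal_series_const[of 1] in simp_all)
  from this[of UNIV] show ?thesis
    by (simp add: mpow_def deg_def power_sum)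
qed

lemma cseries_component: "cseries \<rho> \<rho> (\<lambda>x::real^'d. of_real (x $ i))"
proof -
  have d: "deg (\<lambda>j. if j = i then 1 else 0) = 1" by (simp add: deg_def)
  have m: "mpow x (\<lambda>j. if j = i then 1 else 0) = x $ i" for x :: "real^'d"
  proof -
    have "mpow x (\<lambda>j. if j = i then 1 else 0) = (\<Prod>j\<in>UNIV. if j = i then x $ i else 1)"
      unfolding mpow_def by (intro prod.cong) auto
    then show ?thesis by simp
  qed
  show ?thesis
    using cnorm.normal_series_monomial[of 1 \<rho> "\<lambda>j. if j = i then 1 else 0"] d m by (simp add: scaleR_conv_of_real)
qed

lemma cseries_linear:
  fixes l :: "real^'d \<Rightarrow> real"
  assumes "linear l"
  shows "\<exists>c\<ge>0. \<forall>\<rho>\<ge>0. cseries \<rho> (c * \<rho>) (\<lambda>x. of_real (l x))"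
proof -
  define v where "v j = l (axis j 1)" for j :: 'd
  have l: "l x = (\<Sum>j\<in>UNIV. v j * x $ j)" for x
  proof -
    have "x = (\<Sum>j\<in>UNIV. x $ j *\<^sub>R axis j 1)"
      using basis_expansion[of x] by (simp add: scalar_mult_eq_scaleR)
    then have "l x = l (\<Sum>j\<in>UNIV. x $ j *\<^sub>R axis j 1)" by simp
    then show ?thesis using assms by (simp add: linear_sum linear_scale mult.commute v_def)
  qed
  define c where "c = (\<Sum>j\<in>UNIV. \<bar>v j\<bar>)"
  have "cseries \<rho> (c * \<rho>) (\<lambda>x. of_real (l x))" if \<rho>: "0 \<le> \<rho>" for \<rho>
  proof -
    have "cseries \<rho> (\<Sum>j\<in>J. \<bar>v j\<bar> * \<rho>) (\<lambda>x. \<Sum>j\<in>J. of_real (v j) * of_real (x $ j))"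
      for J :: "'d set"
    proof (induction J rule: infinite_finite_induct)
      case (insert j J)
      have "cseries \<rho> (\<bar>v j\<bar> * \<rho>) (\<lambda>x. of_real (v j) * of_real (x $ j))"
        using cmult.normal_series_bilinear[OF cnorm.normal_series_const[of "of_real (v j)"] cseries_component[of _ j] \<rho>]
        by simp
      then show ?case
        using cnorm.normal_series_add[of \<rho>] insert \<rho> by simp
    qed (use cnorm.normal_series_const[of 0] in simp_all)
    from this[of UNIV] show ?thesis
      by (simp add: l c_def sum_distrib_right)
  qed
  then show ?thesis by (intro exI[of _ c]) (auto simp: c_def sum_nonneg)
qed

text \<open>On a small enough cube each component of \<open>T x\<close> has majorant at most
  \<open>\<rho>\<close>. Inserting \<open>T x\<close> into the series at \<open>T k0\<close>, the
  term of exponent \<open>\<alpha>\<close> then has majorant at most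
  \<open>norm (a \<alpha>) * \<rho> ^ deg \<alpha>\<close>, which is summable.\<close>

lemma canalytic_linear_comp:
  fixes T :: "real^'d \<Rightarrow> real^'e"
  assumes T: "linear T" and f: "canalytic f (T k0)"
  shows "canalytic (\<lambda>k. f (T k)) k0"
proof -
  obtain \<rho> M where \<rho>: "0 < \<rho>" and n: "cseries \<rho> M (\<lambda>x. f (T k0 + x))"
    using f unfolding analytic_near_def by blast
  obtain a where a: "(\<lambda>\<alpha>. norm (a \<alpha>) * \<rho> ^ deg \<alpha>) summable_on UNIV"
     "(\<Sum>\<^sub>\<infinity>\<alpha>. norm (a \<alpha>) * \<rho> ^ deg \<alpha>) \<le> M"
     "\<And>x. (\<forall>i. \<bar>x $ i\<bar> < \<rho>) \<Longrightarrow> ((\<lambda>\<alpha>. mpow x \<alpha> *\<^sub>R a \<alpha>) has_sum f (T k0 + x)) UNIV"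
    using n unfolding cseries_iff by auto
  have "\<forall>i. \<exists>c\<ge>0. \<forall>\<rho>\<ge>0. cseries \<rho> (c * \<rho>) (\<lambda>x. of_real (T x $ i))"
    using T by (intro allI cseries_linear linear_compose[of T "\<lambda>y. y $ _", unfolded o_def])
      (auto simp: linear_iff)
  then obtain c where c: "\<And>i. c i \<ge> 0" "\<And>i \<rho>. \<rho> \<ge> 0 \<Longrightarrow> cseries \<rho> (c i * \<rho>) (\<lambda>x. of_real (T x $ i))"
    by metis
  obtain K where K: "\<And>x. norm (T x) \<le> K * norm x" "0 < K"
    using linear_bounded_pos[OF T] by (auto simp: mult.commute)
  \<comment> \<open>With \<open>r = \<rho> / d\<close>, the first entry keeps \<open>T x\<close> in
    the cube of half-side \<open>\<rho>\<close>, by way of the l1 norm; the second bounds the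
    majorant of every component of \<open>T x\<close> by \<open>\<rho>\<close>.\<close>
  define d where "d = max (K * CARD('d)) (\<Sum>i\<in>UNIV. c i)"
  have d: "0 < d" "c i \<le> d" for i
    using K(2) member_le_sum[of i UNIV c] c(1) by (auto simp: d_def less_max_iff_disj intro: max.coboundedI2)
  define r where "r = \<rho> / d"
  have r: "0 < r" using \<rho> d by (simp add: r_def)
  have comp: "cseries r \<rho> (\<lambda>x. of_real (T x $ i))" for i
    using c(2)[of r i] r d \<rho> mult_right_mono[OF d(2)[of i], of r]
    by (intro normal_series_le[of _ _ r "c i * r" _ \<rho>]) (auto simp: r_def)
  have small: "\<bar>T x $ i\<bar> < \<rho>" if x: "\<And>i. \<bar>x $ i\<bar> < r" for x i
  proof -
    have "\<bar>T x $ i\<bar> \<le> norm (T x)" by (rule component_le_norm_cart)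
    also have "\<dots> \<le> K * norm x" by (rule K)
    also have "\<dots> \<le> K * (\<Sum>j\<in>UNIV. \<bar>x $ j\<bar>)" using K(2) norm_le_l1_cart by (intro mult_left_mono) auto
    also have "\<dots> < K * (\<Sum>j\<in>(UNIV::'d set). r)"
      using K(2) x by (intro mult_strict_left_mono sum_strict_mono) auto
    also have "\<dots> = (K * CARD('d)) * r" by simp
    also have "\<dots> \<le> d * r" using r by (intro mult_right_mono) (auto simp: d_def)
    also have "\<dots> = \<rho>" using d by (simp add: r_def)
    finally show ?thesis .
  qed
  have "cseries r (infsum (\<lambda>\<alpha>. norm (a \<alpha>) * \<rho> ^ deg \<alpha>) UNIV) (\<lambda>x. f (T (k0 + x)))"
  proof (rule cseries_infsum[OF _ a(1) r])
    show "cseries r (norm (a \<alpha>) * \<rho> ^ deg \<alpha>) (\<lambda>x. a \<alpha> * of_real (mpow (T x) \<alpha>))" for \<alpha>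
      using cmult.normal_series_bilinear[OF cnorm.normal_series_const[of "a \<alpha>"] cseries_mpow[OF comp, of \<alpha>]] r by simp
    show "((\<lambda>\<alpha>. a \<alpha> * of_real (mpow (T x) \<alpha>)) has_sum f (T (k0 + x))) UNIV"
      if "\<And>i. \<bar>x $ i\<bar> < r" for x
      using a(3)[of "T x"] small[OF that] T by (simp add: linear_add scaleR_conv_of_real mult.commute)
  qed
  then show ?thesis unfolding analytic_near_def using r by blast
qed

lemma canalytic_linear:
  fixes l :: "real^'d \<Rightarrow> real"
  assumes "linear l"
  shows "canalytic (\<lambda>k. of_real (l k)) k0"
proof -
  obtain c where "cseries 1 (c * 1) (\<lambda>x. of_real (l x))"
    using cseries_linear[OF assms] zero_le_one by blast
  then have "cseries 1 (norm (complex_of_real (l k0)) + c * 1) (\<lambda>x. of_real (l k0) + of_real (l x))"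
    by (intro cnorm.normal_series_add cnorm.normal_series_const) auto
  then have "cseries 1 (norm (complex_of_real (l k0)) + c * 1) (\<lambda>x. of_real (l (k0 + x)))"
    using assms by (simp add: linear_add)
  then show ?thesis unfolding analytic_near_def using zero_less_one by blast
qed

text \<open>Inserts \<open>f - f k0\<close> into the Taylor series of \<open>F\<close> at
  \<open>f k0\<close>. The inserted function vanishes at \<open>k0\<close>, so its majorant can be
  brought down to \<open>r / 2\<close>, inside the disc.\<close>

lemma canalytic_holomorphic_comp:
  assumes F: "F holomorphic_on ball (f k0) r" and r: "0 < r" and f: "canalytic f k0"
  shows "canalytic (\<lambda>k. F (f k)) k0"
proof -
  let ?z = "f k0"
  define c where "c n = (deriv ^^ n) F ?z / fact n" for n
  have c: "(\<lambda>n. c n * (w - ?z) ^ n) sums F w" if "w \<in> ball ?z r" for w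
    unfolding c_def by (rule holomorphic_power_series[OF F that])
  \<comment> \<open>Any radius strictly between \<open>r / 2\<close> and \<open>r\<close> serves:
    convergence at \<open>2 * r / 3\<close> gives absolute convergence at
    \<open>r / 2\<close>.\<close>
  have "summable (\<lambda>n. c n * (of_real (2*r/3)) ^ n)"
    using c[of "?z + of_real (2*r/3)"] r by (auto simp: dist_norm sums_iff norm_mult)
  then have sm: "summable (\<lambda>n. norm (c n * (of_real (r/2)) ^ n))"
    using r by (intro powser_insidea[of c "of_real (2*r/3)" "of_real (r/2)"]) (auto simp: norm_divide norm_mult)
  have smo: "(\<lambda>n. norm (c n) * (r/2) ^ n) summable_on UNIV"
  proof (rule summable_nonneg_imp_summable_on)
    have "(\<lambda>n. norm (c n * (of_real (r/2)) ^ n)) = (\<lambda>n. norm (c n) * (r/2) ^ n)"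
      using r by (simp add: norm_mult norm_power norm_divide)
    with sm show "summable (\<lambda>n. norm (c n) * (r/2) ^ n)" by simp
  qed (use r in auto)
  obtain \<rho> M where \<rho>: "0 < \<rho>" and n: "cseries \<rho> M (\<lambda>x. f (k0 + x))"
    using f unfolding analytic_near_def by blast
  let ?g = "\<lambda>x. f (k0 + x) - ?z"
  define M' where "M' = max (M + norm ?z) r"
  have "cseries \<rho> (M + norm (- ?z)) (\<lambda>x. f (k0 + x) + (- ?z))"
    using \<rho> by (intro cnorm.normal_series_add n cnorm.normal_series_const) auto
  then have g: "cseries \<rho> M' ?g" by (simp add: M'_def normal_series_le)
  have M': "r \<le> M'" "0 < M'" using r by (auto simp: M'_def)
  \<comment> \<open>Chosen so that \<open>t * M' = r / 2\<close>; the maximum in \<open>M'\<close>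
    ensures \<open>t \<le> 1 / 2\<close>.\<close>
  define t where "t = r / (2 * M')"
  have t: "0 < t" "t \<le> 1" "t * M' = r / 2" using M' r by (auto simp: t_def)
  have g': "cseries (t * \<rho>) (r / 2) ?g"
    using cseries_vanishing[OF g _ \<rho>, of t] t by simp
  have "t < 1" using M' r by (auto simp: t_def)
  then have small: "norm (?g x) \<le> r / 2" if "\<And>i. \<bar>x $ i\<bar> < t * \<rho>" for x
    using cnorm.normal_series_bound[OF g \<rho>, of t x] t that by (auto dest: less_imp_le)
  have "cseries (t * \<rho>) (infsum (\<lambda>n. norm (c n) * (r/2) ^ n) UNIV) (\<lambda>x. F (f (k0 + x)))"
  proof (rule cseries_infsum[OF _ smo])
    show "cseries (t * \<rho>) (norm (c n) * (r/2) ^ n) (\<lambda>x. c n * ?g x ^ n)" for n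
      using cmult.normal_series_bilinear[OF cnorm.normal_series_const[of "c n"] cseries_power[OF g', of n]] t \<rho> by simp
    show "((\<lambda>n. c n * ?g x ^ n) has_sum F (f (k0 + x))) UNIV" if x: "\<And>i. \<bar>x $ i\<bar> < t * \<rho>" for x
    proof (rule norm_summable_imp_has_sum)
      have sx: "norm (?g x) \<le> r / 2" by (rule small[OF x])
      then show "(\<lambda>n. c n * ?g x ^ n) sums F (f (k0 + x))"
        using c[of "f (k0 + x)"] r by (simp add: dist_norm norm_minus_commute)
      show "summable (\<lambda>n. norm (c n * ?g x ^ n))"
        using sx r by (intro summable_comparison_test'[OF sm])
          (auto simp: norm_mult norm_power norm_divide intro!: mult_left_mono power_mono)
    qed
  qed (use t \<rho> in auto)
  then show ?thesis unfolding analytic_near_def using t \<rho> by (intro exI[of _ "t * \<rho>"]) auto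
qed

lemma canalytic_mult: "canalytic f k0 \<Longrightarrow> canalytic g k0 \<Longrightarrow> canalytic (\<lambda>k. f k * g k) k0"
  using cmult.analytic_near_bilinear by simp

lemma canalytic_continuous:
  assumes "canalytic f k0"
  shows "isCont f k0"
proof -
  have "((\<lambda>k. f k - f k0) \<longlongrightarrow> 0) (nhds k0)"
    by (rule tendsto_norm_zero_cancel[OF cnorm.analytic_near_continuous[OF assms]]) simp
  then have "(f \<longlongrightarrow> f k0) (nhds k0)" by (rule LIM_zero_cancel)
  then show ?thesis unfolding isCont_def by (rule tendsto_mono[rotated]) (simp add: at_within_def)
qed

section \<open>Lattices with a basis matrix, their reciprocals and their cells\<close>

definition ivec :: "('d \<Rightarrow> int) \<Rightarrow> real^'d" where
  "ivec n = (\<chi> i. of_int (n i))"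

lemma ivec_component [simp]: "ivec n $ i = of_int (n i)"
  by (simp add: ivec_def)

lemma ivec_add: "ivec (m + n) = ivec m + ivec n" and ivec_uminus: "ivec (- n) = - ivec n"
  and ivec_zero: "ivec 0 = 0"
  by (simp_all add: vec_eq_iff)

lemma inner_transpose: "(transpose A *v x) \<bullet> y = x \<bullet> (A *v (y :: real^'d))"
  by (simp add: dot_lmul_matrix[symmetric])

text \<open>The columns of \<open>A\<close> are a basis of the lattice and \<open>A'\<close> reads
  off coordinates, so questions about the lattice become questions about integer vectors.\<close>

locale lattice_basis =
  fixes A A' :: "real^'d^'d" and L :: "(real^'d) set"
  assumes right_inv: "A ** A' = mat 1" and left_inv: "A' ** A = mat 1"
    and L_def: "L = range (\<lambda>n. A *v ivec n)"
begin

lemma A_A' [simp]: "A *v (A' *v x) = x" and A'_A [simp]: "A' *v (A *v x) = x"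
  by (simp_all add: matrix_vector_mul_assoc right_inv left_inv)

lemma memI: "A *v ivec n \<in> L"
  by (simp add: L_def)

lemma add_mem: "x \<in> L \<Longrightarrow> y \<in> L \<Longrightarrow> x + y \<in> L"
  unfolding L_def by (auto simp: matrix_vector_right_distrib[symmetric] ivec_add[symmetric])

lemma uminus_mem: "x \<in> L \<Longrightarrow> - x \<in> L"
proof -
  assume "x \<in> L"
  then obtain n where "x = A *v ivec n" by (auto simp: L_def)
  then have "- x = A *v ivec (- n)"
    by (simp add: ivec_uminus linear_neg[OF matrix_vector_mul_linear])
  then show ?thesis using memI by simp
qed

lemma zero_mem: "0 \<in> L"
  using memI[of 0] by (simp add: ivec_zero)

lemma diff_mem: "x \<in> L \<Longrightarrow> y \<in> L \<Longrightarrow> x - y \<in> L"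
  using add_mem[of x "- y"] uminus_mem by simp

lemma mem_iff: "x \<in> L \<longleftrightarrow> (\<forall>i. \<exists>n::int. (A' *v x) $ i = of_int n)"
proof
  assume "\<forall>i. \<exists>n::int. (A' *v x) $ i = of_int n"
  then obtain n :: "'d \<Rightarrow> int" where "\<And>i. (A' *v x) $ i = of_int (n i)" by metis
  then have "A' *v x = ivec n" by (simp add: vec_eq_iff)
  then have "x = A *v ivec n" by (metis A_A')
  then show "x \<in> L" using memI by simp
qed (auto simp: L_def)

text \<open>The dual basis is \<open>2 * pi\<close> times the inverse transpose: pairing with the
  basis vectors \<open>A *v axis i 1\<close> recovers the integer coordinates of a reciprocal
  vector.\<close>

lemma reciprocal: "lattice_basis ((2 * pi) *\<^sub>R transpose A') ((1 / (2 * pi)) *\<^sub>R transpose A) (reciprocal_lattice L)"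
proof
  show "(2 * pi) *\<^sub>R transpose A' ** (1 / (2 * pi)) *\<^sub>R transpose A = mat 1"
    "(1 / (2 * pi)) *\<^sub>R transpose A ** (2 * pi) *\<^sub>R transpose A' = mat 1"
    by (simp_all add: scalar_matrix_assoc[symmetric] matrix_scalar_ac matrix_transpose_mul[symmetric]
        right_inv left_inv)
  show "reciprocal_lattice L = range (\<lambda>n. ((2 * pi) *\<^sub>R transpose A') *v ivec n)"
  proof safe
    fix n
    have "(((2 * pi) *\<^sub>R transpose A') *v ivec n) \<bullet> (A *v ivec m) = 2 * pi * of_int (\<Sum>i\<in>UNIV. n i * m i)" for m
    proof -
      have "(((2 * pi) *\<^sub>R transpose A') *v ivec n) \<bullet> (A *v ivec m) = 2 * pi * (ivec n \<bullet> (A' *v (A *v ivec m)))"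
        by (simp add: scaleR_matrix_vector_assoc[symmetric] dot_lmul_matrix)
      then show ?thesis by (simp add: inner_vec_def)
    qed
    then show "((2 * pi) *\<^sub>R transpose A') *v ivec n \<in> reciprocal_lattice L"
      unfolding reciprocal_lattice_def L_def by blast
  next
    fix K assume K: "K \<in> reciprocal_lattice L"
    have "\<exists>m::int. K \<bullet> (A *v axis i 1) = 2 * pi * of_int m" for i
    proof -
      have "ivec (\<lambda>j. if j = i then 1 else 0) = axis i 1" by (simp add: vec_eq_iff axis_def)
      then show ?thesis using K memI[of "\<lambda>j. if j = i then 1 else 0"] unfolding reciprocal_lattice_def by auto
    qed
    then obtain m :: "'d \<Rightarrow> int" where m: "\<And>i. K \<bullet> (A *v axis i 1) = 2 * pi * of_int (m i)" by metis
    have "transpose A *v K = (2 * pi) *\<^sub>R ivec m"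
    proof (simp only: vec_eq_iff, intro allI)
      fix i
      have "(transpose A *v K) $ i = (transpose A *v K) \<bullet> axis i 1" by (simp add: inner_axis)
      also have "\<dots> = K \<bullet> (A *v axis i 1)" by (rule inner_transpose)
      finally show "(transpose A *v K) $ i = ((2 * pi) *\<^sub>R ivec m) $ i" by (simp add: m)
    qed
    then have "transpose A' *v (transpose A *v K) = (2 * pi) *\<^sub>R (transpose A' *v ivec m)"
      by (simp add: matrix_vector_mult_scaleR)
    then have "K = ((2 * pi) *\<^sub>R transpose A') *v ivec m"
      by (simp add: vector_matrix_mul_assoc right_inv scaleR_matrix_vector_assoc[symmetric])
    then show "K \<in> range (\<lambda>n. ((2 * pi) *\<^sub>R transpose A') *v ivec n)" by blast
  qed
qed

text \<open>Pairing \<open>y\<close> with the dual basis returns \<open>2 * pi\<close> times its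
  coordinates. In this way periodicity in the wavevector forces displacements of the site to be
  lattice vectors.\<close>

lemma double_reciprocal:
  assumes "\<And>K. K \<in> reciprocal_lattice L \<Longrightarrow> \<exists>n::int. K \<bullet> y = 2 * pi * of_int n"
  shows "y \<in> L"
proof -
  have "\<exists>n::int. (A' *v y) $ i = of_int n" for i
  proof -
    let ?e = "\<lambda>j. if j = i then 1 else (0::int)"
    have e: "ivec ?e = axis i 1" by (simp add: vec_eq_iff axis_def)
    obtain n :: int where "(((2 * pi) *\<^sub>R transpose A') *v ivec ?e) \<bullet> y = 2 * pi * of_int n"
      using assms[OF lattice_basis.memI[OF reciprocal, of ?e]] by blast
    then have "2 * pi * (axis i 1 \<bullet> (A' *v y)) = 2 * pi * of_int n"
      by (simp add: e scaleR_matrix_vector_assoc[symmetric] dot_lmul_matrix)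
    then show ?thesis by (auto simp: inner_axis')
  qed
  then show ?thesis unfolding mem_iff by blast
qed

text \<open>The representative in the half-open parallelepiped of the basis. It is unique and
  exactly periodic at every point, whereas translates of the Wigner-Seitz cell share their
  boundaries.\<close>

definition red :: "real^'d \<Rightarrow> real^'d" where
  "red x = A *v (\<chi> i. frac ((A' *v x) $ i))"

lemma red_diff: "x - red x \<in> L"
proof -
  have "A' *v (x - red x) = ivec (\<lambda>i. \<lfloor>(A' *v x) $ i\<rfloor>)"
    by (simp add: red_def matrix_vector_mult_diff_distrib vec_eq_iff frac_def)
  then have "x - red x = A *v ivec (\<lambda>i. \<lfloor>(A' *v x) $ i\<rfloor>)" by (metis A_A')
  then show ?thesis using memI by simp
qed

lemma red_add: "R \<in> L \<Longrightarrow> red (x + R) = red x"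
proof -
  assume "R \<in> L"
  then obtain n where R: "R = A *v ivec n" by (auto simp: L_def)
  have "frac (u + of_int m) = frac u" for u :: real and m :: int by (simp add: frac_def)
  then show ?thesis by (simp add: red_def R matrix_vector_right_distrib)
qed

lemma red_bounded: "\<exists>D>0. \<forall>x. norm (red x) \<le> D"
proof -
  obtain K where K: "0 < K" "\<And>x. norm (A *v x) \<le> K * norm x"
    using linear_bounded_pos[OF matrix_vector_mul_linear[of A]] by (auto simp: mult.commute)
  have "norm (red x) \<le> K * CARD('d)" for x
  proof -
    let ?f = "(\<chi> i. frac ((A' *v x) $ i)) :: real^'d"
    have "norm ?f \<le> (\<Sum>i\<in>UNIV. \<bar>?f $ i\<bar>)" by (rule norm_le_l1_cart)
    also have "\<dots> \<le> (\<Sum>i\<in>(UNIV::'d set). 1)"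
      by (intro sum_mono) (simp add: frac_ge_0 less_imp_le[OF frac_lt_1])
    finally have "norm ?f \<le> CARD('d)" by simp
    then show ?thesis unfolding red_def using K by (meson order_trans mult_left_mono less_imp_le)
  qed
  then show ?thesis using K by (intro exI[of _ "K * CARD('d)"]) auto
qed

lemma red_measurable: "red \<in> borel_measurable borel"
proof -
  have f: "(frac :: real \<Rightarrow> real) \<in> borel_measurable borel"
    unfolding frac_def[abs_def] by measurable
  have "(\<lambda>x. (A' *v x) $ i) \<in> borel_measurable borel" for i
    by (intro borel_measurable_continuous_onI continuous_intros linear_continuous_on matrix_vector_mul_bounded_linear)
  then have m: "(\<lambda>x. frac ((A' *v x) $ i)) \<in> borel_measurable borel" for i
    using measurable_compose[OF _ f] by blast
  have "red x = (\<Sum>i\<in>UNIV. frac ((A' *v x) $ i) *\<^sub>R (A *v axis i 1))" for x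
  proof -
    have "(\<chi> i. frac ((A' *v x) $ i)) = (\<Sum>i\<in>UNIV. frac ((A' *v x) $ i) *\<^sub>R axis i (1::real))"
      using basis_expansion[of "\<chi> i. frac ((A' *v x) $ i)"] by (simp add: scalar_mult_eq_scaleR)
    then show ?thesis
      unfolding red_def by (simp add: linear_sum[OF matrix_vector_mul_linear] matrix_vector_mult_scaleR)
  qed
  then have eq: "red = (\<lambda>x. \<Sum>i\<in>UNIV. frac ((A' *v x) $ i) *\<^sub>R (A *v axis i 1))" by (rule ext)
  show ?thesis
    unfolding eq by (intro borel_measurable_sum borel_measurable_scaleR borel_measurable_const m)
qed

lemma finite_bounded: "finite {R \<in> L. norm R \<le> r}"
proof -
  obtain K where K: "0 < K" "\<And>x. norm (A' *v x) \<le> K * norm x"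
    using linear_bounded_pos[OF matrix_vector_mul_linear[of A']] by (auto simp: mult.commute)
  have "{R \<in> L. norm R \<le> r} \<subseteq> (\<lambda>n. A *v ivec n) ` (PiE UNIV (\<lambda>_. {- \<lceil>K * r\<rceil>..\<lceil>K * r\<rceil>}))"
  proof
    fix R assume "R \<in> {R \<in> L. norm R \<le> r}"
    then obtain n where n: "R = A *v ivec n" "norm R \<le> r" by (auto simp: L_def)
    have "\<bar>of_int (n i)\<bar> \<le> K * r" for i
    proof -
      have "\<bar>real_of_int (n i)\<bar> = \<bar>(A' *v R) $ i\<bar>" by (simp add: n)
      also have "\<dots> \<le> norm (A' *v R)" by (rule component_le_norm_cart)
      also have "\<dots> \<le> K * norm R" by (rule K)
      also have "\<dots> \<le> K * r" using K n by simp
      finally show ?thesis .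
    qed
    then have "real_of_int \<bar>n i\<bar> \<le> of_int \<lceil>K * r\<rceil>" for i
      using le_of_int_ceiling[of "K * r"] order_trans by (simp only: of_int_abs) blast
    then have "\<bar>n i\<bar> \<le> \<lceil>K * r\<rceil>" for i
      by (simp only: of_int_le_iff)
    then have "- \<lceil>K * r\<rceil> \<le> n i \<and> n i \<le> \<lceil>K * r\<rceil>" for i
      by (simp only: abs_le_iff minus_le_iff)
    then have "n i \<in> {- \<lceil>K * r\<rceil>..\<lceil>K * r\<rceil>}" for i
      by simp
    then have "n \<in> PiE UNIV (\<lambda>_. {- \<lceil>K * r\<rceil>..\<lceil>K * r\<rceil>})" by auto
    with n show "R \<in> (\<lambda>n. A *v ivec n) ` (PiE UNIV (\<lambda>_. {- \<lceil>K * r\<rceil>..\<lceil>K * r\<rceil>}))" by blast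
  qed
  then show ?thesis by (rule finite_subset) (auto intro!: finite_imageI finite_PiE)
qed

text \<open>A point of the cell is no longer than any of its lattice translates, in particular
  \<open>red x\<close>.\<close>

lemma unit_cell_bounded: "\<exists>D>0. \<forall>x\<in>unit_cell L. norm x \<le> D"
proof -
  obtain D where D: "D > 0" "\<And>x. norm (red x) \<le> D" using red_bounded by blast
  have "norm x \<le> D" if "x \<in> unit_cell L" for x
  proof -
    have "norm x \<le> norm (x - (x - red x))" using that red_diff unfolding unit_cell_def by blast
    with D(2)[of x] show ?thesis by simp
  qed
  with D show ?thesis by blast
qed

lemma unit_cell_compact: "compact (unit_cell L)"
proof -
  have "unit_cell L = (\<Inter>R\<in>L. {r. norm r \<le> norm (r - R)})" by (auto simp: unit_cell_def)
  moreover have "closed {r. norm r \<le> norm (r - R)}" for R :: "real^'d"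
    by (intro closed_Collect_le continuous_intros)
  ultimately have "closed (unit_cell L)" by auto
  moreover have "bounded (unit_cell L)" using unit_cell_bounded unfolding bounded_iff by blast
  ultimately show ?thesis by (simp add: compact_eq_bounded_closed)
qed

text \<open>Subtract a nearest lattice vector. It exists because a vector longer than
  \<open>2 * norm x\<close> is farther from \<open>x\<close> than 0 is, which leaves finitely many
  candidates.\<close>

lemma unit_cell_cover: "\<exists>R\<in>L. x - R \<in> unit_cell L"
proof -
  let ?F = "{R \<in> L. norm R \<le> 2 * norm x}"
  have F0: "0 \<in> ?F" using zero_mem by simp
  have F1: "finite ?F" by (rule finite_bounded)
  have F2: "?F \<noteq> {}" by (metis F0 empty_iff)
  note F = F1 F2
  define R where "R = arg_min_on (\<lambda>R. norm (x - R)) ?F"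
  have R: "R \<in> ?F" "\<And>R'. R' \<in> ?F \<Longrightarrow> norm (x - R) \<le> norm (x - R')"
    unfolding R_def by (rule arg_min_if_finite(1)[OF F], rule arg_min_least[OF F])
  have "norm (x - R) \<le> norm (x - R')" if "R' \<in> L" for R'
  proof (cases "norm R' \<le> 2 * norm x")
    case False
    have "norm (x - R) \<le> norm x" using R(2)[of 0] zero_mem by simp
    also have "\<dots> \<le> norm (x - R')" using False norm_triangle_ineq2[of R' x] norm_minus_commute[of x R'] by simp
    finally show ?thesis .
  qed (use R that in auto)
  then have "norm (x - R) \<le> norm (x - R - R')" if "R' \<in> L" for R'
    using that add_mem[of R R'] R(1) by (simp add: diff_diff_eq)
  then show ?thesis using R(1) unfolding unit_cell_def by blast
qed

end

lemma full_rank_lattice_basis: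
  fixes L :: "(real^'d) set"
  assumes "full_rank_lattice L"
  obtains A A' where "lattice_basis A A' L"
proof -
  obtain B where B: "independent B" "span B = UNIV"
     "L = {(\<Sum>b\<in>B. of_int (n b) *\<^sub>R b) | n :: real^'d \<Rightarrow> int. True}"
    using assms unfolding full_rank_lattice_def by blast
  have fin: "finite B" using B(1) independent_imp_finite by blast
  have "card B = CARD('d)"
    using B dim_eq_card[of B UNIV] by (simp add: dim_UNIV)
  then obtain e :: "'d \<Rightarrow> real^'d" where e: "bij_betw e UNIV B"
    using finite_same_card_bij[of "UNIV :: 'd set" B] fin by auto
  define A :: "real^'d^'d" where "A = (\<chi> i j. e j $ i)"
  have col: "columns A = B"
    using e by (auto simp: columns_def column_def A_def bij_betw_def vec_nth_inverse)
  then have "\<exists>A'. A ** A' = mat 1"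
    using B(2) by (simp add: matrix_right_invertible_span_columns span_vec_eq)
  then obtain A' where A': "A ** A' = mat 1" by blast
  have Av: "A *v x = (\<Sum>j\<in>UNIV. x $ j *\<^sub>R e j)" for x
    by (simp add: vec_eq_iff matrix_vector_mult_def A_def mult.commute)
  have "L = range (\<lambda>n. A *v ivec n)"
  proof safe
    fix x assume "x \<in> L"
    then obtain n :: "real^'d \<Rightarrow> int" where "x = (\<Sum>b\<in>B. of_int (n b) *\<^sub>R b)" using B(3) by blast
    also have "\<dots> = A *v ivec (\<lambda>j. n (e j))"
      unfolding Av by (subst sum.reindex_bij_betw[OF e, symmetric]) simp
    finally show "x \<in> range (\<lambda>n. A *v ivec n)" by blast
  next
    fix n :: "'d \<Rightarrow> int"
    have "A *v ivec n = (\<Sum>b\<in>B. of_int (n (the_inv e b)) *\<^sub>R b)"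
      unfolding Av using e by (subst sum.reindex_bij_betw[OF e, symmetric]) (simp add: the_inv_f_f bij_betw_def)
    then show "A *v ivec n \<in> L" using B(3) by auto
  qed
  then have "lattice_basis A A' L"
    using A' matrix_left_right_inverse by unfold_locales auto
  then show ?thesis by (rule that)
qed

text \<open>The Wigner-Seitz cell is defined by lengths alone, so linear isometries of the lattice
  preserve it exactly. Integrals over the unit cell and over the zone then transform by a change of
  variables without recutting the domain.\<close>

lemma orthogonal_unit_cell:
  assumes "orthogonal_transformation T" "T ` L = L"
  shows "T ` unit_cell L = unit_cell L"
proof -
  have sub: "T ` unit_cell L \<subseteq> unit_cell L" if T: "orthogonal_transformation T" "T ` L = L" for T
  proof (rule image_subsetI)
    fix x assume x: "x \<in> unit_cell L"
    have "norm (T x) \<le> norm (T x - R)" if "R \<in> L" for R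
    proof -
      have "R \<in> T ` L" using T(2) that by simp
      then obtain R' where R': "R' \<in> L" "R = T R'" by (elim imageE)
      have "norm (T x) = norm x" using T(1) by (rule orthogonal_transformation_norm)
      also have "\<dots> \<le> norm (x - R')" using x R'(1) by (simp add: unit_cell_def)
      also have "\<dots> = norm (T (x - R'))" using orthogonal_transformation_norm[OF T(1)] by simp
      also have "T (x - R') = T x - R"
        unfolding R'(2) by (rule linear_diff[OF orthogonal_transformation_linear[OF T(1)]])
      finally show ?thesis .
    qed
    then show "T x \<in> unit_cell L" by (simp add: unit_cell_def)
  qed
  define T' where "T' = inv_into UNIV T"
  have T': "orthogonal_transformation T'" "T' (T x) = x" "T (T' x) = x" for x
    unfolding T'_def using orthogonal_transformation_inv[OF assms(1)]
      orthogonal_transformation_inj[OF assms(1)] orthogonal_transformation_surj[OF assms(1)]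
    by (simp_all add: surj_f_inv_f)
  have "T' ` (T ` L) = L" by (simp add: image_image T'(2))
  then have "T' ` L = L" using assms(2) by simp
  then have "T' ` unit_cell L \<subseteq> unit_cell L" by (rule sub[OF T'(1)])
  then have "T ` T' ` unit_cell L \<subseteq> T ` unit_cell L" by (rule image_mono)
  then have "unit_cell L \<subseteq> T ` unit_cell L" by (simp add: image_image T'(3))
  with sub[OF assms] show ?thesis by (rule subset_antisym)
qed

lemma continuous_integer_constant:
  fixes f :: "real^'d \<Rightarrow> real"
  assumes "continuous_on UNIV f" "\<And>k. \<exists>n::int. f k = of_int n"
  shows "f k = f 0"
proof -
  have "f constant_on UNIV"
  proof (rule continuous_discrete_range_constant[OF connected_UNIV assms(1)])
    fix x
    show "\<exists>e>0. \<forall>y. y \<in> UNIV \<and> f y \<noteq> f x \<longrightarrow> e \<le> norm (f y - f x)"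
    proof (intro exI[of _ 1] conjI allI impI)
      fix y assume "y \<in> UNIV \<and> f y \<noteq> f x"
      moreover obtain m n :: int where "f x = of_int m" "f y = of_int n" using assms(2) by blast
      ultimately show "1 \<le> norm (f y - f x)" by (auto simp: simp flip: of_int_diff of_int_abs)
    qed simp
  qed
  then show ?thesis by (auto simp: constant_on_def)
qed

lemma sum_apply: "(\<Sum>i\<in>I. f i) x = (\<Sum>i\<in>I. f i x)"
  by (induction I rule: infinite_finite_induct) auto

text \<open>The components of the vector are the values at the unit vectors. Applied to phase
  increments along reciprocal vectors, it supplies the position of the site.\<close>

lemma additive_ivec:
  fixes F :: "('d::finite \<Rightarrow> int) \<Rightarrow> real"
  assumes "\<And>m n. F (m + n) = F m + F n"
  shows "\<exists>v::real^'d. \<forall>n. F n = v \<bullet> ivec n"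
proof -
  interpret additive F by standard (rule assms)
  let ?e = "\<lambda>i j. if j = i then 1 else (0::int)"
  have scale_nat: "F (\<lambda>j. of_nat m * n j) = of_nat m * F n" for m n
  proof (induction m)
    case 0
    then show ?case using zero by (simp add: zero_fun_def)
  next
    case (Suc m)
    have "(\<lambda>j. of_nat (Suc m) * n j) = n + (\<lambda>j. of_nat m * n j)" by (auto simp: algebra_simps)
    then show ?case using Suc by (simp add: assms algebra_simps)
  qed
  have scale: "F (\<lambda>j. m * n j) = of_int m * F n" for m :: int and n
  proof (cases m)
    case (nonneg k)
    then show ?thesis using scale_nat by simp
  next
    case (neg k)
    have "(\<lambda>j. m * n j) = - (\<lambda>j. of_nat (Suc k) * n j)" unfolding neg fun_eq_iff by (simp add: algebra_simps)
    then have "F (\<lambda>j. m * n j) = - F (\<lambda>j. of_nat (Suc k) * n j)" by (simp only: minus)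
    also have "\<dots> = of_int m * F n" proof -
      have "of_int m = - real (Suc k)" using neg by simp
      then show ?thesis unfolding scale_nat by (simp only: mult_minus_left)
    qed
    finally show ?thesis .
  qed
  have "F n = (\<chi> i. F (?e i)) \<bullet> ivec n" for n
  proof -
    have "n = (\<Sum>i\<in>UNIV. (\<lambda>j. n i * ?e i j))" by (auto simp: fun_eq_iff sum_apply if_distrib cong: if_cong)
    then have "F n = (\<Sum>i\<in>UNIV. F (\<lambda>j. n i * ?e i j))" by (metis (no_types) sum)
    then show ?thesis by (simp only: scale) (simp add: inner_vec_def mult.commute)
  qed
  then show ?thesis by blast
qed

subsection \<open>Orthogonal maps preserve Lebesgue measure\<close>

lemma nn_integral_lborel_shift:
  fixes c :: "'a::euclidean_space"
  assumes "f \<in> borel_measurable borel"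
  shows "(\<integral>\<^sup>+x. f (x + c) \<partial>lborel) = (\<integral>\<^sup>+x. f x \<partial>lborel)"
proof -
  have "(\<integral>\<^sup>+x. f x \<partial>lborel) = (\<integral>\<^sup>+x. f x \<partial>distr lborel borel ((+) c))"
    by (simp only: lborel_distr_plus)
  also have "\<dots> = (\<integral>\<^sup>+x. f (c + x) \<partial>lborel)"
    using assms by (intro nn_integral_distr) auto
  finally show ?thesis by (simp add: add.commute)
qed

text \<open>Both sides, multiplied by the volume of the unit ball \<open>B\<close>, are evaluations of
  \<open>\<integral>\<integral> indicator A (T x + y) * indicator B y\<close> by Tonelli and translation invariance.\<close>

lemma lborel_distr_orthogonal:
  fixes T :: "'a::euclidean_space \<Rightarrow> 'a"
  assumes T: "orthogonal_transformation T"
  shows "distr lborel borel T = lborel"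
proof (rule measure_eqI)
  fix A assume "A \<in> sets (distr lborel borel T)"
  then have A [measurable]: "A \<in> sets borel" by simp
  have lin: "linear T" using T by (rule orthogonal_transformation_linear)
  have Tm [measurable]: "T \<in> borel_measurable borel"
    using lin by (intro borel_measurable_continuous_onI linear_continuous_on linear_conv_bounded_linear[THEN iffD1])
  define T' where "T' = inv_into UNIV T"
  have T': "T (T' y) = y" for y
    unfolding T'_def using orthogonal_transformation_surj[OF T] by (simp add: surj_f_inv_f)
  define B where "B = ball (0::'a) 1"
  have [measurable]: "B \<in> sets borel" by (simp add: B_def)
  let ?I = "\<lambda>x y. indicator A (T x + y) * indicator B y :: ennreal"
  have "emeasure (distr lborel borel T) A * emeasure lborel B =
      (\<integral>\<^sup>+x. indicator A (T x) \<partial>lborel) * (\<integral>\<^sup>+y. indicator B y \<partial>lborel)"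
  proof -
    have "emeasure (distr lborel borel T) A = (\<integral>\<^sup>+x. indicator A x \<partial>distr lborel borel T)" by simp
    also have "\<dots> = (\<integral>\<^sup>+x. indicator A (T x) \<partial>lborel)" by (rule nn_integral_distr) auto
    finally show ?thesis by simp
  qed
  also have "\<dots> = (\<integral>\<^sup>+y. (\<integral>\<^sup>+x. indicator A (T x) \<partial>lborel) * indicator B y \<partial>lborel)"
    by (subst nn_integral_cmult) (auto intro!: borel_measurable_indicator)
  also have "\<dots> = (\<integral>\<^sup>+y. \<integral>\<^sup>+x. ?I x y \<partial>lborel \<partial>lborel)"
  proof (rule nn_integral_cong)
    fix y
    have "(\<integral>\<^sup>+x. indicator A (T x + y) \<partial>lborel) = (\<integral>\<^sup>+x. indicator A (T (x + T' y)) \<partial>lborel)"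
      using lin by (simp add: linear_add T')
    also have "\<dots> = (\<integral>\<^sup>+x. indicator A (T x) \<partial>lborel)"
      by (rule nn_integral_lborel_shift[of "\<lambda>x. indicator A (T x)"]) measurable
    finally show "(\<integral>\<^sup>+x. indicator A (T x) \<partial>lborel) * indicator B y = (\<integral>\<^sup>+x. ?I x y \<partial>lborel)"
      by (subst nn_integral_multc) auto
  qed
  also have "\<dots> = (\<integral>\<^sup>+x. \<integral>\<^sup>+y. ?I x y \<partial>lborel \<partial>lborel)"
    by (rule lborel_pair.Fubini') measurable
  also have "\<dots> = (\<integral>\<^sup>+x. \<integral>\<^sup>+y. indicator A y * indicator B (y - T x) \<partial>lborel \<partial>lborel)"
  proof (rule nn_integral_cong)
    fix x
    show "(\<integral>\<^sup>+y. ?I x y \<partial>lborel) = (\<integral>\<^sup>+y. indicator A y * indicator B (y - T x) \<partial>lborel)"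
      using nn_integral_lborel_shift[of "\<lambda>y. indicator A y * indicator B (y - T x) :: ennreal" "T x"]
      by (simp add: add.commute)
  qed
  also have "\<dots> = (\<integral>\<^sup>+y. \<integral>\<^sup>+x. indicator A y * indicator B (y - T x) \<partial>lborel \<partial>lborel)"
    by (rule lborel_pair.Fubini'[symmetric]) measurable
  also have "\<dots> = (\<integral>\<^sup>+y. indicator A y * emeasure lborel B \<partial>lborel)"
  proof (rule nn_integral_cong)
    fix y
    have "norm (y - T x) = norm (T' y - x)" for x
    proof -
      have "y - T x = T (T' y - x)" using lin by (simp add: linear_diff T')
      then show ?thesis using orthogonal_transformation_norm[OF T] by simp
    qed
    then have "indicator B (y - T x) = (indicator B (x + - T' y) :: ennreal)" for x
      by (simp add: B_def indicator_def norm_minus_commute)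
    then have "(\<integral>\<^sup>+x. indicator B (y - T x) \<partial>lborel) = (\<integral>\<^sup>+x. indicator B (x + - T' y) \<partial>lborel)" by simp
    also have "\<dots> = emeasure lborel B"
      by (subst nn_integral_lborel_shift) auto
    finally show "(\<integral>\<^sup>+x. indicator A y * indicator B (y - T x) \<partial>lborel) = indicator A y * emeasure lborel B"
      by (subst nn_integral_cmult) auto
  qed
  also have "\<dots> = emeasure lborel A * emeasure lborel B"
    by (subst nn_integral_multc) auto
  finally have "emeasure (distr lborel borel T) A * emeasure lborel B = emeasure lborel A * emeasure lborel B" .
  moreover have "emeasure lborel B \<noteq> 0" "emeasure lborel B \<noteq> \<infinity>"
    using content_ball_pos[of 1 "0::'a"] emeasure_lborel_ball_finite[of "0::'a" 1] by (auto simp: B_def measure_def)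
  ultimately show "emeasure (distr lborel borel T) A = emeasure lborel A"
    by (simp add: mult.commute[of _ "emeasure lborel B"] ennreal_mult_cancel_left)
qed simp

text \<open>A Borel inverse makes the transfer rules unconditional: measurability passes in both
  directions, and a function that is not integrable has integral 0 on both sides.\<close>

locale lborel_iso =
  fixes T T' :: "'a::euclidean_space \<Rightarrow> 'a"
  assumes T_meas [measurable]: "T \<in> borel_measurable borel" and T'_meas [measurable]: "T' \<in> borel_measurable borel"
    and T_T': "T (T' x) = x" and T'_T: "T' (T x) = x"
    and distr: "distr lborel borel T = lborel"
begin

lemma measurable_comp_iff: "(\<lambda>x. f (T x)) \<in> borel_measurable borel \<longleftrightarrow> f \<in> borel_measurable borel"
proof
  assume "(\<lambda>x. f (T x)) \<in> borel_measurable borel"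
  then have "(\<lambda>x. f (T (T' x))) \<in> borel_measurable borel" by (rule measurable_compose[OF T'_meas])
  then show "f \<in> borel_measurable borel" by (simp add: T_T')
qed (rule measurable_compose[OF T_meas])

lemma integrable_comp_iff:
  fixes f :: "'a \<Rightarrow> 'b::{banach, second_countable_topology}"
  shows "integrable lborel (\<lambda>x. f (T x)) \<longleftrightarrow> integrable lborel f"
proof (cases "f \<in> borel_measurable borel")
  case True
  then show ?thesis using integrable_distr_eq[of T lborel borel f] by (simp add: distr)
next
  case False
  then show ?thesis using measurable_comp_iff[of f] by (auto dest: borel_measurable_integrable)
qed

lemma integral_comp:
  fixes f :: "'a \<Rightarrow> 'b::{banach, second_countable_topology}"
  shows "(LINT x|lborel. f (T x)) = (LINT x|lborel. f x)"
proof (cases "f \<in> borel_measurable borel")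
  case True
  then show ?thesis using integral_distr[of T lborel borel f] by (simp add: distr)
next
  case False
  then have "\<not> integrable lborel f" by (auto dest: borel_measurable_integrable)
  then show ?thesis using integrable_comp_iff[of f] by (simp add: not_integrable_integral_eq)
qed

lemma AE_comp:
  assumes "AE x in lborel. P x"
  shows "AE x in lborel. P (T x)"
proof (rule AE_distrD[of T lborel borel P])
  show "AE x in distr lborel borel T. P x" unfolding distr by (rule assms)
qed simp

end

lemma lborel_iso_shift: "lborel_iso (\<lambda>x::'a::euclidean_space. x - c) (\<lambda>x. x + c)"
proof
  have "(\<lambda>x. x - c) = (+) (- c)" by auto
  then show "distr lborel borel (\<lambda>x. x - c) = lborel" by (simp only: lborel_distr_plus)
qed auto

lemma lborel_iso_orthogonal:
  assumes T: "orthogonal_transformation T" and T': "\<And>x. T (T' x) = x" "\<And>x. T' (T x) = x"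
  shows "lborel_iso T T'"
proof
  have "T' = inv_into UNIV T" using T' by (metis (no_types) ext inj_on_def inv_f_f)
  then have o: "orthogonal_transformation T'" using orthogonal_transformation_inv[OF T] by simp
  have "S \<in> borel_measurable borel" if "orthogonal_transformation S" for S :: "'a \<Rightarrow> 'a"
    using orthogonal_transformation_linear[OF that]
    by (intro borel_measurable_continuous_onI linear_continuous_on linear_conv_bounded_linear[THEN iffD1])
  then show "T \<in> borel_measurable borel" "T' \<in> borel_measurable borel" using T o by auto
qed (use assms lborel_distr_orthogonal in auto)

lemma lborel_iso_comp: "lborel_iso S S' \<Longrightarrow> lborel_iso T T' \<Longrightarrow> lborel_iso (\<lambda>x. S (T x)) (\<lambda>x. T' (S' x))"
proof -
  assume "lborel_iso S S'" "lborel_iso T T'"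
  then interpret S: lborel_iso S S' + T: lborel_iso T T' by simp_all
  show ?thesis
  proof
    have "distr lborel borel (\<lambda>x. S (T x)) = distr (distr lborel borel T) borel S"
      by (subst distr_distr) (auto simp: o_def)
    then show "distr lborel borel (\<lambda>x. S (T x)) = lborel" by (simp add: S.distr T.distr)
  qed (auto simp: S.T_T' S.T'_T T.T_T' T.T'_T)
qed

subsection \<open>Algebra of values\<close>

lemma val_scale_nth [simp]: "(c *\<^sub>v x) $ a $ i = c * x $ a $ i"
  by (simp add: val_scale_def)

lemma val_eqI: "(\<And>a i. x $ a $ i = y $ a $ i) \<Longrightarrow> x = (y :: complex^'v^'m)"
  by (simp add: vec_eq_iff)

lemma val_scale_simps:
  "c *\<^sub>v (x + y) = c *\<^sub>v x + c *\<^sub>v y" "(c + d) *\<^sub>v x = c *\<^sub>v x + d *\<^sub>v x"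
  "c *\<^sub>v d *\<^sub>v x = (c * d) *\<^sub>v x" "1 *\<^sub>v x = x" "0 *\<^sub>v x = 0" "c *\<^sub>v 0 = 0"
  "c *\<^sub>v (x - y) = c *\<^sub>v x - c *\<^sub>v y" "c *\<^sub>v (- x) = - (c *\<^sub>v x)"
  by (rule val_eqI, simp add: algebra_simps)+

lemma scaleR_eq_val_scale: "r *\<^sub>R x = of_real r *\<^sub>v x"
  by (rule val_eqI) (simp only: vector_scaleR_component val_scale_nth scaleR_conv_of_real[where 'a=complex])

lemma norm_val_square: "(norm (x :: complex^'v^'m))\<^sup>2 = (\<Sum>a\<in>UNIV. \<Sum>i\<in>UNIV. (cmod (x $ a $ i))\<^sup>2)"
  by (simp add: norm_vec_def L2_set_def sum_nonneg)

lemma norm_val_scale: "norm (c *\<^sub>v x) = cmod c * norm x"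
proof -
  have "(norm (c *\<^sub>v x))\<^sup>2 = (cmod c * norm x)\<^sup>2"
    unfolding norm_val_square power_mult_distrib by (simp add: norm_mult power_mult_distrib sum_distrib_left)
  then show ?thesis by (simp add: power2_eq_iff_nonneg)
qed

lemma val_inner_alt: "val_inner x y = (\<Sum>a\<in>UNIV. \<Sum>i\<in>UNIV. cnj (x $ a $ i) * y $ a $ i)"
  by (simp add: val_inner_def herm_def)

lemma val_inner_self: "val_inner x x = of_real ((norm x)\<^sup>2)"
  by (simp only: val_inner_alt norm_val_square of_real_sum complex_norm_square mult.commute)

lemma val_inner_simps:
  "val_inner (x + x') y = val_inner x y + val_inner x' y"
  "val_inner x (y + y') = val_inner x y + val_inner x y'"
  "val_inner (c *\<^sub>v x) y = cnj c * val_inner x y" "val_inner x (c *\<^sub>v y) = c * val_inner x y"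
  "val_inner 0 y = 0" "val_inner x 0 = 0"
  "val_inner x (y - y') = val_inner x y - val_inner x y'"
  by (simp_all add: val_inner_alt algebra_simps sum.distrib sum_distrib_left sum_subtractf)

lemma cnj_val_inner: "cnj (val_inner x y) = val_inner y x"
  by (simp add: val_inner_alt mult.commute)

lemma norm_val_inner_le: "cmod (val_inner x y) \<le> norm x * norm y"
proof -
  have "cmod (val_inner x y) \<le> (\<Sum>a\<in>UNIV. \<Sum>i\<in>UNIV. cmod (x $ a $ i) * cmod (y $ a $ i))"
    unfolding val_inner_alt by (intro order_trans[OF norm_sum] sum_mono) (simp add: norm_mult)
  also have "\<dots> \<le> (\<Sum>a\<in>UNIV. norm (x $ a) * norm (y $ a))"
  proof (intro sum_mono)
    fix a
    show "(\<Sum>i\<in>UNIV. cmod (x $ a $ i) * cmod (y $ a $ i)) \<le> norm (x $ a) * norm (y $ a)"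
      using L2_set_mult_ineq[of "\<lambda>i. cmod (x $ a $ i)" "\<lambda>i. cmod (y $ a $ i)" UNIV] by (simp add: norm_vec_def)
  qed
  also have "\<dots> \<le> norm x * norm y"
    using L2_set_mult_ineq[of "\<lambda>a. norm (x $ a)" "\<lambda>a. norm (y $ a)" UNIV] by (simp add: norm_vec_def[of x] norm_vec_def[of y])
  finally show ?thesis .
qed

lemma bounded_bilinear_val_inner: "bounded_bilinear (val_inner :: complex^'v^'m \<Rightarrow> _)"
proof
  show "\<exists>K. \<forall>a (b :: complex^'v^'m). cmod (val_inner a b) \<le> norm a * norm b * K"
    by (intro exI[of _ 1]) (simp add: norm_val_inner_le)
qed (simp_all add: val_inner_simps scaleR_eq_val_scale scaleR_conv_of_real[where 'a=complex])

lemma bounded_bilinear_val_scale: "bounded_bilinear ((*\<^sub>v) :: complex \<Rightarrow> complex^'v^'m \<Rightarrow> _)"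
proof
  show "\<exists>K. \<forall>a b. norm (a *\<^sub>v (b :: complex^'v^'m)) \<le> norm a * norm b * K"
    by (intro exI[of _ 1]) (simp add: norm_val_scale)
qed (simp_all add: val_scale_simps scaleR_eq_val_scale scaleR_conv_of_real[where 'a=complex] mult.commute)

lemma borel_measurable_bilinear:
  fixes B :: "'a::euclidean_space \<Rightarrow> 'b::euclidean_space \<Rightarrow> 'c::real_normed_vector"
  assumes "bounded_bilinear B" "f \<in> borel_measurable M" "g \<in> borel_measurable M"
  shows "(\<lambda>x. B (f x) (g x)) \<in> borel_measurable M"
  using assms(2,3)
  by (rule borel_measurable_continuous_Pair)
     (intro continuous_intros bounded_bilinear.continuous_on[OF assms(1)])

lemma val_inner_measurable [measurable (raw)]:
  "f \<in> borel_measurable M \<Longrightarrow> g \<in> borel_measurable M \<Longrightarrow> (\<lambda>x. val_inner (f x) (g x)) \<in> borel_measurable M"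
  by (rule borel_measurable_bilinear[OF bounded_bilinear_val_inner])

lemma val_scale_measurable [measurable (raw)]:
  "f \<in> borel_measurable M \<Longrightarrow> g \<in> borel_measurable M \<Longrightarrow> (\<lambda>x. f x *\<^sub>v g x) \<in> borel_measurable M"
  by (rule borel_measurable_bilinear[OF bounded_bilinear_val_scale])

subsection \<open>Locally square-integrable functions\<close>

lemma l2locD:
  assumes "f \<in> l2loc"
  shows "f \<in> borel_measurable borel" "compact C \<Longrightarrow> set_integrable lborel C (\<lambda>r. (norm (f r))\<^sup>2)"
  using assms by (auto simp: l2loc_def)

lemma l2locI_bound:
  assumes "f \<in> borel_measurable borel" "\<And>r. (norm (f r))\<^sup>2 \<le> F r"
    "\<And>C. compact C \<Longrightarrow> set_integrable lborel C F"
  shows "f \<in> l2loc"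
proof -
  have "set_integrable lborel C (\<lambda>r. (norm (f r))\<^sup>2)" if C: "compact C" for C
  proof (rule set_integrable_bound[OF assms(3)[OF C]])
    have "C \<in> sets borel" using C by (simp add: borel_compact)
    then show "set_borel_measurable lborel C (\<lambda>r. (norm (f r))\<^sup>2)"
      unfolding set_borel_measurable_def using assms(1) by measurable
    show "AE x in lborel. x \<in> C \<longrightarrow> norm ((norm (f x))\<^sup>2) \<le> norm (F x)"
      using assms(2) by (intro AE_I2) (auto intro: order_trans[OF assms(2)])
  qed
  then show ?thesis using assms(1) by (simp add: l2loc_def)
qed

lemma l2loc_add:
  assumes "f \<in> l2loc" "g \<in> l2loc"
  shows "(\<lambda>r. f r + g r) \<in> l2loc"
proof (rule l2locI_bound[where F="\<lambda>r. 2 * (norm (f r))\<^sup>2 + 2 * (norm (g r))\<^sup>2"])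
  fix r
  have "(norm (f r + g r))\<^sup>2 \<le> (norm (f r) + norm (g r))\<^sup>2"
    by (intro power_mono norm_triangle_ineq) auto
  also have "\<dots> \<le> 2 * (norm (f r))\<^sup>2 + 2 * (norm (g r))\<^sup>2"
    using sum_squares_bound[of "norm (f r)" "norm (g r)"] by (simp add: power2_sum)
  finally show "(norm (f r + g r))\<^sup>2 \<le> 2 * (norm (f r))\<^sup>2 + 2 * (norm (g r))\<^sup>2" .
qed (use assms in \<open>auto intro!: set_integral_add borel_measurable_add dest: l2locD\<close>)

lemma l2loc_mult:
  assumes "f \<in> l2loc" "c \<in> borel_measurable borel" "\<And>r. cmod (c r) \<le> K"
  shows "(\<lambda>r. c r *\<^sub>v f r) \<in> l2loc"
proof (rule l2locI_bound[where F="\<lambda>r. K\<^sup>2 * (norm (f r))\<^sup>2"])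
  show "(\<lambda>r. c r *\<^sub>v f r) \<in> borel_measurable borel"
    using assms(2) l2locD(1)[OF assms(1)] by (rule val_scale_measurable)
  show "(norm (c r *\<^sub>v f r))\<^sup>2 \<le> K\<^sup>2 * (norm (f r))\<^sup>2" for r
    using assms(3)[of r] by (auto simp: norm_val_scale power_mult_distrib intro!: mult_right_mono power_mono)
qed (use assms in \<open>auto intro!: l2locD\<close>)

lemma l2loc_scale: "f \<in> l2loc \<Longrightarrow> (\<lambda>r. c *\<^sub>v f r) \<in> l2loc"
  by (rule l2loc_mult[of _ "\<lambda>_. c" "cmod c"]) auto

lemma l2loc_zero: "(\<lambda>r. 0) \<in> l2loc"
  by (simp add: l2loc_def set_integrable_def)

lemma l2loc_plus: "f \<in> l2loc \<Longrightarrow> g \<in> l2loc \<Longrightarrow> f + g \<in> l2loc"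
  using l2loc_add[of f g] by (simp add: plus_fun_def)

lemma cis_inner_measurable: "(\<lambda>r. cis (k \<bullet> r)) \<in> borel_measurable borel"
  by (intro borel_measurable_continuous_onI continuous_intros)

lemma l2loc_phase: "f \<in> l2loc \<Longrightarrow> phase k f \<in> l2loc"
  unfolding phase_def by (rule l2loc_mult[where K=1]) (auto simp: cis_inner_measurable)

lemma phase_phase: "phase k (phase q f) = phase (k + q) f"
  by (simp add: phase_def fun_eq_iff val_scale_simps inner_add_left cis_mult)

lemma phase_zero: "phase 0 f = f"
  by (simp add: phase_def val_scale_simps)

subsection \<open>Bloch functions\<close>

lemma blochD:
  assumes "f \<in> bloch L k"
  shows "f \<in> l2loc" "R \<in> L \<Longrightarrow> AE r in lborel. f (r + R) = cis (k \<bullet> R) *\<^sub>v f r"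
  using assms by (auto simp: bloch_def)

lemma blochI:
  assumes "f \<in> l2loc" "\<And>R. R \<in> L \<Longrightarrow> AE r in lborel. f (r + R) = cis (k \<bullet> R) *\<^sub>v f r"
  shows "f \<in> bloch L k"
  using assms by (auto simp: bloch_def)

lemma bloch_plus:
  assumes "f \<in> bloch L k" "g \<in> bloch L k"
  shows "f + g \<in> bloch L k"
proof (rule blochI)
  fix R assume R: "R \<in> L"
  from blochD(2)[OF assms(1) R] blochD(2)[OF assms(2) R]
  show "AE r in lborel. (f + g) (r + R) = cis (k \<bullet> R) *\<^sub>v (f + g) r"
    by eventually_elim (simp add: val_scale_simps)
qed (use assms in \<open>auto intro: l2loc_plus blochD\<close>)

lemma bloch_scale:
  assumes "f \<in> bloch L k"
  shows "(\<lambda>r. c *\<^sub>v f r) \<in> bloch L k"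
proof (rule blochI)
  fix R assume R: "R \<in> L"
  from blochD(2)[OF assms(1) R]
  show "AE r in lborel. c *\<^sub>v f (r + R) = cis (k \<bullet> R) *\<^sub>v c *\<^sub>v f r"
    by eventually_elim (simp add: val_scale_simps mult.commute)
qed (use assms in \<open>auto intro: l2loc_scale blochD\<close>)

lemma bloch_scaleR: "f \<in> bloch L k \<Longrightarrow> c *\<^sub>R f \<in> bloch L k"
  using bloch_scale[of f L k "of_real c"] by (simp add: scaleR_fun_def scaleR_eq_val_scale)

lemma bloch_zero: "0 \<in> bloch L k"
  by (rule blochI) (use l2loc_zero in \<open>auto simp: zero_fun_def val_scale_simps\<close>)

lemma bloch_phase:
  assumes "f \<in> bloch L k"
  shows "phase q f \<in> bloch L (q + k)"
proof (rule blochI)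
  fix R assume R: "R \<in> L"
  from blochD(2)[OF assms(1) R]
  show "AE r in lborel. phase q f (r + R) = cis ((q + k) \<bullet> R) *\<^sub>v phase q f r"
    by eventually_elim (simp add: phase_def val_scale_simps cis_mult inner_add_left inner_add_right add_ac)
qed (use assms in \<open>auto intro: l2loc_phase blochD\<close>)

lemma bloch_phase_strip: "f \<in> bloch L k \<Longrightarrow> phase (- k) f \<in> bloch L 0"
  using bloch_phase[of f L k "- k"] by simp

subsection \<open>The inner product over a unit cell\<close>

lemma cell_inner_scale_right: "cell_inner L f (\<lambda>r. c *\<^sub>v g r) = c * cell_inner L f g"
  unfolding cell_inner_def set_lebesgue_integral_def val_inner_simps
  by (subst integral_mult_right_zero[symmetric]) (simp add: mult.left_commute)

lemma cell_inner_scale_left: "cell_inner L (\<lambda>r. c *\<^sub>v f r) g = cnj c * cell_inner L f g"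
  unfolding cell_inner_def set_lebesgue_integral_def val_inner_simps
  by (subst integral_mult_right_zero[symmetric]) (simp add: mult.left_commute)

lemma cnj_cell_inner: "cnj (cell_inner L f g) = cell_inner L g f"
  unfolding cell_inner_def set_lebesgue_integral_def
  by (subst Bochner_Integration.integral_cnj[symmetric]) (simp add: cnj_val_inner)

lemma cell_inner_phase: "cell_inner L (phase k f) (phase k g) = cell_inner L f g"
  by (simp add: cell_inner_def phase_def val_inner_simps mult.assoc[symmetric] cis_cnj cis_mult)

lemma cell_norm_phase: "cell_norm L (phase k f) = cell_norm L f"
  by (simp add: cell_norm_def phase_def norm_val_scale)

lemma cell_norm_scale: "cell_norm L (\<lambda>r. c *\<^sub>v f r) = cmod c * cell_norm L f"
  by (simp add: cell_norm_def norm_val_scale power_mult_distrib real_sqrt_mult)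

lemma cell_norm_scaleR: "cell_norm L (c *\<^sub>R f) = \<bar>c\<bar> * cell_norm L f"
  using cell_norm_scale[of L "of_real c" f] by (simp add: scaleR_fun_def scaleR_eq_val_scale)

lemma cell_norm_nonneg: "0 \<le> cell_norm L f"
  unfolding cell_norm_def set_lebesgue_integral_def by (intro real_sqrt_ge_zero integral_nonneg_AE) auto

lemma product_bound_limit:
  fixes X a b :: real
  assumes "\<And>t. 0 < t \<Longrightarrow> 2 * X \<le> t * a\<^sup>2 + b\<^sup>2 / t" "0 \<le> a" "0 \<le> b"
  shows "X \<le> a * b"
proof -
  have "X \<le> (a + e) * (b + e)" if e: "0 < e" for e
  proof -
    have p: "0 < a + e" "0 < b + e" using assms e by auto
    have "2 * X \<le> ((b + e) / (a + e)) * a\<^sup>2 + b\<^sup>2 / ((b + e) / (a + e))"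
      using p by (intro assms(1)) auto
    also have "\<dots> \<le> ((b + e) / (a + e)) * (a + e)\<^sup>2 + (b + e)\<^sup>2 / ((b + e) / (a + e))"
      using p assms e by (intro add_mono mult_left_mono divide_right_mono power_mono) auto
    also have "\<dots> = 2 * ((a + e) * (b + e))"
    proof -
      have "(v / u) * u\<^sup>2 + v\<^sup>2 / (v / u) = 2 * (u * v)" if "0 < u" "0 < v" for u v :: real
        using that by (simp add: power2_eq_square)
      from this[OF p] show ?thesis .
    qed
    finally show ?thesis by simp
  qed
  then have "\<forall>\<^sub>F e in at_right 0. X \<le> (a + e) * (b + e)"
    by (auto simp: eventually_at_right_less eventually_at_filter)
  moreover have "((\<lambda>e. (a + e) * (b + e)) \<longlongrightarrow> (a + 0) * (b + 0)) (at_right 0)"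
    by (intro tendsto_intros)
  ultimately show ?thesis using tendsto_lowerbound by fastforce
qed

context lattice_basis
begin

lemma unit_cell_sets [measurable]: "unit_cell L \<in> sets borel"
  using unit_cell_compact by (simp add: borel_compact)

lemma cell_integrable_square: "f \<in> l2loc \<Longrightarrow> set_integrable lborel (unit_cell L) (\<lambda>r. (norm (f r))\<^sup>2)"
  using l2locD(2) unit_cell_compact by blast

lemma cell_integrable_product:
  assumes "f \<in> l2loc" "g \<in> l2loc"
  shows "set_integrable lborel (unit_cell L) (\<lambda>r. norm (f r) * norm (g r))"
proof (rule set_integrable_bound)
  show "set_integrable lborel (unit_cell L) (\<lambda>r. (norm (f r))\<^sup>2 + (norm (g r))\<^sup>2)"
    using assms by (intro set_integral_add cell_integrable_square)
  show "set_borel_measurable lborel (unit_cell L) (\<lambda>r. norm (f r) * norm (g r))"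
    unfolding set_borel_measurable_def using l2locD(1)[OF assms(1)] l2locD(1)[OF assms(2)] by measurable
  have "norm (f x) * norm (g x) \<le> (norm (f x))\<^sup>2 + (norm (g x))\<^sup>2" for x
  proof -
    have "0 \<le> norm (f x) * norm (g x)" by simp
    then show ?thesis using sum_squares_bound[of "norm (f x)" "norm (g x)"] by linarith
  qed
  then show "AE x in lborel. x \<in> unit_cell L \<longrightarrow>
      norm (norm (f x) * norm (g x)) \<le> norm ((norm (f x))\<^sup>2 + (norm (g x))\<^sup>2)"
    by (intro AE_I2) simp
qed

lemma cell_integrable_inner:
  assumes "f \<in> l2loc" "g \<in> l2loc"
  shows "set_integrable lborel (unit_cell L) (\<lambda>r. val_inner (f r) (g r))"
proof (rule set_integrable_bound[OF cell_integrable_product[OF assms]])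
  show "set_borel_measurable lborel (unit_cell L) (\<lambda>r. val_inner (f r) (g r))"
    unfolding set_borel_measurable_def using l2locD(1)[OF assms(1)] l2locD(1)[OF assms(2)] by measurable
qed (simp add: norm_val_inner_le)

lemma cell_norm_square: "(cell_norm L f)\<^sup>2 = (LINT r:unit_cell L|lborel. (norm (f r))\<^sup>2)"
  unfolding cell_norm_def set_lebesgue_integral_def
  by (intro real_sqrt_pow2 integral_nonneg_AE) auto

lemma cell_inner_self: "cell_inner L f f = of_real ((cell_norm L f)\<^sup>2)"
  unfolding cell_norm_square cell_inner_def val_inner_self by (rule set_integral_complex_of_real)

lemma cell_inner_add_right:
  "f \<in> l2loc \<Longrightarrow> g \<in> l2loc \<Longrightarrow> h \<in> l2loc \<Longrightarrow> cell_inner L f (g + h) = cell_inner L f g + cell_inner L f h"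
  unfolding cell_inner_def by (simp add: val_inner_simps set_integral_add cell_integrable_inner)

lemma cell_inner_add_left:
  "f \<in> l2loc \<Longrightarrow> g \<in> l2loc \<Longrightarrow> h \<in> l2loc \<Longrightarrow> cell_inner L (f + g) h = cell_inner L f h + cell_inner L g h"
  unfolding cell_inner_def by (simp add: val_inner_simps set_integral_add cell_integrable_inner)

text \<open>The weighted inequality between \<open>2 * x * y\<close> and
  \<open>t * x^2 + y^2 / t\<close> is integrated pointwise, and \<open>t\<close> is optimized
  afterwards.\<close>

lemma cell_Cauchy_Schwarz:
  assumes f: "f \<in> l2loc" and g: "g \<in> l2loc"
  shows "cmod (cell_inner L f g) \<le> cell_norm L f * cell_norm L g"
proof -
  let ?X = "LINT r:unit_cell L|lborel. norm (f r) * norm (g r)"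
  have "cmod (cell_inner L f g) \<le> (LINT r:unit_cell L|lborel. cmod (val_inner (f r) (g r)))"
    unfolding cell_inner_def by (rule set_integral_norm_bound[OF cell_integrable_inner[OF assms]])
  also have "\<dots> \<le> ?X"
    by (intro set_integral_mono set_integrable_norm cell_integrable_inner cell_integrable_product assms norm_val_inner_le)
  also have "?X \<le> cell_norm L f * cell_norm L g"
  proof (rule product_bound_limit)
    fix t :: real assume t: "0 < t"
    have "2 * ?X = (LINT r:unit_cell L|lborel. 2 * (norm (f r) * norm (g r)))" by simp
    also have "\<dots> \<le> (LINT r:unit_cell L|lborel. t * (norm (f r))\<^sup>2 + (norm (g r))\<^sup>2 / t)"
    proof (rule set_integral_mono)
      fix r
      have "0 \<le> (t * norm (f r) - norm (g r))\<^sup>2 / t" using t by simp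
      also have "\<dots> = t * (norm (f r))\<^sup>2 + (norm (g r))\<^sup>2 / t - 2 * (norm (f r) * norm (g r))"
        using t by (simp add: power2_eq_square field_simps)
      finally show "2 * (norm (f r) * norm (g r)) \<le> t * (norm (f r))\<^sup>2 + (norm (g r))\<^sup>2 / t" by simp
    qed (use assms in \<open>auto intro!: set_integral_add set_integrable_mult_right set_integrable_divide
          cell_integrable_square cell_integrable_product\<close>)
    also have "\<dots> = t * (cell_norm L f)\<^sup>2 + (cell_norm L g)\<^sup>2 / t"
      unfolding cell_norm_square using assms
      by (subst set_integral_add) (auto intro!: set_integrable_mult_right set_integrable_divide cell_integrable_square)
    finally show "2 * ?X \<le> t * (cell_norm L f)\<^sup>2 + (cell_norm L g)\<^sup>2 / t" .
  qed (simp_all add: cell_norm_nonneg)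
  finally show ?thesis .
qed

lemma cell_norm_triangle:
  assumes f: "f \<in> l2loc" and g: "g \<in> l2loc"
  shows "cell_norm L (f + g) \<le> cell_norm L f + cell_norm L g"
proof -
  have "of_real ((cell_norm L (f + g))\<^sup>2) = cell_inner L (f + g) (f + g)" by (simp add: cell_inner_self)
  also have "\<dots> = (cell_inner L f f + cell_inner L f g) + (cell_inner L g f + cell_inner L g g)"
    using assms by (simp add: cell_inner_add_left cell_inner_add_right l2loc_plus)
  finally have "(cell_norm L (f + g))\<^sup>2 = Re ((cell_inner L f f + cell_inner L f g) + (cell_inner L g f + cell_inner L g g))"
    by (metis Re_complex_of_real)
  also have "\<dots> = (cell_norm L f)\<^sup>2 + 2 * Re (cell_inner L f g) + (cell_norm L g)\<^sup>2"
    using cnj_cell_inner[of L f g, symmetric] by (simp add: cell_inner_self)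
  also have "\<dots> \<le> (cell_norm L f)\<^sup>2 + 2 * (cell_norm L f * cell_norm L g) + (cell_norm L g)\<^sup>2"
    using cell_Cauchy_Schwarz[OF assms] complex_Re_le_cmod[of "cell_inner L f g"] by simp
  also have "\<dots> = (cell_norm L f + cell_norm L g)\<^sup>2" by (simp add: power2_sum)
  finally show ?thesis by (rule power2_le_imp_le) (simp add: cell_norm_nonneg)
qed

lemma seminormed_bloch: "seminormed (bloch L k) (cell_norm L)"
  by standard (auto simp: bloch_zero bloch_plus bloch_scaleR cell_norm_nonneg cell_norm_scaleR
      intro: cell_norm_triangle blochD)

text \<open>The conjugation in the first slot is harmless, since only real scalars are
  compared.\<close>

lemma null_bilinear_cell_inner:
  "null_bilinear (bloch L k) (cell_norm L) (bloch L k) (cell_norm L) UNIV norm (cell_inner L) 1"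
proof -
  interpret seminormed "bloch L k" "cell_norm L" by (rule seminormed_bloch)
  show ?thesis
  proof
    fix f g :: "real^'d \<Rightarrow> complex^'v::finite^'m::finite" and t :: real
    assume "f \<in> bloch L k" "g \<in> bloch L k"
    then show "cmod (cell_inner L f g) \<le> 1 * cell_norm L f * cell_norm L g"
      using cell_Cauchy_Schwarz by (auto dest: blochD)
    show "cell_inner L (t *\<^sub>R f) g = t *\<^sub>R cell_inner L f g"
      using cell_inner_scale_left[of L "of_real t" f g] by (simp add: scaleR_fun_def scaleR_eq_val_scale scaleR_conv_of_real)
    show "cmod (cell_inner L f (t *\<^sub>R g) - t *\<^sub>R cell_inner L f g) = 0"
      using cell_inner_scale_right[of L f "of_real t" g] by (simp add: scaleR_fun_def scaleR_eq_val_scale scaleR_conv_of_real)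
  qed (auto simp: cell_inner_add_left cell_inner_add_right blochD(1)[of _ L k])
qed

lemma null_bilinear_val_scale:
  "null_bilinear UNIV norm (bloch L k) (cell_norm L) (bloch L k) (cell_norm L)
     (\<lambda>c (f :: ('d, 'v::finite, 'm::finite) wavefun) r. c *\<^sub>v f r) 1"
proof -
  interpret seminormed "bloch L k" "cell_norm L" by (rule seminormed_bloch)
  show ?thesis
    by standard (auto simp: bloch_scale cell_norm_scale fun_eq_iff val_scale_simps scaleR_fun_def
        scaleR_eq_val_scale scaleR_conv_of_real nrm_zero nrm_zero[unfolded zero_fun_def] fun_diff_def mult.commute)
qed

lemma cell_inner_cong_AE:
  assumes "AE r in lborel. f r = f' r" "AE r in lborel. g r = g' r"
    "f \<in> borel_measurable borel" "f' \<in> borel_measurable borel" "g \<in> borel_measurable borel" "g' \<in> borel_measurable borel"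
  shows "cell_inner L f g = cell_inner L f' g'"
  unfolding cell_inner_def set_lebesgue_integral_def
proof (rule integral_cong_AE)
  show "AE r in lborel. indicator (unit_cell L) r *\<^sub>R val_inner (f r) (g r) =
      indicator (unit_cell L) r *\<^sub>R val_inner (f' r) (g' r)"
    using assms(1,2) by eventually_elim simp
qed (use assms(3-) in measurable)

lemma cell_norm_cong_AE:
  assumes "AE r in lborel. f r = g r" "f \<in> borel_measurable borel" "g \<in> borel_measurable borel"
  shows "cell_norm L f = cell_norm L g"
proof -
  have "complex_of_real ((cell_norm L f)\<^sup>2) = of_real ((cell_norm L g)\<^sup>2)"
    using cell_inner_cong_AE[OF assms(1,1) assms(2,3,2,3)] by (simp add: cell_inner_self)
  then show ?thesis by (simp only: of_real_eq_iff) (simp add: cell_norm_nonneg)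
qed

end

subsection \<open>The action of the space group on wavefunctions\<close>

text \<open>The scalar \<open>c\<close> passes through an operator of sign \<open>s\<close> as \<open>cj s c\<close>.\<close>

definition cj :: "real \<Rightarrow> complex \<Rightarrow> complex" where
  "cj s c = (if s = 1 then c else cnj c)"

lemma cj_mult: "cj s (a * b) = cj s a * cj s b" and cj_one: "cj s 1 = 1"
  and cj_sum: "cj s (sum f I) = (\<Sum>i\<in>I. cj s (f i))" and cj_of_real: "cj s (of_real r) = of_real r"
  by (simp_all add: cj_def)

lemma cj_cis: "s = 1 \<or> s = -1 \<Longrightarrow> cj s (cis x) = cis (s * x)"
  by (auto simp: cj_def cis_cnj)

lemma integral_cj: "integral\<^sup>L M (\<lambda>x. cj s (f x)) = cj s (integral\<^sup>L M f)"
  by (simp add: cj_def)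

lemma cj_scaleR: "cj s (r *\<^sub>R c) = r *\<^sub>R cj s c"
  by (simp add: cj_def)

context magnetic_space_group
begin

lemma s_one: "s \<one> = 1"
  using s_hom[of \<one> \<one>] s_sign[of \<one>] by auto

lemma s_inv: "p \<in> carrier P \<Longrightarrow> s (inv p) = s p"
  using s_hom[of "inv p" p] s_sign[of p] s_sign[of "inv p"] s_one by auto

lemma s_square: "p \<in> carrier P \<Longrightarrow> s p * s p = 1"
  using s_sign[of p] by auto

lemma pc_inv_left: "p \<in> carrier P \<Longrightarrow> pc (inv p) (pc p x) = x"
  using pc_hom[of "inv p" p] pc_one by (simp add: fun_eq_iff)

lemma pc_inv_right: "p \<in> carrier P \<Longrightarrow> pc p (pc (inv p) x) = x"
  using pc_hom[of p "inv p"] pc_one by (simp add: fun_eq_iff)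

lemma pc_linear: "p \<in> carrier P \<Longrightarrow> linear (pc p)"
  using pc_orthogonal orthogonal_transformation_linear by blast

lemma pc_inner: "p \<in> carrier P \<Longrightarrow> pc p x \<bullet> y = x \<bullet> pc (inv p) y"
proof -
  assume p: "p \<in> carrier P"
  have "pc p x \<bullet> pc p (pc (inv p) y) = x \<bullet> pc (inv p) y"
    using pc_orthogonal[OF p] by (simp add: orthogonal_transformation_def)
  then show ?thesis using p by (simp add: pc_inv_right)
qed

lemma pc_mem: "p \<in> carrier P \<Longrightarrow> R \<in> BL \<Longrightarrow> pc p R \<in> BL"
  using pc_lattice by blast

lemma space_carrier: "g \<in> carrier (space_group P BL pc) \<longleftrightarrow> fst g \<in> carrier P \<and> snd g \<in> BL"
  by (cases g) (auto simp: space_group_def)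

lemma inv_space_group:
  assumes "p \<in> carrier P" "R \<in> BL"
  shows "inv\<^bsub>space_group P BL pc\<^esub> (p, R) = (inv p, - pc (inv p) R)"
proof (rule group.inv_equality[OF group_space_group])
  show "(inv p, - pc (inv p) R) \<otimes>\<^bsub>space_group P BL pc\<^esub> (p, R) = \<one>\<^bsub>space_group P BL pc\<^esub>"
    using assms by (simp add: space_group_def)
qed (use assms pc_mem[of "inv p" R] lattice_uminus in \<open>auto simp: space_group_def\<close>)

definition Dv :: "'p \<Rightarrow> complex^'v^'m \<Rightarrow> complex^'v^'m" where
  "Dv p x = (\<chi> a. D p (x $ a))"

lemma D_add: "p \<in> carrier P \<Longrightarrow> D p (u + v) = D p u + D p v"
  and D_scale: "p \<in> carrier P \<Longrightarrow> D p (c *s u) = cj (s p) c *s D p u"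
  and D_herm: "p \<in> carrier P \<Longrightarrow> herm (D p u) (D p v) = cj (s p) (herm u v)"
  and D_bij: "p \<in> carrier P \<Longrightarrow> bij (D p)"
  using s_sign[of p] D_unitary[of p] D_antiunitary[of p]
  by (auto simp: unitary_op_def antiunitary_op_def cj_def)

lemma D_one: "D \<one> v = v"
proof -
  have "D \<one> (D \<one> v) = D \<one> v" using D_hom[of \<one> \<one>] by (simp add: fun_eq_iff)
  then show ?thesis using D_bij[of \<one>] by (simp add: bij_def inj_eq)
qed

lemma Dv_one: "Dv \<one> x = x"
  by (simp add: Dv_def D_one vec_eq_iff)

lemma Dv_mult: "q \<in> carrier P \<Longrightarrow> p \<in> carrier P \<Longrightarrow> Dv q (Dv p x) = Dv (q \<otimes> p) x"
  using D_hom[of q p] by (simp add: Dv_def vec_eq_iff fun_eq_iff)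

lemma Dv_add: "p \<in> carrier P \<Longrightarrow> Dv p (x + y) = Dv p x + Dv p y"
  by (simp add: Dv_def vec_eq_iff D_add)

lemma Dv_scale: "p \<in> carrier P \<Longrightarrow> Dv p (c *\<^sub>v x) = cj (s p) c *\<^sub>v Dv p x"
  by (simp add: Dv_def val_scale_def D_scale vec_eq_iff)

lemma Dv_inner: "p \<in> carrier P \<Longrightarrow> val_inner (Dv p x) (Dv p y) = cj (s p) (val_inner x y)"
  by (simp add: Dv_def val_inner_def D_herm cj_sum)

lemma norm_Dv:
  assumes "p \<in> carrier P"
  shows "norm (Dv p x) = norm x"
proof -
  have "complex_of_real ((norm (Dv p x))\<^sup>2) = of_real ((norm x)\<^sup>2)"
    using Dv_inner[OF assms, of x x] unfolding val_inner_self cj_of_real .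
  then show ?thesis by (simp only: of_real_eq_iff) (simp add: power2_eq_iff_nonneg)
qed

lemma Dv_linear: "p \<in> carrier P \<Longrightarrow> linear (Dv p)"
  by (rule linearI) (simp_all add: Dv_add scaleR_eq_val_scale Dv_scale cj_of_real)

lemma Dv_measurable: "p \<in> carrier P \<Longrightarrow> Dv p \<in> borel_measurable borel"
  using Dv_linear
  by (intro borel_measurable_continuous_onI linear_continuous_on linear_conv_bounded_linear[THEN iffD1])

lemma ghat_apply:
  assumes "p \<in> carrier P" "R \<in> BL"
  shows "ghat P BL pc D (p, R) f = (\<lambda>r. Dv p (f (pc (inv p) (r - R))))"
  using assms by (simp add: ghat_def inv_space_group act_def Dv_def linear_diff[OF pc_linear] fun_eq_iff)

lemma ghat_mult:
  assumes "q \<in> carrier P" "R' \<in> BL" "p \<in> carrier P" "R \<in> BL"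
  shows "ghat P BL pc D (q, R') (ghat P BL pc D (p, R) f) = ghat P BL pc D (q \<otimes> p, pc q R + R') f"
proof -
  have "pc (inv p) (pc (inv q) (r - R') - R) = pc (inv (q \<otimes> p)) (r - (pc q R + R'))" for r
  proof -
    have "pc (inv q) (r - R') - R = pc (inv q) (r - (pc q R + R'))"
    proof -
      have "R = pc (inv q) (pc q R)" using assms pc_inv_left by simp
      then have "pc (inv q) (r - R') - R = pc (inv q) (r - R' - pc q R)"
        using assms linear_diff[OF pc_linear[of "inv q"]] by simp
      then show ?thesis by (simp add: algebra_simps)
    qed
    moreover have "pc (inv (q \<otimes> p)) = pc (inv p) \<circ> pc (inv q)"
      using assms by (simp add: inv_mult_group pc_hom)
    ultimately show ?thesis by simp
  qed
  then show ?thesis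
    using assms pc_mem lattice_add by (simp add: ghat_apply Dv_mult fun_eq_iff)
qed

lemma ghat_inverse:
  assumes "p \<in> carrier P" "R \<in> BL"
  shows "ghat P BL pc D (p, R) (ghat P BL pc D (inv p, - pc (inv p) R) f) = f"
    "ghat P BL pc D (inv p, - pc (inv p) R) (ghat P BL pc D (p, R) f) = f"
proof -
  have m: "inv p \<in> carrier P" "- pc (inv p) R \<in> BL" using assms pc_mem lattice_uminus by auto
  have one: "ghat P BL pc D (\<one>, 0) f = f"
    using lattice_zero by (simp add: ghat_apply Dv_one pc_one)
  have "pc p (- pc (inv p) R) + R = 0" "pc (inv p) R + - pc (inv p) R = 0"
    using assms linear_neg[OF pc_linear[of p]] pc_inv_right by simp_all
  then show "ghat P BL pc D (p, R) (ghat P BL pc D (inv p, - pc (inv p) R) f) = f"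
    "ghat P BL pc D (inv p, - pc (inv p) R) (ghat P BL pc D (p, R) f) = f"
    using assms m one by (simp_all add: ghat_mult)
qed

lemma ghat_iso:
  assumes "p \<in> carrier P"
  shows "lborel_iso (\<lambda>r. pc (inv p) (r - R)) (\<lambda>r. pc p r + R)"
  using lborel_iso_comp[OF lborel_iso_orthogonal[of "pc (inv p)" "pc p"] lborel_iso_shift[of R]]
    assms pc_orthogonal pc_inv_left pc_inv_right by simp

lemma ghat_AE:
  assumes "p \<in> carrier P" "R \<in> BL" "AE r in lborel. f r = h r"
  shows "AE r in lborel. ghat P BL pc D (p, R) f r = ghat P BL pc D (p, R) h r"
proof -
  interpret lborel_iso "\<lambda>r. pc (inv p) (r - R)" "\<lambda>r. pc p r + R" using assms(1) by (rule ghat_iso)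
  show ?thesis
    using AE_comp[OF assms(3)] by eventually_elim (simp add: ghat_apply assms)
qed

lemma ghat_scale:
  assumes "p \<in> carrier P" "R \<in> BL"
  shows "ghat P BL pc D (p, R) (\<lambda>r. c *\<^sub>v f r) = (\<lambda>r. cj (s p) c *\<^sub>v ghat P BL pc D (p, R) f r)"
  using assms by (simp add: ghat_apply Dv_scale)

lemma ghat_l2loc:
  assumes pR: "p \<in> carrier P" "R \<in> BL" and f: "f \<in> l2loc"
  shows "ghat P BL pc D (p, R) f \<in> l2loc"
proof -
  let ?T = "\<lambda>r. pc (inv p) (r - R)"
  interpret lborel_iso ?T "\<lambda>r. pc p r + R" using pR(1) by (rule ghat_iso)
  have m: "ghat P BL pc D (p, R) f \<in> borel_measurable borel"
    unfolding ghat_apply[OF pR]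
    by (intro measurable_compose[OF _ Dv_measurable[OF pR(1)]] measurable_compose[OF T_meas] l2locD f)
  have "set_integrable lborel C (\<lambda>r. (norm (ghat P BL pc D (p, R) f r))\<^sup>2)" if C: "compact C" for C
  proof -
    have "continuous_on UNIV (pc (inv p))"
      using pR by (intro linear_continuous_on linear_conv_bounded_linear[THEN iffD1] pc_linear) simp
    then have "continuous_on C ?T"
      by (rule continuous_on_compose2) (auto intro: continuous_intros)
    then have "compact (?T ` C)" using C by (rule compact_continuous_image)
    then have "integrable lborel (\<lambda>y. indicator (?T ` C) y *\<^sub>R (norm (f y))\<^sup>2)"
      using l2locD(2)[OF f] by (simp add: set_integrable_def)
    then have "integrable lborel (\<lambda>r. indicator (?T ` C) (?T r) *\<^sub>R (norm (f (?T r)))\<^sup>2)"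
      by (subst integrable_comp_iff)
    moreover have "indicator (?T ` C) (?T r) = (indicator C r :: real)" for r
    proof -
      have "inj ?T" using T'_T by (rule inj_on_inverseI)
      then have "?T r \<in> ?T ` C \<longleftrightarrow> r \<in> C" by (rule inj_image_mem_iff)
      then show ?thesis unfolding indicator_def by (simp only:)
    qed
    ultimately show ?thesis
      by (simp add: set_integrable_def ghat_apply[OF pR] norm_Dv pR)
  qed
  with m show ?thesis by (simp add: l2loc_def)
qed

text \<open>An antiunitary operation conjugates the Bloch phase; this is the source of the factor
  \<open>s p\<close> in the action on wavevectors.\<close>

lemma ghat_bloch:
  assumes p: "p \<in> carrier P" and f: "f \<in> bloch BL k"
  shows "ghat P BL pc D (p, 0) f \<in> bloch BL (s p *\<^sub>R pc p k)"
proof (rule blochI)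
  show "ghat P BL pc D (p, 0) f \<in> l2loc" using p f lattice_zero by (intro ghat_l2loc blochD)
  fix R assume R: "R \<in> BL"
  interpret lborel_iso "\<lambda>r. pc (inv p) (r - 0)" "\<lambda>r. pc p r + 0" using p by (rule ghat_iso)
  have "AE r in lborel. f (pc (inv p) r + pc (inv p) R) = cis (k \<bullet> pc (inv p) R) *\<^sub>v f (pc (inv p) r)"
    using AE_comp[OF blochD(2)[OF f pc_mem[of "inv p" R]]] p R by simp
  then show "AE r in lborel. ghat P BL pc D (p, 0) f (r + R) =
      cis ((s p *\<^sub>R pc p k) \<bullet> R) *\<^sub>v ghat P BL pc D (p, 0) f r"
  proof eventually_elim
    case (elim r)
    have "cj (s p) (cis (k \<bullet> pc (inv p) R)) = cis ((s p *\<^sub>R pc p k) \<bullet> R)"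
      using p s_sign by (simp add: cj_cis pc_inner)
    then show ?case
      using elim p lattice_zero by (simp add: ghat_apply linear_add[OF pc_linear] Dv_scale)
  qed
qed

lemma ghat_bloch_zero: "p \<in> carrier P \<Longrightarrow> f \<in> bloch BL 0 \<Longrightarrow> ghat P BL pc D (p, 0) f \<in> bloch BL 0"
  using ghat_bloch[of p f 0] linear_0[OF pc_linear] by simp

lemma ghat_phase:
  assumes p: "p \<in> carrier P"
  shows "ghat P BL pc D (p, 0) (phase k f) = phase (s p *\<^sub>R pc p k) (ghat P BL pc D (p, 0) f)"
proof
  fix r
  have "cj (s p) (cis (k \<bullet> pc (inv p) r)) = cis ((s p *\<^sub>R pc p k) \<bullet> r)"
    using p s_sign by (simp add: cj_cis pc_inner)
  then show "ghat P BL pc D (p, 0) (phase k f) r = phase (s p *\<^sub>R pc p k) (ghat P BL pc D (p, 0) f) r"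
    using p lattice_zero by (simp add: ghat_apply phase_def Dv_scale)
qed

text \<open>\<open>(p|R)\<close> is \<open>(p|0)\<close> followed by the translation by
  \<open>R\<close>, which acts on a Bloch function as a phase. The action on a band is thus
  determined by the point operations.\<close>

lemma ghat_translate:
  assumes "p \<in> carrier P" "R \<in> BL" "f \<in> bloch BL k"
  shows "AE r in lborel. ghat P BL pc D (p, R) f r =
    cis (- (s p * (pc p k \<bullet> R))) *\<^sub>v ghat P BL pc D (p, 0) f r"
proof -
  have "AE r in lborel. ghat P BL pc D (p, 0) f (r + - R) =
      cis ((s p *\<^sub>R pc p k) \<bullet> (- R)) *\<^sub>v ghat P BL pc D (p, 0) f r"
    using assms lattice_uminus by (intro blochD(2)[OF ghat_bloch]) auto
  then show ?thesis
    using assms lattice_zero by (simp add: ghat_apply)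
qed

lemma ghat_cell_inner:
  assumes p: "p \<in> carrier P"
  shows "cell_inner BL (ghat P BL pc D (p, 0) f) (ghat P BL pc D (p, 0) h) = cj (s p) (cell_inner BL f h)"
proof -
  interpret lborel_iso "\<lambda>r. pc (inv p) (r - 0)" "\<lambda>r. pc p r + 0" using p by (rule ghat_iso)
  have ind: "indicator (unit_cell BL) r = (indicator (unit_cell BL) (pc (inv p) r) :: real)" for r
  proof -
    have "pc (inv p) ` unit_cell BL = unit_cell BL" "pc p ` unit_cell BL = unit_cell BL"
      using p pc_orthogonal pc_lattice by (auto intro!: orthogonal_unit_cell)
    then have "r \<in> unit_cell BL \<longleftrightarrow> pc (inv p) r \<in> unit_cell BL"
      using p pc_inv_right[of p r] imageI[of r "unit_cell BL" "pc (inv p)"]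
        imageI[of "pc (inv p) r" "unit_cell BL" "pc p"] by auto
    then show ?thesis by (simp add: indicator_def)
  qed
  have "indicator (unit_cell BL) r *\<^sub>R val_inner (ghat P BL pc D (p, 0) f r) (ghat P BL pc D (p, 0) h r) =
      cj (s p) (indicator (unit_cell BL) (pc (inv p) r) *\<^sub>R val_inner (f (pc (inv p) r)) (h (pc (inv p) r)))" for r
    unfolding ind[of r] using p lattice_zero by (simp add: ghat_apply Dv_inner cj_scaleR)
  then have "cell_inner BL (ghat P BL pc D (p, 0) f) (ghat P BL pc D (p, 0) h) =
    (LINT r|lborel. cj (s p) (indicator (unit_cell BL) (pc (inv p) r) *\<^sub>R val_inner (f (pc (inv p) r)) (h (pc (inv p) r))))"
    unfolding cell_inner_def set_lebesgue_integral_def by (simp only:)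
  also have "\<dots> = (LINT r|lborel. cj (s p) (indicator (unit_cell BL) r *\<^sub>R val_inner (f r) (h r)))"
    using integral_comp[of "\<lambda>r. cj (s p) (indicator (unit_cell BL) r *\<^sub>R val_inner (f r) (h r))"] by simp
  finally show ?thesis
    by (simp add: integral_cj cell_inner_def set_lebesgue_integral_def)
qed

text \<open>With the inverse image of a test function in place of \<open>h\<close>, this moves a
  group element from a Wannier function to the test function.\<close>

lemma ghat_pairing:
  assumes pR: "p \<in> carrier P" "R \<in> BL"
  shows "(LINT r|lborel. val_inner (ghat P BL pc D (p, R) h r) (ghat P BL pc D (p, R) f r)) =
    cj (s p) (LINT r|lborel. val_inner (h r) (f r))"
proof -
  interpret lborel_iso "\<lambda>r. pc (inv p) (r - R)" "\<lambda>r. pc p r + R" using pR(1) by (rule ghat_iso)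
  have "(LINT r|lborel. val_inner (ghat P BL pc D (p, R) h r) (ghat P BL pc D (p, R) f r)) =
     (LINT r|lborel. cj (s p) (val_inner (h (pc (inv p) (r - R))) (f (pc (inv p) (r - R)))))"
    using pR by (simp add: ghat_apply Dv_inner)
  also have "\<dots> = (LINT r|lborel. cj (s p) (val_inner (h r) (f r)))"
    by (rule integral_comp[of "\<lambda>r. cj (s p) (val_inner (h r) (f r))"])
  finally show ?thesis by (simp add: integral_cj)
qed

end

section \<open>Phases and one-dimensional spans\<close>

lemma cis_eq_1_iff: "cis x = 1 \<longleftrightarrow> (\<exists>n::int. x = 2 * pi * of_int n)"
proof
  assume "cis x = 1"
  then have "cos x = 1" by (simp add: complex_eq_iff)
  then show "\<exists>n::int. x = 2 * pi * of_int n" by (auto simp: cos_one_2pi_int)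
next
  assume "\<exists>n::int. x = 2 * pi * of_int n"
  then show "cis x = 1" by (auto simp: cis_multiple_2pi)
qed

lemma lspan_singleton:
  fixes i :: 'j
  shows "lspan {i} e = {f \<in> l2loc. \<exists>c. AE r in lborel. f r = c *\<^sub>v e i r}"
proof -
  have "(\<exists>c :: 'j \<Rightarrow> complex. AE r in lborel. f r = c i *\<^sub>v e i r) \<longleftrightarrow> (\<exists>c. AE r in lborel. f r = c *\<^sub>v e i r)" for f
  proof
    assume "\<exists>c. AE r in lborel. f r = c *\<^sub>v e i r"
    then obtain c where "AE r in lborel. f r = c *\<^sub>v e i r" ..
    then show "\<exists>c :: 'j \<Rightarrow> complex. AE r in lborel. f r = c i *\<^sub>v e i r"
      by (intro exI[of _ "\<lambda>_. c"])
  qed blast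
  then show ?thesis by (simp add: lspan_def)
qed

lemma lessThan_1: "{..<1::nat} = {0}"
  by auto

lemma canalytic_exp_i:
  assumes "canalytic (\<lambda>k. of_real (f k)) k0"
  shows "canalytic (\<lambda>k. cis (f k)) k0"
proof -
  have "canalytic (\<lambda>k. exp (\<i> * of_real (f k))) k0"
    by (rule canalytic_holomorphic_comp[where F="\<lambda>z. exp (\<i> * z)" and r=1, OF _ _ assms])
       (auto intro!: holomorphic_intros)
  then show ?thesis by (simp add: cis_conv_exp)
qed

section \<open>The action of the point group on wavevectors\<close>

context magnetic_space_group
begin

lemma orthogonal_twisted: "p \<in> carrier P \<Longrightarrow> orthogonal_transformation (\<lambda>k. s p *\<^sub>R pc p k)"
  using pc_orthogonal[of p] s_square[of p] linear_compose_scale_right[OF pc_linear[of p], of "s p"]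
  by (auto simp: orthogonal_transformation_def mult.assoc[symmetric])

lemma twisted_inverse: 
  "p \<in> carrier P \<Longrightarrow> s p *\<^sub>R pc p (s p *\<^sub>R pc (inv p) k) = k"
  "p \<in> carrier P \<Longrightarrow> s p *\<^sub>R pc (inv p) (s p *\<^sub>R pc p k) = k"
  using s_square[of p] linear_scale[OF pc_linear[of p]] linear_scale[OF pc_linear[of "inv p"]]
  by (simp_all add: pc_inv_left pc_inv_right)

lemma twisted_mult:
  "q \<in> carrier P \<Longrightarrow> p \<in> carrier P \<Longrightarrow>
    s q *\<^sub>R pc q (s p *\<^sub>R pc p k) = s (q \<otimes> p) *\<^sub>R pc (q \<otimes> p) k"
  using linear_scale[OF pc_linear[of q]] by (simp add: s_hom pc_hom)

lemma twisted_reciprocal: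
  assumes "p \<in> carrier P" "K \<in> reciprocal_lattice BL"
  shows "s p *\<^sub>R pc p K \<in> reciprocal_lattice BL"
  unfolding reciprocal_lattice_def
proof (intro CollectI ballI)
  fix R assume "R \<in> BL"
  then have "pc (inv p) R \<in> BL" using assms pc_mem by simp
  then obtain n :: int where n: "K \<bullet> pc (inv p) R = 2 * pi * of_int n"
    using assms(2) unfolding reciprocal_lattice_def by blast
  have "(s p *\<^sub>R pc p K) \<bullet> R = s p * (K \<bullet> pc (inv p) R)" using assms by (simp add: pc_inner)
  then show "\<exists>n::int. (s p *\<^sub>R pc p K) \<bullet> R = 2 * pi * of_int n"
    using s_sign[OF assms(1)] n by (auto intro: exI[of _ n] exI[of _ "- n"])
qed

lemma twisted_reciprocal_image:
  assumes "p \<in> carrier P"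
  shows "(\<lambda>k. s p *\<^sub>R pc p k) ` reciprocal_lattice BL = reciprocal_lattice BL"
proof (rule subset_antisym)
  show "reciprocal_lattice BL \<subseteq> (\<lambda>k. s p *\<^sub>R pc p k) ` reciprocal_lattice BL"
  proof
    fix K assume "K \<in> reciprocal_lattice BL"
    then have "s p *\<^sub>R pc (inv p) K \<in> reciprocal_lattice BL"
      using twisted_reciprocal[of "inv p" K] assms by (simp add: s_inv)
    moreover have "K = s p *\<^sub>R pc p (s p *\<^sub>R pc (inv p) K)" using assms by (simp add: twisted_inverse)
    ultimately show "K \<in> (\<lambda>k. s p *\<^sub>R pc p k) ` reciprocal_lattice BL" by (rule rev_image_eqI)
  qed
qed (use assms twisted_reciprocal in blast)

text \<open>The twisted map is orthogonal and permutes the reciprocal lattice, so it preserves both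
  Lebesgue measure and the Wigner-Seitz cell that serves as zone.\<close>

lemma zone_integral_twisted:
  assumes "p \<in> carrier P"
  shows "(LINT k:unit_cell (reciprocal_lattice BL)|lborel. (H :: _ \<Rightarrow> complex) (s p *\<^sub>R pc p k)) =
    (LINT k:unit_cell (reciprocal_lattice BL)|lborel. H k)"
proof -
  let ?T = "\<lambda>k. s p *\<^sub>R pc p k" and ?C = "unit_cell (reciprocal_lattice BL)"
  interpret lborel_iso ?T "\<lambda>k. s p *\<^sub>R pc (inv p) k"
    using assms by (intro lborel_iso_orthogonal orthogonal_twisted) (auto simp: twisted_inverse)
  have TC: "?T ` ?C = ?C"
    by (intro orthogonal_unit_cell orthogonal_twisted twisted_reciprocal_image assms)
  have "inj ?T" using T'_T by (rule inj_on_inverseI)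
  then have "?T k \<in> ?T ` ?C \<longleftrightarrow> k \<in> ?C" for k by (rule inj_image_mem_iff)
  then have ind: "indicator ?C k = (indicator ?C (?T k) :: real)" for k
    unfolding TC indicator_def by (simp only:)
  have "(LINT k|lborel. indicator ?C k *\<^sub>R H (?T k)) = (LINT k|lborel. indicator ?C (?T k) *\<^sub>R H (?T k))"
    by (simp only: ind[symmetric])
  also have "\<dots> = (LINT k|lborel. indicator ?C k *\<^sub>R H k)"
    by (rule integral_comp[of "\<lambda>k. indicator ?C k *\<^sub>R H k"])
  finally show ?thesis by (simp add: set_lebesgue_integral_def)
qed

end

section \<open>Phases of the point operations on a simple band\<close>

locale localized_simple_band = magnetic_space_group P BL pc s D
  for P :: "('p, 'b) monoid_scheme" (structure) and BL :: "(real^'d) set" and pc s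
    and D :: "'p \<Rightarrow> complex^'v \<Rightarrow> complex^'v" +
  fixes E :: "real^'d \<Rightarrow> ('d, 'v, 'm::finite) wavefun set" and \<psi> :: "real^'d \<Rightarrow> ('d, 'v, 'm) wavefun"
  assumes is_band: "band P BL pc s D 1 E"
    and normalized: "cell_inner BL (\<psi> k) (\<psi> k) = 1"
    and spans: "E k = {f \<in> l2loc. \<exists>c. AE r in lborel. f r = c *\<^sub>v \<psi> k r}"
    and mem_E: "\<psi> k \<in> E k"
    and analytic: "analytic_near (bloch BL 0) (cell_norm BL) (\<lambda>k. phase (- k) (\<psi> k)) k0"
    and periodic: "K \<in> reciprocal_lattice BL \<Longrightarrow> AE r in lborel. \<psi> (k + K) r = \<psi> k r"
begin

text \<open>The basis is fixed by choice, because the sublocale below refers to definite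
  matrices.\<close>

definition A_BL :: "real^'d^'d" where "A_BL = (SOME A. \<exists>A'. lattice_basis A A' BL)"
definition A'_BL :: "real^'d^'d" where "A'_BL = (SOME A'. lattice_basis A_BL A' BL)"

sublocale LB: lattice_basis A_BL A'_BL BL
proof -
  have "\<exists>A A'. lattice_basis A A' BL" using full_rank_lattice_basis[OF lattice] by blast
  then have "\<exists>A'. lattice_basis A_BL A' BL" unfolding A_BL_def by (rule someI_ex)
  then show "lattice_basis A_BL A'_BL BL" unfolding A'_BL_def by (rule someI_ex)
qed

lemma band_bloch: "f \<in> E k \<Longrightarrow> f \<in> bloch BL k"
  using is_band unfolding band_def by blast

lemma ghat_mem_E:
  assumes "p \<in> carrier P" "f \<in> E k"
  shows "ghat P BL pc D (p, 0) f \<in> E (s p *\<^sub>R pc p k)"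
proof -
  have "(p, 0) \<in> carrier (space_group P BL pc)" using assms lattice_zero by (simp add: space_carrier)
  then have "ghat P BL pc D (p, 0) ` E k = E (s p *\<^sub>R pc p k)"
    using is_band unfolding band_def by fastforce
  then show ?thesis using assms(2) by blast
qed

lemma psi_l2loc: "\<psi> k \<in> l2loc"
  using mem_E band_bloch blochD(1) by blast

definition u :: "real^'d \<Rightarrow> ('d, 'v, 'm) wavefun" where
  "u k = phase (- k) (\<psi> k)"

lemma u_bloch: "u k \<in> bloch BL 0"
  unfolding u_def by (intro bloch_phase_strip band_bloch mem_E)

text \<open>As the fibres are lines, this matrix element is the entire action of \<open>p\<close> at
  \<open>k\<close>. Writing it as an inner product gives access to its analyticity.\<close>

definition lam :: "'p \<Rightarrow> real^'d \<Rightarrow> complex" where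
  "lam p k = cell_inner BL (\<psi> (s p *\<^sub>R pc p k)) (ghat P BL pc D (p, 0) (\<psi> k))"

lemma ghat_psi_l2loc: "p \<in> carrier P \<Longrightarrow> ghat P BL pc D (p, 0) (\<psi> k) \<in> l2loc"
  using lattice_zero psi_l2loc by (intro ghat_l2loc)

lemma ghat_psi:
  assumes "p \<in> carrier P"
  shows "AE r in lborel. ghat P BL pc D (p, 0) (\<psi> k) r = lam p k *\<^sub>v \<psi> (s p *\<^sub>R pc p k) r"
proof -
  let ?k = "s p *\<^sub>R pc p k" and ?g = "ghat P BL pc D (p, 0) (\<psi> k)"
  have "?g \<in> E ?k" using assms mem_E by (rule ghat_mem_E)
  then obtain c where c: "AE r in lborel. ?g r = c *\<^sub>v \<psi> ?k r"
    unfolding spans by blast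
  have "lam p k = cell_inner BL (\<psi> ?k) (\<lambda>r. c *\<^sub>v \<psi> ?k r)"
    unfolding lam_def using assms c ghat_psi_l2loc psi_l2loc
    by (intro LB.cell_inner_cong_AE l2locD l2loc_scale) auto
  then have "lam p k = c" by (simp add: cell_inner_scale_right normalized)
  with c show ?thesis by simp
qed

lemma lam_unique:
  assumes "p \<in> carrier P" "AE r in lborel. ghat P BL pc D (p, 0) (\<psi> k) r = c *\<^sub>v \<psi> (s p *\<^sub>R pc p k) r"
  shows "lam p k = c"
proof -
  have "lam p k = cell_inner BL (\<psi> (s p *\<^sub>R pc p k)) (\<lambda>r. c *\<^sub>v \<psi> (s p *\<^sub>R pc p k) r)"
    unfolding lam_def using assms ghat_psi_l2loc psi_l2loc
    by (intro LB.cell_inner_cong_AE l2locD l2loc_scale) auto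
  then show ?thesis by (simp add: cell_inner_scale_right normalized)
qed

lemma norm_lam:
  assumes "p \<in> carrier P"
  shows "cmod (lam p k) = 1"
proof -
  have "1 = cell_inner BL (ghat P BL pc D (p, 0) (\<psi> k)) (ghat P BL pc D (p, 0) (\<psi> k))"
    using assms normalized by (simp add: ghat_cell_inner cj_one)
  also have "\<dots> = cell_inner BL (\<lambda>r. lam p k *\<^sub>v \<psi> (s p *\<^sub>R pc p k) r) (\<lambda>r. lam p k *\<^sub>v \<psi> (s p *\<^sub>R pc p k) r)"
    using assms ghat_psi ghat_psi_l2loc psi_l2loc
    by (intro LB.cell_inner_cong_AE l2locD l2loc_scale) auto
  also have "\<dots> = lam p k * cnj (lam p k)"
    by (simp add: cell_inner_scale_left cell_inner_scale_right normalized mult.commute)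
  finally have "complex_of_real ((cmod (lam p k))\<^sup>2) = of_real 1" using complex_norm_square[of "lam p k"] by simp
  then show ?thesis
    using norm_ge_zero[of "lam p k"] by (simp only: of_real_eq_iff) (auto simp: power2_eq_1_iff)
qed

text \<open>An antiunitary \<open>q\<close> conjugates the scalar that it passes, hence
  \<open>cj (s q)\<close>. No extra sign appears because \<open>D\<close> is a true representation,
  of the double group in the spinful case.\<close>

lemma lam_mult:
  assumes "q \<in> carrier P" "p \<in> carrier P"
  shows "lam (q \<otimes> p) k = cj (s q) (lam p k) * lam q (s p *\<^sub>R pc p k)"
proof (rule lam_unique)
  let ?k = "s p *\<^sub>R pc p k"
  have "AE r in lborel. ghat P BL pc D (q, 0) (ghat P BL pc D (p, 0) (\<psi> k)) r =
     ghat P BL pc D (q, 0) (\<lambda>r. lam p k *\<^sub>v \<psi> ?k r) r"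
    using assms lattice_zero ghat_psi by (intro ghat_AE) auto
  moreover have "AE r in lborel. ghat P BL pc D (q, 0) (\<psi> ?k) r = lam q ?k *\<^sub>v \<psi> (s q *\<^sub>R pc q ?k) r"
    using assms by (intro ghat_psi)
  moreover have "ghat P BL pc D (q, 0) (ghat P BL pc D (p, 0) (\<psi> k)) = ghat P BL pc D (q \<otimes> p, 0) (\<psi> k)"
    using assms lattice_zero linear_0[OF pc_linear] by (simp add: ghat_mult)
  moreover have "ghat P BL pc D (q, 0) (\<lambda>r. lam p k *\<^sub>v \<psi> ?k r) =
      (\<lambda>r. cj (s q) (lam p k) *\<^sub>v ghat P BL pc D (q, 0) (\<psi> ?k) r)"
    using assms lattice_zero by (intro ghat_scale)
  ultimately show "AE r in lborel. ghat P BL pc D (q \<otimes> p, 0) (\<psi> k) r =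
      (cj (s q) (lam p k) * lam q ?k) *\<^sub>v \<psi> (s (q \<otimes> p) *\<^sub>R pc (q \<otimes> p) k) r"
    using assms by (simp add: twisted_mult val_scale_simps[symmetric]) (auto simp: val_scale_simps elim: eventually_elim2)
qed (use assms in simp)

lemma lam_periodic:
  assumes p: "p \<in> carrier P" and K: "K \<in> reciprocal_lattice BL"
  shows "lam p (k + K) = lam p k"
proof (rule lam_unique[OF p])
  let ?T = "\<lambda>k. s p *\<^sub>R pc p k"
  have T: "?T (k + K) = ?T k + ?T K" using p by (simp add: linear_add[OF pc_linear] scaleR_add_right)
  have "AE r in lborel. ghat P BL pc D (p, 0) (\<psi> (k + K)) r = ghat P BL pc D (p, 0) (\<psi> k) r"
    using p lattice_zero periodic[OF K] by (intro ghat_AE)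
  moreover have "AE r in lborel. \<psi> (?T (k + K)) r = \<psi> (?T k) r"
    unfolding T using twisted_reciprocal[OF p K] by (rule periodic)
  moreover note ghat_psi[OF p, of k]
  ultimately show "AE r in lborel. ghat P BL pc D (p, 0) (\<psi> (k + K)) r = lam p k *\<^sub>v \<psi> (?T (k + K)) r"
    by eventually_elim simp
qed

lemma analytic_u: "analytic_near (bloch BL 0) (cell_norm BL) u k0"
  using analytic unfolding u_def[abs_def] .

lemma canalytic_inner_u: "h \<in> bloch BL 0 \<Longrightarrow> canalytic (\<lambda>k. cell_inner BL h (u k)) k0"
  and canalytic_u_inner: "h \<in> bloch BL 0 \<Longrightarrow> canalytic (\<lambda>k. cell_inner BL (u k) h) k0"
proof -
  interpret null_bilinear "bloch BL 0" "cell_norm BL" "bloch BL 0" "cell_norm BL" UNIV norm "cell_inner BL" 1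
    by (rule LB.null_bilinear_cell_inner)
  assume h: "h \<in> bloch BL 0"
  show "canalytic (\<lambda>k. cell_inner BL h (u k)) k0" "canalytic (\<lambda>k. cell_inner BL (u k) h) k0"
    using analytic_near_bilinear[OF S1.analytic_near_const[OF h] analytic_u h u_bloch]
      analytic_near_bilinear[OF analytic_u S1.analytic_near_const[OF h] u_bloch h] by simp_all
qed

text \<open>In the defining inner product both arguments vary with \<open>k\<close>. Freezing the
  first at \<open>h = u (?T k0)\<close> gives scalar functions with
  \<open>F k = lam p k * G (?T k)\<close> and \<open>G (?T k0) = 1\<close>, so near
  \<open>k0\<close> the phase is a quotient of analytic scalars.\<close>

lemma lam_analytic:
  assumes p: "p \<in> carrier P"
  shows "canalytic (lam p) k0"
proof -
  let ?T = "\<lambda>k. s p *\<^sub>R pc p k"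
  define h where "h = u (?T k0)"
  \<comment> \<open>Moving the operation onto the fixed vector leaves \<open>u k\<close> untouched
    in the inner product.\<close>
  define h' where "h' = ghat P BL pc D (inv p, 0) h"
  define G where "G k = cell_inner BL h (u k)" for k
  define F where "F k = cell_inner BL h (ghat P BL pc D (p, 0) (u k))" for k
  have h: "h \<in> bloch BL 0" "h' \<in> bloch BL 0"
    unfolding h_def h'_def using p u_bloch by (auto intro: ghat_bloch_zero)
  have "ghat P BL pc D (p, 0) h' = h"
    using ghat_inverse(1)[OF p lattice_zero, of h] p linear_0[OF pc_linear[of "inv p"]] by (simp add: h'_def)
  then have F: "F k = cj (s p) (cell_inner BL h' (u k))" for k
    using ghat_cell_inner[OF p, of h' "u k"] by (simp add: F_def)
  \<comment> \<open>For an antiunitary operation the conjugation is absorbed by exchanging the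
    arguments of the inner product.\<close>
  have Fan: "canalytic F k0"
  proof (cases "s p = 1")
    case True
    then have "F = (\<lambda>k. cell_inner BL h' (u k))" by (intro ext) (simp add: F cj_def)
    then show ?thesis using canalytic_inner_u[OF h(2)] by simp
  next
    case False
    then have "F = (\<lambda>k. cell_inner BL (u k) h')" by (intro ext) (simp add: F cj_def cnj_cell_inner)
    then show ?thesis using canalytic_u_inner[OF h(2)] by simp
  qed
  have Gan: "canalytic G k" for k
    unfolding G_def[abs_def] by (rule canalytic_inner_u[OF h(1)])
  have lin: "linear ?T" using orthogonal_twisted[OF p] by (rule orthogonal_transformation_linear)
  have GT: "canalytic (\<lambda>k. G (?T k)) k0" by (rule canalytic_linear_comp[OF lin Gan])
  have G1: "G (?T k0) = 1"
    unfolding G_def h_def u_def by (simp add: cell_inner_phase normalized)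
  have rel: "F k = lam p k * G (?T k)" for k
  proof -
    have "ghat P BL pc D (p, 0) (u k) = phase (- ?T k) (ghat P BL pc D (p, 0) (\<psi> k))"
      unfolding u_def using ghat_phase[OF p, of "- k"] linear_neg[OF pc_linear[OF p]] by simp
    then have "AE r in lborel. ghat P BL pc D (p, 0) (u k) r = lam p k *\<^sub>v u (?T k) r"
      using ghat_psi[OF p, of k] by (auto simp: u_def phase_def val_scale_simps mult.commute elim!: eventually_mono)
    then have "F k = cell_inner BL h (\<lambda>r. lam p k *\<^sub>v u (?T k) r)"
      unfolding F_def using h u_bloch ghat_bloch_zero[OF p]
      by (intro LB.cell_inner_cong_AE l2locD l2loc_scale blochD(1)[of _ BL 0]) auto
    then show ?thesis by (simp add: cell_inner_scale_right G_def)
  qed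
  have "canalytic (\<lambda>k. inverse (G (?T k))) k0"
  proof (rule canalytic_holomorphic_comp[where F=inverse and r=1, OF _ _ GT])
    show "inverse holomorphic_on ball (G (?T k0)) 1"
      by (intro holomorphic_intros) (auto simp: G1 dist_norm)
  qed simp
  then have an: "canalytic (\<lambda>k. F k * inverse (G (?T k))) k0" using Fan by (intro canalytic_mult)
  have "\<forall>\<^sub>F k in nhds k0. G (?T k) \<noteq> 0"
  proof -
    have "((\<lambda>k. G (?T k)) \<longlongrightarrow> G (?T k0)) (nhds k0)"
      using canalytic_continuous[OF GT] by (simp add: continuous_at tendsto_nhds_iff)
    then show ?thesis using G1 by (intro tendsto_imp_eventually_ne) auto
  qed
  then have "\<forall>\<^sub>F k in nhds k0. F k * inverse (G (?T k)) = lam p k"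
    by eventually_elim (simp add: rel)
  from cnorm.analytic_near_cong[OF this] show ?thesis using an by simp
qed

end

subsection \<open>The gauge\<close>

context localized_simple_band
begin

text \<open>A nonvanishing continuous function on a contractible space has a continuous logarithm;
  modulus 1 makes it purely imaginary.\<close>

lemma phase_lift:
  assumes p: "p \<in> carrier P"
  shows "\<exists>t. continuous_on UNIV t \<and> (\<forall>k. lam p k = cis (t k))"
proof -
  have "continuous_on UNIV (lam p)"
    using canalytic_continuous[OF lam_analytic[OF p]] by (simp add: continuous_on_eq_continuous_at)
  moreover have "lam p k \<noteq> 0" for k using norm_lam[OF p, of k] by auto
  ultimately obtain g where g: "continuous_on UNIV g" "\<And>k. k \<in> UNIV \<Longrightarrow> lam p k = exp (g k)"
    using continuous_logarithm_on_contractible[OF _ convex_imp_contractible[OF convex_UNIV]] by metis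
  have "lam p k = cis (Im (g k))" for k
  proof -
    have "exp (Re (g k)) = 1" using norm_lam[OF p, of k] g(2)[of k] by (simp add: norm_exp_eq_Re)
    then have "g k = \<i> * of_real (Im (g k))" by (simp add: complex_eq_iff)
    then show ?thesis using g(2)[of k] by (simp add: cis_conv_exp)
  qed
  moreover have "continuous_on UNIV (\<lambda>k. Im (g k))" using g(1) by (intro continuous_intros)
  ultimately show ?thesis by blast
qed

definition theta :: "'p \<Rightarrow> real^'d \<Rightarrow> real" where
  "theta p = (SOME t. continuous_on UNIV t \<and> (\<forall>k. lam p k = cis (t k)))"

lemma theta:
  assumes "p \<in> carrier P"
  shows "continuous_on UNIV (theta p)" "lam p k = cis (theta p k)"
proof -
  have "continuous_on UNIV (theta p) \<and> (\<forall>k. lam p k = cis (theta p k))"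
    unfolding theta_def by (rule someI_ex[OF phase_lift[OF assms]])
  then show "continuous_on UNIV (theta p)" "lam p k = cis (theta p k)" by blast+
qed

text \<open>Near \<open>k0\<close> the lift moves by less than \<open>pi\<close>, so it is
  recovered, up to its value at \<open>k0\<close>, from the principal logarithm of the quotient of
  \<open>lam p k\<close> by \<open>lam p k0\<close>.\<close>

lemma theta_analytic:
  assumes p: "p \<in> carrier P"
  shows "canalytic (\<lambda>k. of_real (theta p k)) k0"
proof -
  let ?f = "\<lambda>k. lam p k * cnj (lam p k0)"
  have f: "?f k = cis (theta p k - theta p k0)" for k
    by (simp add: theta[OF p] cis_cnj cis_mult)
  have "canalytic (\<lambda>k. cnj (lam p k0)) k0" by (rule cnorm.analytic_near_const) simp
  then have "canalytic ?f k0" using lam_analytic[OF p] by (intro canalytic_mult)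
  moreover have "Ln holomorphic_on ball (?f k0) 1"
  proof (rule holomorphic_on_Ln)
    show "ball (?f k0) 1 \<inter> \<real>\<^sub>\<le>\<^sub>0 = {}"
    proof (rule ccontr)
      assume "ball (?f k0) 1 \<inter> \<real>\<^sub>\<le>\<^sub>0 \<noteq> {}"
      then obtain z :: complex where z: "norm (1 - z) < 1" "z \<in> \<real>\<^sub>\<le>\<^sub>0" by (auto simp: f dist_norm)
      then have "Re z \<le> 0" by (simp add: complex_nonpos_Reals_iff)
      then show False using z(1) complex_Re_le_cmod[of "1 - z"] by simp
    qed
  qed
  ultimately have "canalytic (\<lambda>k. Ln (?f k)) k0"
    using canalytic_holomorphic_comp[of Ln ?f k0 1] by simp
  then have "canalytic (\<lambda>k. - \<i> * Ln (?f k)) k0"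
    by (intro canalytic_mult cnorm.analytic_near_const) auto
  then have an: "canalytic (\<lambda>k. of_real (theta p k0) + - \<i> * Ln (?f k)) k0"
    by (intro cnorm.analytic_near_add cnorm.analytic_near_const) auto
  have "(theta p \<longlongrightarrow> theta p k0) (nhds k0)"
    using theta(1)[OF p] by (simp add: continuous_on_eq_continuous_at continuous_at tendsto_nhds_iff)
  then have "\<forall>\<^sub>F k in nhds k0. dist (theta p k) (theta p k0) < pi"
    by (rule tendstoD) simp
  then have "\<forall>\<^sub>F k in nhds k0. of_real (theta p k0) + - \<i> * Ln (?f k) = of_real (theta p k)"
  proof eventually_elim
    case (elim k)
    have "Ln (?f k) = \<i> * of_real (theta p k - theta p k0)"
      unfolding f cis_conv_exp using elim by (intro Ln_exp) (auto simp: dist_real_def)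
    then have "- \<i> * Ln (?f k) = of_real (theta p k) - of_real (theta p k0)"
      by (simp only: mult.assoc[symmetric]) simp
    then show ?case by (simp only: add_diff_cancel_left' add_diff_eq)
  qed
  from cnorm.analytic_near_cong[OF this] show ?thesis using an by simp
qed

lemma phase_constant:
  assumes "continuous_on UNIV t" "\<And>k. cis (t k) = 1"
  shows "t k = t (0 :: real^'d)"
proof -
  have "t k / (2 * pi) = t 0 / (2 * pi)"
  proof (rule continuous_integer_constant)
    show "continuous_on UNIV (\<lambda>k. t k / (2 * pi))" using assms(1) by (intro continuous_intros) auto
    fix k
    obtain n :: int where "t k = 2 * pi * of_int n" using assms(2)[of k] cis_eq_1_iff by blast
    then show "\<exists>n::int. t k / (2 * pi) = of_int n" by (intro exI[of _ n]) simp
  qed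
  then show ?thesis by simp
qed

lemma twisted_continuous: "p \<in> carrier P \<Longrightarrow> continuous_on UNIV (\<lambda>k. s p *\<^sub>R pc p k)"
  using orthogonal_transformation_linear[OF orthogonal_twisted[of p]]
  by (intro linear_continuous_on linear_conv_bounded_linear[THEN iffD1])

text \<open>The cocycle identity of the phases lifts up to a multiple of \<open>2 * pi\<close>,
  which is continuous in \<open>k\<close> and hence constant.\<close>

lemma theta_mult:
  assumes q: "q \<in> carrier P" and p: "p \<in> carrier P"
  shows "\<exists>c. \<forall>k. theta q (s p *\<^sub>R pc p k) = theta (q \<otimes> p) k - s q * theta p k - c"
proof -
  let ?t = "\<lambda>k. theta (q \<otimes> p) k - s q * theta p k - theta q (s p *\<^sub>R pc p k)"
  have "?t k = ?t 0" for k
  proof (rule phase_constant)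
    have "continuous_on UNIV (\<lambda>k. theta q (s p *\<^sub>R pc p k))"
      by (rule continuous_on_compose2[OF theta(1)[OF q] twisted_continuous[OF p]]) simp
    then show "continuous_on UNIV ?t" using p q by (intro continuous_intros theta) auto
    fix k
    have "cis (theta (q \<otimes> p) k) = cis (s q * theta p k) * cis (theta q (s p *\<^sub>R pc p k))"
      using lam_mult[OF q p, of k] p q s_sign by (simp add: theta cj_cis)
    then have "cis (theta (q \<otimes> p) k) * cis (- (s q * theta p k + theta q (s p *\<^sub>R pc p k))) = 1"
      by (simp add: cis_mult)
    then show "cis (?t k) = 1" by (simp add: cis_mult algebra_simps)
  qed
  then have "\<forall>k. theta q (s p *\<^sub>R pc p k) = theta (q \<otimes> p) k - s q * theta p k - ?t 0"
    by (smt (verit))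
  then show ?thesis by blast
qed

text \<open>Averaging the phases over the point group trivializes their cocycle up to constants.\<close>

definition chi :: "real^'d \<Rightarrow> real" where
  "chi k = - (\<Sum>q\<in>carrier P. s q * theta q k) / card (carrier P)"

lemma card_P: "real (card (carrier P)) \<noteq> 0"
  using finite_point_group one_closed by (auto simp: card_eq_0_iff)

lemma chi_analytic: "canalytic (\<lambda>k. of_real (chi k)) k0"
proof -
  have "canalytic (\<lambda>k. of_real (s q) * of_real (theta q k)) k0" if "q \<in> carrier P" for q
    using theta_analytic[OF that] by (intro canalytic_mult cnorm.analytic_near_const) auto
  then have "canalytic (\<lambda>k. \<Sum>q\<in>carrier P. of_real (s q) * of_real (theta q k)) k0"
    by (intro cnorm.analytic_near_sum) auto
  then have "canalytic (\<lambda>k. of_real (- 1 / card (carrier P)) * (\<Sum>q\<in>carrier P. of_real (s q) * of_real (theta q k))) k0"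
    by (intro canalytic_mult cnorm.analytic_near_const) auto
  then show ?thesis by (simp add: chi_def)
qed

text \<open>Right translation by \<open>p\<close> permutes the summands, and
  \<open>s q * s q = 1\<close> makes every summand contribute the same \<open>theta p\<close>. The
  leftover \<open>c\<close> is an average of signed multiples of \<open>2 * pi\<close>, in general
  not such a multiple itself; it becomes a phase carried by the Wannier function.\<close>

lemma chi_twisted:
  assumes p: "p \<in> carrier P"
  shows "\<exists>c. \<forall>k. chi (s p *\<^sub>R pc p k) = s p * chi k + theta p k + c"
proof -
  have "\<forall>q. \<exists>c. q \<in> carrier P \<longrightarrow> (\<forall>k. theta q (s p *\<^sub>R pc p k) = theta (q \<otimes> p) k - s q * theta p k - c)"
    using theta_mult[OF _ p] by blast
  from choice[OF this] obtain c where
    c: "\<And>q k. q \<in> carrier P \<Longrightarrow> theta q (s p *\<^sub>R pc p k) = theta (q \<otimes> p) k - s q * theta p k - c q"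
    by blast
  let ?N = "real (card (carrier P))"
  define C where "C = (\<Sum>q\<in>carrier P. s q * c q)"
  have "chi (s p *\<^sub>R pc p k) = s p * chi k + theta p k + C / ?N" for k
  proof -
    have sq: "s q * (s q * x) = x" if "q \<in> carrier P" for q x
      using s_square[OF that] by (simp add: mult.assoc[symmetric])
    have "(\<Sum>q\<in>carrier P. s q * theta q (s p *\<^sub>R pc p k)) =
        (\<Sum>q\<in>carrier P. s p * (s (q \<otimes> p) * theta (q \<otimes> p) k) - theta p k - s q * c q)"
    proof (rule sum.cong)
      fix q assume q: "q \<in> carrier P"
      have "s q = s p * s (q \<otimes> p)" using s_hom[OF q p] sq[OF p] by (simp add: mult.left_commute)
      then show "s q * theta q (s p *\<^sub>R pc p k) = s p * (s (q \<otimes> p) * theta (q \<otimes> p) k) - theta p k - s q * c q"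
        using sq[OF q, of "theta p k"] by (simp add: c[OF q] algebra_simps)
    qed simp
    also have "\<dots> = s p * (\<Sum>q\<in>carrier P. s (q \<otimes> p) * theta (q \<otimes> p) k) - ?N * theta p k - C"
      by (simp add: sum_subtractf sum_distrib_left C_def)
    also have "(\<Sum>q\<in>carrier P. s (q \<otimes> p) * theta (q \<otimes> p) k) = (\<Sum>q\<in>carrier P. s q * theta q k)"
      by (rule sum.reindex_bij_witness[of _ "\<lambda>q. q \<otimes> inv p" "\<lambda>q. q \<otimes> p"]) (use p in \<open>auto simp: m_assoc\<close>)
    finally show ?thesis
      using card_P by (simp add: chi_def field_simps)
  qed
  then show ?thesis by blast
qed

text \<open>The increment along \<open>K\<close> is \<open>2 * pi\<close> times the winding number
  of \<open>lam p\<close> around a loop of the torus, so it is independent of the base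
  point.\<close>

lemma theta_periodic:
  assumes "p \<in> carrier P" "K \<in> reciprocal_lattice BL"
  shows "theta p (k + K) - theta p k = theta p K - theta p 0"
proof -
  have "theta p (k + K) - theta p k = theta p (0 + K) - theta p 0"
  proof (rule phase_constant[of "\<lambda>k. theta p (k + K) - theta p k"])
    have "continuous_on UNIV (\<lambda>k. theta p (k + K))"
      by (rule continuous_on_compose2[OF theta(1)[OF assms(1)]]) (auto intro: continuous_intros)
    then show "continuous_on UNIV (\<lambda>k. theta p (k + K) - theta p k)"
      using assms by (intro continuous_intros theta)
    fix k
    have "cis (theta p (k + K)) = cis (theta p k)"
      using lam_periodic[OF assms] assms(1) by (simp add: theta)
    then have "cis (theta p (k + K)) * cis (- theta p k) = 1" by (simp add: cis_mult)
    then show "cis (theta p (k + K) - theta p k) = 1" by (simp add: cis_mult)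
  qed
  then show ?thesis by simp
qed

text \<open>The increments of \<open>chi\<close> are additive in \<open>K\<close> and therefore
  given by pairing with a vector. As averages of winding numbers they lie in
  \<open>2 * pi / |P|\<close> times the integers, so \<open>w\<close> need not belong to
  \<open>BL\<close>.\<close>

lemma chi_quasiperiodic: "\<exists>w. \<forall>k. \<forall>K\<in>reciprocal_lattice BL. chi (k + K) = chi k + w \<bullet> K"
proof -
  interpret RB: lattice_basis "(2 * pi) *\<^sub>R transpose A'_BL" "(1 / (2 * pi)) *\<^sub>R transpose A_BL" "reciprocal_lattice BL"
    by (rule LB.reciprocal)
  let ?M = "(2 * pi) *\<^sub>R transpose A'_BL" and ?M' = "(1 / (2 * pi)) *\<^sub>R transpose A_BL"
  have shift: "chi (k + K) - chi k = chi K - chi 0" if "K \<in> reciprocal_lattice BL" for k K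
  proof -
    have "(\<Sum>q\<in>carrier P. s q * theta q (k + K)) - (\<Sum>q\<in>carrier P. s q * theta q k) =
      (\<Sum>q\<in>carrier P. s q * theta q K) - (\<Sum>q\<in>carrier P. s q * theta q 0)"
      unfolding sum_subtractf[symmetric] right_diff_distrib[symmetric]
      using theta_periodic[OF _ that] by (intro sum.cong refl) simp
    then show ?thesis unfolding chi_def by (simp add: diff_divide_distrib[symmetric])
  qed
  define F where "F n = chi (?M *v ivec n) - chi 0" for n
  have "F (m + n) = F m + F n" for m n
    using shift[OF RB.memI[of n], of "?M *v ivec m"]
    by (simp add: F_def ivec_add matrix_vector_right_distrib)
  then obtain v where v: "\<And>n. F n = v \<bullet> ivec n" using additive_ivec[of F] by blast
  have "chi (k + K) = chi k + (transpose ?M' *v v) \<bullet> K" if K: "K \<in> reciprocal_lattice BL" for k K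
  proof -
    obtain n where n: "K = ?M *v ivec n" using K RB.L_def by blast
    have "(transpose ?M' *v v) \<bullet> K = v \<bullet> (?M' *v K)" by (rule inner_transpose)
    also have "?M' *v K = ivec n" unfolding n by (rule RB.A'_A)
    also have "v \<bullet> ivec n = chi K - chi 0" by (simp only: v[symmetric] F_def n)
    finally show ?thesis using shift[OF K, of k] by simp
  qed
  then show ?thesis by blast
qed

definition site :: "real^'d" where
  "site = (SOME w. \<forall>k. \<forall>K\<in>reciprocal_lattice BL. chi (k + K) = chi k + w \<bullet> K)"

text \<open>Subtracting the linear part makes the gauge phase periodic. The linear part returns as
  the translation phases of the point operations, which identify \<open>site\<close> as the
  centre.\<close>

definition chi' :: "real^'d \<Rightarrow> real" where
  "chi' k = chi k - site \<bullet> k"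

definition psi' :: "real^'d \<Rightarrow> ('d, 'v, 'm) wavefun" where
  "psi' k = (\<lambda>r. cis (chi' k) *\<^sub>v \<psi> k r)"

lemma chi'_periodic: "K \<in> reciprocal_lattice BL \<Longrightarrow> chi' (k + K) = chi' k"
  using someI_ex[OF chi_quasiperiodic] by (simp add: site_def[symmetric] chi'_def inner_add_right)

lemma chi'_analytic: "canalytic (\<lambda>k. of_real (chi' k)) k0"
proof -
  have "canalytic (\<lambda>k. of_real (- (site \<bullet> k))) k0"
    by (intro canalytic_linear linearI) (simp_all add: inner_add_right)
  then have "canalytic (\<lambda>k. of_real (chi k) + of_real (- (site \<bullet> k))) k0"
    using chi_analytic by (intro cnorm.analytic_near_add) auto
  then show ?thesis by (simp add: chi'_def)
qed

lemma psi'_analytic: "analytic_near (bloch BL 0) (cell_norm BL) (\<lambda>k. phase (- k) (psi' k)) k0"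
proof -
  interpret null_bilinear UNIV norm "bloch BL 0" "cell_norm BL" "bloch BL 0" "cell_norm BL"
    "\<lambda>c (f :: ('d, 'v, 'm) wavefun) r. c *\<^sub>v f r" 1
    by (rule LB.null_bilinear_val_scale)
  have "analytic_near (bloch BL 0) (cell_norm BL) (\<lambda>k r. cis (chi' k) *\<^sub>v u k r) k0"
    by (rule analytic_near_bilinear[OF canalytic_exp_i[OF chi'_analytic] analytic_u _ u_bloch]) simp
  moreover have "(\<lambda>k r. cis (chi' k) *\<^sub>v u k r) = (\<lambda>k. phase (- k) (psi' k))"
    by (simp add: fun_eq_iff u_def phase_def psi'_def val_scale_simps mult.commute)
  ultimately show ?thesis by simp
qed

lemma psi'_periodic:
  assumes "K \<in> reciprocal_lattice BL"
  shows "AE r in lborel. psi' (k + K) r = psi' k r"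
  using periodic[OF assms, of k] by eventually_elim (simp add: psi'_def chi'_periodic[OF assms])

lemma psi'_l2loc: "psi' k \<in> l2loc"
  unfolding psi'_def using psi_l2loc by (rule l2loc_scale)

lemma E_psi': "E k = {f \<in> l2loc. \<exists>c. AE r in lborel. f r = c *\<^sub>v psi' k r}"
proof -
  have "(\<exists>c. AE r in lborel. f r = c *\<^sub>v \<psi> k r) \<longleftrightarrow> (\<exists>c. AE r in lborel. f r = c *\<^sub>v psi' k r)" for f
  proof
    assume "\<exists>c. AE r in lborel. f r = c *\<^sub>v \<psi> k r"
    then obtain c where "AE r in lborel. f r = c *\<^sub>v \<psi> k r" ..
    then have "AE r in lborel. f r = (c * cis (- chi' k)) *\<^sub>v psi' k r"
      by (simp add: psi'_def val_scale_simps mult.assoc cis_mult)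
    then show "\<exists>c. AE r in lborel. f r = c *\<^sub>v psi' k r" by blast
  qed (auto simp: psi'_def val_scale_simps)
  then show ?thesis unfolding spans by simp
qed

lemma psi'_normalized: "cell_inner BL (psi' k) (psi' k) = 1"
  by (simp add: psi'_def cell_inner_scale_left cell_inner_scale_right normalized cis_cnj cis_mult)

text \<open>In the new gauge, the phase of each point operation is that of a translation, as if the
  Wannier function sat at \<open>site\<close>.\<close>

lemma ghat_psi':
  assumes p: "p \<in> carrier P"
  shows "\<exists>c. \<forall>k. AE r in lborel. ghat P BL pc D (p, 0) (psi' k) r =
    cis (c + s p * (k \<bullet> (pc (inv p) site - site))) *\<^sub>v psi' (s p *\<^sub>R pc p k) r"
proof -
  let ?T = "\<lambda>k. s p *\<^sub>R pc p k"
  obtain c where c: "\<And>k. chi (?T k) = s p * chi k + theta p k + c" using chi_twisted[OF p] by blast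
  have "AE r in lborel. ghat P BL pc D (p, 0) (psi' k) r =
    cis (- c + s p * (k \<bullet> (pc (inv p) site - site))) *\<^sub>v psi' (?T k) r" for k
    using ghat_psi[OF p, of k]
  proof eventually_elim
    case (elim r)
    have e: "s p * chi' k + theta p k = (- c + s p * (k \<bullet> (pc (inv p) site - site))) + chi' (?T k)"
      using p by (simp add: chi'_def c inner_diff_right algebra_simps pc_inner[symmetric] inner_commute)
    have "ghat P BL pc D (p, 0) (psi' k) r = cis (s p * chi' k) *\<^sub>v ghat P BL pc D (p, 0) (\<psi> k) r"
      unfolding psi'_def using p lattice_zero s_sign by (simp add: ghat_scale cj_cis)
    also have "\<dots> = cis (s p * chi' k + theta p k) *\<^sub>v \<psi> (?T k) r"
      using elim p by (simp add: theta val_scale_simps cis_mult)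
    finally show ?case unfolding e by (simp add: psi'_def val_scale_simps cis_mult)
  qed
  then show ?thesis by blast
qed

text \<open>In the new gauge the phase of \<open>p\<close> compares two periodic sections, so it has
  the same value at 0 and at every reciprocal vector \<open>K\<close>. Hence the displacement pairs
  with each \<open>K\<close> to a multiple of \<open>2 * pi\<close>, which places it in the double
  reciprocal of \<open>BL\<close>.\<close>

lemma site_shift:
  assumes p: "p \<in> carrier P"
  shows "pc p site - site \<in> BL"
proof -
  have "pc (inv p) site - site \<in> BL" if p: "p \<in> carrier P" for p
  proof (rule LB.double_reciprocal)
    fix K assume K: "K \<in> reciprocal_lattice BL"
    let ?T = "\<lambda>k. s p *\<^sub>R pc p k"
    let ?x = "s p * (K \<bullet> (pc (inv p) site - site))"
    obtain c where c: "\<And>k. AE r in lborel. ghat P BL pc D (p, 0) (psi' k) r =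
      cis (c + s p * (k \<bullet> (pc (inv p) site - site))) *\<^sub>v psi' (?T k) r"
      using ghat_psi'[OF p] by blast
    have T0: "?T 0 = 0" using linear_0[OF pc_linear[OF p]] by simp
    have "AE r in lborel. ghat P BL pc D (p, 0) (psi' (0 + K)) r = ghat P BL pc D (p, 0) (psi' 0) r"
      using p lattice_zero psi'_periodic[OF K] by (intro ghat_AE)
    moreover have "AE r in lborel. psi' (0 + ?T K) r = psi' 0 r"
      using twisted_reciprocal[OF p K] by (rule psi'_periodic)
    moreover note c[of K] c[of 0]
    ultimately have ae: "AE r in lborel. cis (c + ?x) *\<^sub>v psi' 0 r = cis c *\<^sub>v psi' 0 r"
      by eventually_elim (simp add: T0 del: scaleR_eq_0_iff)
    have "cell_inner BL (psi' 0) (\<lambda>r. cis (c + ?x) *\<^sub>v psi' 0 r) = cell_inner BL (psi' 0) (\<lambda>r. cis c *\<^sub>v psi' 0 r)"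
      using ae by (intro LB.cell_inner_cong_AE l2locD l2loc_scale psi'_l2loc) auto
    then have "cis c * cis ?x = cis c * 1" by (simp add: cell_inner_scale_right psi'_normalized cis_mult)
    then have "cis ?x = 1" by simp
    then obtain n :: int where "?x = 2 * pi * of_int n" unfolding cis_eq_1_iff by blast
    then show "\<exists>n::int. K \<bullet> (pc (inv p) site - site) = 2 * pi * of_int n"
      using s_sign[OF p] by (auto intro: exI[of _ n] exI[of _ "- n"])
  qed
  from this[of "inv p"] show ?thesis using p by simp
qed

end

section \<open>Wannier functions and induction from the site\<close>

context localized_simple_band
begin

text \<open>The group element is moved to the test function, the defining integral of
  \<open>w\<close> is applied, and the twisted map is substituted in the zone integral. The
  remaining phases are linear in the wavevector and shift the lattice label to that of
  \<open>act pc (p, R0) (site + R)\<close>; the constant \<open>c\<close> is divided out.\<close>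

lemma wannier_transformed:
  assumes pR: "p \<in> carrier P" "R0 \<in> BL" and w: "wannier BL psi' R w"
    and c: "\<And>k. AE r in lborel. ghat P BL pc D (p, 0) (psi' k) r =
      cis (c + s p * (k \<bullet> (pc (inv p) site - site))) *\<^sub>v psi' (s p *\<^sub>R pc p k) r"
  shows "wannier BL psi' (pc p R + R0 + (pc p site - site))
    (\<lambda>r. cis (- c) *\<^sub>v ghat P BL pc D (p, R0) w r)"
  unfolding wannier_def
proof (intro conjI ballI impI)
  let ?g = "ghat P BL pc D (p, R0)" and ?T = "\<lambda>k. s p *\<^sub>R pc p k"
  let ?R = "pc p R + R0 + (pc p site - site)"
  let ?Z = "unit_cell (reciprocal_lattice BL)"
  let ?C = "complex_of_real (1 / sqrt (measure lborel ?Z))"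
  have p: "p \<in> carrier P" by (rule pR)
  have wl: "w \<in> l2loc" using w by (simp add: wannier_def)
  show "(\<lambda>r. cis (- c) *\<^sub>v ?g w r) \<in> l2loc" using pR wl by (intro l2loc_scale ghat_l2loc)
  fix h :: "(real, 'd) vec \<Rightarrow> complex^'v^'m"
  assume h: "h \<in> l2loc" and bd: "bounded {r. h r \<noteq> 0}"
  define h' where "h' = ghat P BL pc D (inv p, - pc (inv p) R0) h"
  have m: "inv p \<in> carrier P" "- pc (inv p) R0 \<in> BL" using pR pc_mem lattice_uminus by auto
  have gh': "?g h' = h" unfolding h'_def by (rule ghat_inverse(1)[OF pR])
  have h': "h' \<in> l2loc" unfolding h'_def using m h by (intro ghat_l2loc)
  \<comment> \<open>The weak definition of \<open>w\<close> tests against functions of bounded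
    support, a property that Euclidean motions preserve.\<close>
  have bd': "bounded {r. h' r \<noteq> 0}"
  proof -
    obtain B where B: "\<And>r. h r \<noteq> 0 \<Longrightarrow> norm r \<le> B" using bd unfolding bounded_iff by auto
    have "norm r \<le> B + norm R0" if "h' r \<noteq> 0" for r
    proof -
      have "h' r = Dv (inv p) (h (pc p r + R0))"
        unfolding h'_def ghat_apply[OF m] using p by (simp add: linear_add[OF pc_linear] pc_inv_right)
      then have "h (pc p r + R0) \<noteq> 0" using that linear_0[OF Dv_linear[OF m(1)]] by metis
      then have "norm (pc p r + R0) \<le> B" by (rule B)
      moreover have "norm (pc p r) \<le> norm (pc p r + R0) + norm R0"
        using norm_triangle_ineq4[of "pc p r + R0" R0] by simp
      moreover have "norm (pc p r) = norm r"
        using pc_orthogonal[OF p] by (rule orthogonal_transformation_norm)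
      ultimately show ?thesis by simp
    qed
    then show ?thesis unfolding bounded_iff by blast
  qed
  define Q where "Q k = (LINT r|lborel. val_inner (h r) (psi' k r))" for k
  have pairing: "(LINT r|lborel. val_inner (h r) (?g f r)) = cj (s p) (LINT r|lborel. val_inner (h' r) (f r))" for f
    using ghat_pairing[OF pR, of h' f] unfolding gh' .
  \<comment> \<open>The translation by \<open>R0\<close> and the phase of \<open>p\<close> are
    combined; orthogonality, \<open>pc p k \<bullet> pc p site = k \<bullet> site\<close>, turns
    both into a pairing with \<open>?T k\<close>.\<close>
  have gpsi: "(LINT r|lborel. val_inner (h r) (?g (psi' k) r)) =
      cis c * cis (- (?T k \<bullet> (R0 + (pc p site - site)))) * Q (?T k)" for k
  proof -
    have b: "psi' k \<in> bloch BL k"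
      unfolding psi'_def by (intro bloch_scale band_bloch mem_E)
    let ?e = "cis (- (s p * (pc p k \<bullet> R0))) * cis (c + s p * (k \<bullet> (pc (inv p) site - site)))"
    have "AE r in lborel. ?g (psi' k) r = ?e *\<^sub>v psi' (?T k) r"
      using ghat_translate[OF pR b] c[of k] by eventually_elim (simp add: val_scale_simps)
    then have "(LINT r|lborel. val_inner (h r) (?g (psi' k) r)) = (LINT r|lborel. val_inner (h r) (?e *\<^sub>v psi' (?T k) r))"
      using h pR psi'_l2loc
      by (intro integral_cong_AE) (auto elim!: eventually_mono intro!: val_inner_measurable l2locD ghat_l2loc l2loc_scale)
    also have "\<dots> = ?e * Q (?T k)" by (simp add: val_inner_simps Q_def)
    also have "?e = cis c * cis (- (?T k \<bullet> (R0 + (pc p site - site))))"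
    proof -
      have "pc p k \<bullet> pc p site = k \<bullet> site" using p by (simp add: pc_inner pc_inv_left)
      then have "- (s p * (pc p k \<bullet> R0)) + (c + s p * (k \<bullet> (pc (inv p) site - site))) =
          c + - (?T k \<bullet> (R0 + (pc p site - site)))"
        using p by (simp add: inner_diff_right inner_add_right pc_inner[symmetric] algebra_simps)
      then show ?thesis by (simp only: cis_mult)
    qed
    finally show ?thesis .
  qed
  have w': "(LINT r|lborel. val_inner (h' r) (w r)) =
      ?C * (LINT k:?Z|lborel. cis (- (k \<bullet> R)) * (LINT r|lborel. val_inner (h' r) (psi' k r)))"
    using w h' bd' unfolding wannier_def by blast
  \<comment> \<open>The right-hand side depends on \<open>k\<close> only through
    \<open>?T k\<close>, as the substitution in the zone integral requires.\<close>
  have integrand: "cj (s p) (cis (- (k \<bullet> R)) * (LINT r|lborel. val_inner (h' r) (psi' k r))) =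
      cis c * (cis (- (?T k \<bullet> ?R)) * Q (?T k))" for k
  proof -
    have "pc p k \<bullet> pc p R = k \<bullet> R" using p by (simp add: pc_inner pc_inv_left)
    then have "cj (s p) (cis (- (k \<bullet> R))) = cis (- (?T k \<bullet> pc p R))"
      using p s_sign by (simp add: cj_cis)
    moreover have "cis (- (?T k \<bullet> ?R)) = cis (- (?T k \<bullet> pc p R)) * cis (- (?T k \<bullet> (R0 + (pc p site - site))))"
      by (simp only: cis_mult inner_add_right minus_add_distrib add.assoc)
    ultimately show ?thesis
      unfolding cj_mult pairing[symmetric] gpsi by (simp add: mult_ac)
  qed
  have "(LINT r|lborel. val_inner (h r) (cis (- c) *\<^sub>v ?g w r)) =
      cis (- c) * cj (s p) (LINT r|lborel. val_inner (h' r) (w r))"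
    by (simp add: val_inner_simps pairing)
  also have "\<dots> = cis (- c) * (?C * (LINT k:?Z|lborel. cj (s p) (cis (- (k \<bullet> R)) *
      (LINT r|lborel. val_inner (h' r) (psi' k r)))))"
    unfolding w' cj_mult[of _ ?C] cj_of_real set_lebesgue_integral_def cj_scaleR[symmetric] integral_cj ..
  also have "(LINT k:?Z|lborel. cj (s p) (cis (- (k \<bullet> R)) * (LINT r|lborel. val_inner (h' r) (psi' k r)))) =
      (LINT k:?Z|lborel. cis c * (cis (- (?T k \<bullet> ?R)) * Q (?T k)))"
    by (simp only: integrand)
  also have "\<dots> = cis c * (LINT k:?Z|lborel. cis (- (?T k \<bullet> ?R)) * Q (?T k))" by simp
  also have "(LINT k:?Z|lborel. cis (- (?T k \<bullet> ?R)) * Q (?T k)) = (LINT k:?Z|lborel. cis (- (k \<bullet> ?R)) * Q k)"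
    by (rule zone_integral_twisted[OF p, of "\<lambda>k. cis (- (k \<bullet> ?R)) * Q k"])
  finally have "(LINT r|lborel. val_inner (h r) (cis (- c) *\<^sub>v ?g w r)) =
      cis (- c) * (?C * (cis c * (LINT k:?Z|lborel. cis (- (k \<bullet> ?R)) * Q k)))" .
  also have "\<dots> = ?C * (LINT k:?Z|lborel. cis (- (k \<bullet> ?R)) * Q k)"
  proof -
    have "cis (- c) * (z * (cis c * y)) = z * y" for y z
      by (simp add: mult.left_commute[of z] mult.assoc[symmetric] cis_mult)
    then show ?thesis .
  qed
  finally show "(LINT r|lborel. val_inner (h r) (cis (- c) *\<^sub>v ?g w r)) =
      ?C * (LINT k:?Z|lborel. cis (- (k \<bullet> ?R)) * (LINT r|lborel. val_inner (h r) (psi' k r)))"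
    by (simp only: Q_def)
qed

lemma sites_eq: "sites BL 1 (\<lambda>_. site) = {site + R | R. R \<in> BL}"
  by (auto simp: sites_def)

text \<open>With a single site per cell, the point \<open>site + R\<close> determines its label
  \<open>R\<close>.\<close>

lemma site_space_eq:
  "site_space BL 1 (\<lambda>_. site) (\<lambda>_. 1) (\<lambda>_. psi') (site + R) =
    {f \<in> l2loc. R \<in> BL \<and> (\<exists>w. wannier BL psi' R w \<and> (\<exists>c. AE r in lborel. f r = c *\<^sub>v w r))}"
proof (intro subset_antisym subsetI)
  fix f assume "f \<in> site_space BL 1 (\<lambda>_. site) (\<lambda>_. 1) (\<lambda>_. psi') (site + R)"
  then obtain R' w where R': "R' \<in> BL" "site + R = site + R'" and w: "\<forall>\<alpha><1::nat. wannier BL psi' R' (w \<alpha>)"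
    and f: "f \<in> lspan {..<1::nat} w"
    unfolding site_space_def mem_Collect_eq by (elim exE conjE bexE) (rule that)
  obtain c where "f \<in> l2loc" "AE r in lborel. f r = c *\<^sub>v w 0 r"
    using f unfolding lessThan_1 lspan_singleton mem_Collect_eq by (elim exE conjE) (rule that)
  moreover have "R' = R" using R'(2) by simp
  moreover have "wannier BL psi' R' (w 0)" using w by simp
  ultimately show "f \<in> {f \<in> l2loc. R \<in> BL \<and> (\<exists>w. wannier BL psi' R w \<and> (\<exists>c. AE r in lborel. f r = c *\<^sub>v w r))}"
    using R'(1) by (intro CollectI conjI exI[of _ "w 0"] exI[of _ c]) simp_all
next
  fix f assume "f \<in> {f \<in> l2loc. R \<in> BL \<and> (\<exists>w. wannier BL psi' R w \<and> (\<exists>c. AE r in lborel. f r = c *\<^sub>v w r))}"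
  then obtain w c where fw: "f \<in> l2loc" "R \<in> BL" "wannier BL psi' R w" "AE r in lborel. f r = c *\<^sub>v w r"
    unfolding mem_Collect_eq by (elim exE conjE) (rule that)
  have "f \<in> lspan {..<1::nat} (\<lambda>_. w)"
    unfolding lessThan_1 lspan_singleton using fw(1,4) by (intro CollectI conjI exI)
  then show "f \<in> site_space BL 1 (\<lambda>_. site) (\<lambda>_. 1) (\<lambda>_. psi') (site + R)"
    unfolding site_space_def using fw(2,3)
    by (intro CollectI exI[of _ "0::nat"] conjI bexI[of _ R] exI[of _ "\<lambda>_. w"]) simp_all
qed

lemma ghat_site_space_subset:
  assumes g: "g \<in> carrier (space_group P BL pc)" and R: "R \<in> BL"
  shows "ghat P BL pc D g ` site_space BL 1 (\<lambda>_. site) (\<lambda>_. 1) (\<lambda>_. psi') (site + R) \<subseteq>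
    site_space BL 1 (\<lambda>_. site) (\<lambda>_. 1) (\<lambda>_. psi') (act pc g (site + R))"
proof (rule image_subsetI)
  obtain p R0 where g': "g = (p, R0)" "p \<in> carrier P" "R0 \<in> BL" using g by (cases g) (auto simp: space_carrier)
  let ?R = "pc p R + R0 + (pc p site - site)"
  have a: "act pc g (site + R) = site + ?R"
    using g' by (simp add: act_def linear_add[OF pc_linear])
  have RB: "?R \<in> BL" using g' R by (intro lattice_add pc_mem site_shift)
  fix f assume "f \<in> site_space BL 1 (\<lambda>_. site) (\<lambda>_. 1) (\<lambda>_. psi') (site + R)"
  then obtain w b where f: "f \<in> l2loc" and w: "wannier BL psi' R w" and b: "AE r in lborel. f r = b *\<^sub>v w r"
    unfolding site_space_eq by blast
  obtain c where c: "\<And>k. AE r in lborel. ghat P BL pc D (p, 0) (psi' k) r =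
      cis (c + s p * (k \<bullet> (pc (inv p) site - site))) *\<^sub>v psi' (s p *\<^sub>R pc p k) r"
    using ghat_psi'[OF g'(2)] by blast
  have "AE r in lborel. ghat P BL pc D (p, R0) f r = ghat P BL pc D (p, R0) (\<lambda>r. b *\<^sub>v w r) r"
    using g' b by (intro ghat_AE)
  then have "AE r in lborel. ghat P BL pc D g f r =
      (cj (s p) b * cis c) *\<^sub>v (cis (- c) *\<^sub>v ghat P BL pc D (p, R0) w r)"
    using g' by (simp add: ghat_scale val_scale_simps cis_mult mult.assoc)
  moreover have "ghat P BL pc D g f \<in> l2loc" unfolding g'(1) using g'(2,3) f by (rule ghat_l2loc)
  moreover note wannier_transformed[OF g'(2,3) w c]
  ultimately show "ghat P BL pc D g f \<in> site_space BL 1 (\<lambda>_. site) (\<lambda>_. 1) (\<lambda>_. psi') (act pc g (site + R))"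
    unfolding a site_space_eq using RB by (intro CollectI conjI exI)
qed

lemma act_sites_subset:
  assumes "g \<in> carrier (space_group P BL pc)" "x \<in> sites BL 1 (\<lambda>_. site)"
  shows "act pc g x \<in> sites BL 1 (\<lambda>_. site)"
proof -
  obtain p R0 where g': "g = (p, R0)" "p \<in> carrier P" "R0 \<in> BL"
    using assms(1) by (cases g) (auto simp: space_carrier)
  obtain R where x: "x = site + R" "R \<in> BL" using assms(2) unfolding sites_eq by blast
  have "act pc g x = site + (pc p R + R0 + (pc p site - site))"
    using g' x by (simp add: act_def linear_add[OF pc_linear])
  moreover have "pc p R + R0 + (pc p site - site) \<in> BL" using g' x by (intro lattice_add pc_mem site_shift)
  ultimately show ?thesis unfolding sites_eq by blast
qed

lemma band_representation: "band_representation P BL pc D E"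
  unfolding band_representation_def
proof (intro exI conjI ballI allI impI)
  \<comment> \<open>The data are one site per cell with one Wannier function: \<open>M = 1\<close>,
    \<open>A n = 1\<close>, and every \<open>\<omega> n\<close> equal to
    \<open>site\<close>.\<close>
  let ?S = "sites BL 1 (\<lambda>_. site)"
  let ?W = "site_space BL 1 (\<lambda>_. site) (\<lambda>_. 1) (\<lambda>_ :: nat \<times> nat. psi')"
  let ?J = "SIGMA n:{..<1::nat}. {..<1::nat}"
  have J: "?J = {(0, 0)}" by auto
  have "psi' k \<in> E k" for k
    unfolding E_psi' using psi'_l2loc by (auto intro!: exI[of _ 1] simp: val_scale_simps)
  then show "orthonormal_frame BL E ?J (\<lambda>_. psi')"
    unfolding orthonormal_frame_def J lspan_singleton by (auto simp: psi'_normalized E_psi')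
  show "analytic_frame BL ?J (\<lambda>_. psi')"
    unfolding analytic_frame_def real_analytic_in_iff using psi'_analytic by blast
  show "periodic_frame BL ?J (\<lambda>_. psi')"
    unfolding periodic_frame_def using psi'_periodic by blast
  fix g assume g: "g \<in> carrier (space_group P BL pc)"
  obtain p R0 where g': "g = (p, R0)" "p \<in> carrier P" "R0 \<in> BL" using g by (cases g) (auto simp: space_carrier)
  \<comment> \<open>The inverse of \<open>g\<close>; inclusions for \<open>g\<close> and for
    \<open>h\<close> combine to the required equalities.\<close>
  define h where "h = (inv p, - pc (inv p) R0)"
  have h: "h \<in> carrier (space_group P BL pc)"
    unfolding h_def using g' pc_mem[of "inv p" R0] lattice_uminus by (simp add: space_carrier)
  have act: "act pc g (act pc h x) = x" "act pc h (act pc g x) = x" for x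
    using g' by (simp_all add: act_def h_def linear_add[OF pc_linear] linear_diff[OF pc_linear] pc_inv_left pc_inv_right)
  show "act pc g ` ?S = ?S"
  proof (intro subset_antisym subsetI)
    fix x assume "x \<in> ?S"
    then have "act pc h x \<in> ?S" by (rule act_sites_subset[OF h])
    then have "act pc g (act pc h x) \<in> act pc g ` ?S" by (rule imageI)
    then show "x \<in> act pc g ` ?S" unfolding act(1) .
  qed (use act_sites_subset[OF g] in blast)
  fix x assume x: "x \<in> ?S"
  have sub: "ghat P BL pc D g ` ?W x \<subseteq> ?W (act pc g x)"
    if "g \<in> carrier (space_group P BL pc)" "x \<in> ?S" for g x
  proof -
    obtain R where "x = site + R" "R \<in> BL" using \<open>x \<in> ?S\<close> unfolding sites_eq by blast
    then show ?thesis using ghat_site_space_subset[OF that(1)] by simp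
  qed
  have "ghat P BL pc D h ` ?W (act pc g x) \<subseteq> ?W x"
    using sub[OF h act_sites_subset[OF g x]] unfolding act(2) .
  then have "ghat P BL pc D g ` (ghat P BL pc D h ` ?W (act pc g x)) \<subseteq> ghat P BL pc D g ` ?W x"
    by (rule image_mono)
  moreover have "ghat P BL pc D g (ghat P BL pc D h f) = f" for f :: "('d, 'v, 'm) wavefun"
    unfolding g'(1) h_def by (rule ghat_inverse(1)[OF g'(2,3)])
  ultimately have "?W (act pc g x) \<subseteq> ghat P BL pc D g ` ?W x"
    by (simp add: image_image)
  with sub[OF g x] show "ghat P BL pc D g ` ?W x = ?W (act pc g x)" by (rule subset_antisym)
qed simp_all

end

section \<open>Localizable bands of rank at most one\<close>

lemma (in magnetic_space_group) localizable_imp_band_representation: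
  fixes E :: "real^'d \<Rightarrow> ('d, 'v, 'm::finite) wavefun set"
  assumes "band P BL pc s D 1 E" "localizable BL 1 E"
  shows "band_representation P BL pc D E"
proof -
  obtain \<psi> where f: "orthonormal_frame BL E {..<1::nat} \<psi>" and a: "analytic_frame BL {..<1::nat} \<psi>"
    and p: "periodic_frame BL {..<1::nat} \<psi>"
    using assms(2) unfolding localizable_def by blast
  interpret localized_simple_band P BL pc s D E "\<psi> 0"
  proof
    show "band P BL pc s D 1 E" by (rule assms)
    show "cell_inner BL (\<psi> 0 k) (\<psi> 0 k) = 1" "\<psi> 0 k \<in> E k" for k
      using f unfolding orthonormal_frame_def lessThan_1 by auto
    show "E k = {f \<in> l2loc. \<exists>c. AE r in lborel. f r = c *\<^sub>v \<psi> 0 k r}" for k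
      using f unfolding orthonormal_frame_def lessThan_1 lspan_singleton by blast
    show "analytic_near (bloch BL 0) (cell_norm BL) (\<lambda>k. phase (- k) (\<psi> 0 k)) k0" for k0
      using a unfolding analytic_frame_def lessThan_1 real_analytic_in_iff by blast
    show "AE r in lborel. \<psi> 0 (k + K) r = \<psi> 0 k r" if "K \<in> reciprocal_lattice BL" for k K
      using p that unfolding periodic_frame_def lessThan_1 by blast
  qed
  show ?thesis by (rule band_representation)
qed

text \<open>The empty set of sites serves. It removes rank 0 from the localizable topological bands,
  so that excluding rank 1 yields the lower bound 2.\<close>

lemma (in magnetic_space_group) rank_zero_band_representation:
  fixes E :: "real^'d \<Rightarrow> ('d, 'v, 'm::finite) wavefun set"
  assumes "band P BL pc s D 0 E"
  shows "band_representation P BL pc D E"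
  unfolding band_representation_def
proof (intro exI conjI ballI allI impI)
  have "E k = {f \<in> l2loc. AE r in lborel. f r = 0}" for k
    using assms unfolding band_def has_cdim_def by (auto simp: lspan_def)
  then show "orthonormal_frame BL E (SIGMA n:{..<0::nat}. {..<0::nat}) (\<lambda>_ _. undefined)"
    by (simp add: orthonormal_frame_def lspan_def)
qed (auto simp: sites_def site_space_def analytic_frame_def periodic_frame_def)

subsection \<open>Trigonometric approximation of periodic functions\<close>

context lattice_basis
begin

text \<open>Embeds the quotient by \<open>L\<close> into a Euclidean space: continuous periodic
  functions become functions on a compact set, and polynomials there become trigonometric
  polynomials.\<close>

definition torus :: "real^'d \<Rightarrow> complex^'d" where
  "torus k = (\<chi> i. cis (2 * pi * (A' *v k) $ i))"

lemma torus_continuous: "continuous_on S torus"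
proof -
  have "continuous_on S (\<lambda>k. (A' *v k) $ i)" for i
    by (intro continuous_intros linear_continuous_on matrix_vector_mul_bounded_linear)
  then show ?thesis unfolding torus_def by (intro continuous_on_vec_lambda continuous_intros)
qed

lemma torus_eq_iff: "torus k = torus k' \<longleftrightarrow> k - k' \<in> L"
proof -
  have "cis (2 * pi * x) = cis (2 * pi * y) \<longleftrightarrow> (\<exists>n::int. x - y = of_int n)" for x y
  proof -
    have "cis (2 * pi * x) = cis (2 * pi * y) \<longleftrightarrow> cis (2 * pi * (x - y)) = 1"
      by (auto simp: right_diff_distrib cis_divide[symmetric])
    also have "\<dots> \<longleftrightarrow> (\<exists>n::int. x - y = of_int n)"
      unfolding cis_eq_1_iff by simp
    finally show ?thesis .
  qed
  then show ?thesis
    by (simp add: torus_def vec_eq_iff mem_iff matrix_vector_mult_diff_distrib)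
qed

text \<open>The real coordinates of the embedding are cosines and sines of linear functions.\<close>

lemma canalytic_torus_polynomial:
  assumes "real_polynomial_function q"
  shows "canalytic (\<lambda>k. of_real (q (torus k))) k0"
  using assms
proof (induction rule: real_polynomial_function.induct)
  case (linear l)
  interpret bounded_linear l by (rule linear)
  have lin: "linear (\<lambda>k. 2 * pi * (A' *v k) $ i)" for i
    by (intro linearI) (simp_all add: matrix_vector_right_distrib matrix_vector_mult_scaleR algebra_simps)
  have "canalytic (\<lambda>k. cos (of_real (2 * pi * (A' *v k) $ i))) k0" "canalytic (\<lambda>k. sin (of_real (2 * pi * (A' *v k) $ i))) k0" for i
    by (rule canalytic_holomorphic_comp[OF _ zero_less_one canalytic_linear[OF lin]]; intro holomorphic_intros)+
  then have "canalytic (\<lambda>k. \<Sum>i\<in>UNIV. of_real (l (axis i 1)) * cos (of_real (2 * pi * (A' *v k) $ i))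
      + of_real (l (axis i \<i>)) * sin (of_real (2 * pi * (A' *v k) $ i))) k0"
    by (intro cnorm.analytic_near_sum cnorm.analytic_near_add canalytic_mult cnorm.analytic_near_const) auto
  moreover have "l (torus k) = (\<Sum>i\<in>UNIV. l (axis i 1) * cos (2 * pi * (A' *v k) $ i)
      + l (axis i \<i>) * sin (2 * pi * (A' *v k) $ i))" for k
  proof -
    have "torus k = (\<Sum>i\<in>UNIV. cos (2 * pi * (A' *v k) $ i) *\<^sub>R axis i 1 + sin (2 * pi * (A' *v k) $ i) *\<^sub>R axis i \<i>)"
      by (simp add: vec_eq_iff torus_def axis_def complex_eq_iff if_distrib cong: if_cong)
    then show ?thesis by (simp add: sum add scale mult.commute)
  qed
  ultimately show ?case by (simp add: cos_of_real[symmetric] sin_of_real[symmetric])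
next
  case (const c)
  show ?case by (rule cnorm.analytic_near_const) simp
next
  case (add f g)
  then show ?case using cnorm.analytic_near_add[OF add.IH] by simp
next
  case (mult f g)
  then show ?case using canalytic_mult[OF mult.IH] by simp
qed

text \<open>Stone-Weierstrass on the embedded torus, applied to the function \<open>F\<close>
  through which \<open>c\<close> factors.\<close>

lemma periodic_approximation:
  fixes c :: "real^'d \<Rightarrow> complex"
  assumes c: "continuous_on UNIV c" and per: "\<And>k K. K \<in> L \<Longrightarrow> c (k + K) = c k" and e: "0 < e"
  shows "\<exists>t. (\<forall>k0. canalytic t k0) \<and> (\<forall>k. \<forall>K\<in>L. t (k + K) = t k) \<and> (\<forall>k. cmod (c k - t k) < e)"
proof -
  let ?Q = "unit_cell L"
  define F where "F y = c (SOME k. torus k = y)" for y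
  have F: "F (torus k) = c k" for k
  proof -
    have "torus (SOME k'. torus k' = torus k) = torus k" by (rule someI_ex) blast
    then have "(SOME k'. torus k' = torus k) - k \<in> L" by (simp add: torus_eq_iff)
    from per[OF this, of k] show ?thesis by (simp add: F_def)
  qed
  have surj: "\<exists>q\<in>?Q. torus q = torus k" for k
  proof -
    obtain R where "R \<in> L" "k - R \<in> ?Q" using unit_cell_cover by blast
    then show ?thesis using uminus_mem[of R] by (intro bexI[of _ "k - R"]) (simp_all add: torus_eq_iff)
  qed
  have comp: "compact (torus ` ?Q)" by (intro compact_continuous_image torus_continuous unit_cell_compact)
  \<comment> \<open>On the compact cell \<open>torus\<close> is a closed map, hence a quotient map
    onto its image, so \<open>F\<close> inherits continuity from \<open>c\<close>.\<close>
  have "continuous_on (torus ` ?Q) F"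
    unfolding continuous_on_closed_vimage[OF compact_imp_closed[OF comp]]
  proof (intro allI impI)
    fix B :: "complex set" assume "closed B"
    then have "closed (c -` B)" using c continuous_closed_vimage by (auto simp: continuous_on_eq_continuous_at)
    then have "compact (?Q \<inter> c -` B)" by (intro compact_Int_closed unit_cell_compact)
    then have "compact (torus ` (?Q \<inter> c -` B))" by (intro compact_continuous_image torus_continuous)
    moreover have "torus ` (?Q \<inter> c -` B) = F -` B \<inter> torus ` ?Q" by (auto simp: F)
    ultimately show "closed (F -` B \<inter> torus ` ?Q)" by (simp add: compact_imp_closed)
  qed
  from Stone_Weierstrass_polynomial_function[OF comp this e]
  obtain g where g: "polynomial_function g" "\<And>y. y \<in> torus ` ?Q \<Longrightarrow> norm (F y - g y) < e"
    by (elim exE conjE) (rule that, auto)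
  have "real_polynomial_function (Re \<circ> g)" "real_polynomial_function (Im \<circ> g)"
    using g(1) bounded_linear_Re bounded_linear_Im unfolding polynomial_function_def by blast+
  note this[THEN canalytic_torus_polynomial]
  then have "canalytic (\<lambda>k. of_real ((Re \<circ> g) (torus k)) + \<i> * of_real ((Im \<circ> g) (torus k))) k0" for k0
    by (intro cnorm.analytic_near_add canalytic_mult cnorm.analytic_near_const) auto
  then have "canalytic (\<lambda>k. g (torus k)) k0" for k0
    by (simp add: complex_eq[symmetric])
  moreover have "torus (k + K) = torus k" if "K \<in> L" for k K
    using that by (simp add: torus_eq_iff)
  moreover have "cmod (c k - g (torus k)) < e" for k
  proof -
    obtain q where "q \<in> ?Q" "torus q = torus k" using surj by blast
    then show ?thesis using g(2)[of "torus k"] F[of k] by (metis image_eqI)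
  qed
  ultimately show ?thesis by (intro exI[of _ "\<lambda>k. g (torus k)"]) auto
qed

end

subsection \<open>The exponential series in several variables\<close>

text \<open>A finite set of exponents lies in a box, over which the sum factorizes into partial sums
  of the exponential series, each at most \<open>exp b\<close>.\<close>

lemma exp_coefficients_summable:
  fixes b :: real
  assumes "0 \<le> b"
  shows "(\<lambda>\<alpha>::'d::finite \<Rightarrow> nat. \<Prod>i\<in>UNIV. b ^ \<alpha> i / fact (\<alpha> i)) summable_on UNIV"
proof (rule nonneg_bdd_above_summable_on)
  show "bdd_above (sum (\<lambda>\<alpha>::'d \<Rightarrow> nat. \<Prod>i\<in>UNIV. b ^ \<alpha> i / fact (\<alpha> i)) ` {F. F \<subseteq> UNIV \<and> finite F})"
  proof (intro bdd_aboveI2[where M="exp b ^ CARD('d)"])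
    fix F :: "('d \<Rightarrow> nat) set" assume "F \<in> {F. F \<subseteq> UNIV \<and> finite F}"
    then have F: "finite F" by simp
    \<comment> \<open>A bound above all exponents in \<open>F\<close>; the inserted 0 covers empty
      \<open>F\<close>.\<close>
    define N where "N = Suc (Max (insert 0 ((\<lambda>(\<alpha>, i). \<alpha> i) ` (F \<times> UNIV))))"
    have "\<alpha> i < N" if "\<alpha> \<in> F" for \<alpha> i
    proof -
      have "\<alpha> i \<in> (\<lambda>(\<alpha>, i). \<alpha> i) ` (F \<times> UNIV)" using that by force
      then show ?thesis unfolding N_def using F by (intro le_imp_less_Suc Max_ge) auto
    qed
    then have "F \<subseteq> PiE UNIV (\<lambda>_. {..<N})" by auto
    then have "(\<Sum>\<alpha>\<in>F. \<Prod>i\<in>UNIV. b ^ \<alpha> i / fact (\<alpha> i)) \<le> (\<Sum>\<alpha>\<in>PiE (UNIV::'d set) (\<lambda>_. {..<N}). \<Prod>i\<in>UNIV. b ^ \<alpha> i / fact (\<alpha> i))"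
      using assms by (intro sum_mono2) (auto intro!: finite_PiE prod_nonneg)
    also have "\<dots> = (\<Prod>i\<in>(UNIV::'d set). \<Sum>n<N. b ^ n / fact n)"
      by (rule prod_sum_PiE[symmetric]) auto
    also have "\<dots> \<le> (\<Prod>i\<in>(UNIV::'d set). exp b)"
    proof (intro prod_mono conjI)
      have "summable (\<lambda>n. b ^ n / fact n)" using summable_exp[of b] by (simp add: divide_inverse mult.commute)
      then have "(\<Sum>n<N. b ^ n / fact n) \<le> (\<Sum>n. b ^ n / fact n)"
        using assms by (intro sum_le_suminf) auto
      then show "(\<Sum>n<N. b ^ n / fact n) \<le> exp b" by (simp add: exp_def divide_inverse mult.commute)
    qed (use assms in \<open>auto intro!: sum_nonneg\<close>)
    finally show "(\<Sum>\<alpha>\<in>F. \<Prod>i\<in>UNIV. b ^ \<alpha> i / fact (\<alpha> i)) \<le> exp b ^ CARD('d)" by simp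
  qed
qed (use assms in \<open>auto intro!: prod_nonneg\<close>)

lemma exp_coefficients_abs:
  fixes z :: "'d::finite \<Rightarrow> complex"
  assumes "\<And>i. cmod (z i) \<le> b"
  shows "cmod (\<Prod>i\<in>UNIV. z i ^ \<alpha> i / fact (\<alpha> i)) \<le> (\<Prod>i\<in>UNIV. b ^ \<alpha> i / fact (\<alpha> i))"
  unfolding prod_norm[symmetric] using assms
  by (intro prod_mono) (auto simp: norm_divide norm_power intro!: divide_right_mono power_mono)

lemma exp_multiseries:
  fixes z :: "'d::finite \<Rightarrow> complex"
  assumes z: "\<And>i. cmod (z i) \<le> b"
  shows "((\<lambda>\<alpha>. \<Prod>i\<in>UNIV. z i ^ \<alpha> i / fact (\<alpha> i)) has_sum exp (\<Sum>i\<in>UNIV. z i)) UNIV"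
proof -
  have b: "0 \<le> b" using z[of undefined] norm_ge_zero order_trans by blast
  have "(\<lambda>\<alpha>. cmod (\<Prod>i\<in>UNIV. z i ^ \<alpha> i / fact (\<alpha> i))) summable_on UNIV"
    by (rule summable_on_comparison_test[OF exp_coefficients_summable[OF b]]) (auto intro: exp_coefficients_abs[OF z])
  then have s: "(\<lambda>\<alpha>. \<Prod>i\<in>UNIV. z i ^ \<alpha> i / fact (\<alpha> i)) summable_on UNIV"
    by (rule abs_summable_summable)
  have one: "((\<lambda>n. w ^ n / fact n) has_sum exp w) UNIV" "(\<lambda>n. norm (w ^ n / fact n)) summable_on UNIV" for w :: complex
  proof -
    have sn: "summable (\<lambda>n. norm (w ^ n / fact n))"
      using summable_norm_exp[of w] by (simp add: scaleR_conv_of_real divide_inverse mult.commute norm_mult norm_inverse norm_power)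
    have "(\<lambda>n. w ^ n / fact n) sums exp w"
      using exp_converges[of w] by (simp add: scaleR_conv_of_real divide_inverse mult.commute)
    then show "((\<lambda>n. w ^ n / fact n) has_sum exp w) UNIV" using sn by (intro norm_summable_imp_has_sum)
    show "(\<lambda>n. norm (w ^ n / fact n)) summable_on UNIV"
      using sn by (intro summable_nonneg_imp_summable_on) auto
  qed
  \<comment> \<open>The absolutely convergent series in one variable multiply out to the sum over
    all exponents.\<close>
  have "infsum (\<lambda>\<alpha>. \<Prod>i\<in>UNIV. z i ^ \<alpha> i / fact (\<alpha> i)) (PiE UNIV (\<lambda>_. UNIV)) = (\<Prod>i\<in>UNIV. \<Sum>\<^sub>\<infinity>n. z i ^ n / fact n)"
    by (rule infsum_prod_PiE_abs) (use one(2) in auto)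
  also have "\<dots> = exp (\<Sum>i\<in>UNIV. z i)"
    by (simp add: infsumI[OF one(1)] exp_sum)
  finally show ?thesis using has_sum_infsum[OF s] by (simp add: PiE_UNIV_domain)
qed

text \<open>The error bound depends on \<open>b\<close> but not on \<open>z\<close>. It is applied
  at each point \<open>r\<close> separately, and this uniformity turns it into convergence in the
  cell norm.\<close>

lemma exp_multiseries_error:
  fixes z :: "'d::finite \<Rightarrow> complex"
  assumes z: "\<And>i. cmod (z i) \<le> b" and F: "finite F"
  shows "cmod (exp (\<Sum>i\<in>UNIV. z i) - (\<Sum>\<alpha>\<in>F. \<Prod>i\<in>UNIV. z i ^ \<alpha> i / fact (\<alpha> i))) \<le>
    (\<Sum>\<^sub>\<infinity>\<alpha>::'d \<Rightarrow> nat. \<Prod>i\<in>UNIV. b ^ \<alpha> i / fact (\<alpha> i)) - (\<Sum>\<alpha>\<in>F. \<Prod>i\<in>UNIV. b ^ \<alpha> i / fact (\<alpha> i))"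
proof -
  let ?e = "\<lambda>\<alpha>. \<Prod>i\<in>UNIV. z i ^ \<alpha> i / fact (\<alpha> i)" and ?b = "\<lambda>\<alpha>::'d \<Rightarrow> nat. \<Prod>i\<in>UNIV. b ^ \<alpha> i / fact (\<alpha> i)"
  have b: "0 \<le> b" using z[of undefined] norm_ge_zero order_trans by blast
  have s: "?b summable_on UNIV" by (rule exp_coefficients_summable[OF b])
  have lim: "((\<lambda>G. cmod (sum ?e G - sum ?e F)) \<longlongrightarrow> cmod (exp (\<Sum>i\<in>UNIV. z i) - sum ?e F)) (finite_subsets_at_top UNIV)"
    using exp_multiseries[OF z] unfolding has_sum_def by (intro tendsto_intros)
  have "cmod (sum ?e G - sum ?e F) \<le> infsum ?b UNIV - sum ?b F" if "finite G" "F \<subseteq> G" for G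
  proof -
    have "cmod (sum ?e G - sum ?e F) = cmod (sum ?e (G - F))"
      using that F by (simp add: sum_diff)
    also have "\<dots> \<le> sum ?b (G - F)"
      by (intro order_trans[OF norm_sum] sum_mono exp_coefficients_abs z)
    also have "\<dots> = sum ?b G - sum ?b F" using that F by (simp add: sum_diff)
    also have "\<dots> \<le> infsum ?b UNIV - sum ?b F"
      using s that b by (intro diff_right_mono finite_sum_le_infsum) (auto intro!: prod_nonneg)
    finally show ?thesis .
  qed
  then have ev: "\<forall>\<^sub>F G in finite_subsets_at_top UNIV. cmod (sum ?e G - sum ?e F) \<le> infsum ?b UNIV - sum ?b F"
    unfolding eventually_finite_subsets_at_top using F by (intro exI[of _ F]) simp
  show ?thesis by (rule tendsto_upperbound[OF lim ev]) simp
qed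

subsection \<open>Analytic families of periodic functions\<close>

context lattice_basis
begin

text \<open>\<open>twist w k\<close> moves a periodic function \<open>w\<close> to wavevector \<open>k\<close> by a phase that is linear on
  the fundamental domain of \<open>red\<close>, so that \<open>phase k (twist w k)\<close> is periodic in \<open>k\<close>.\<close>

definition twist :: "('d, 'v::finite, 'm::finite) wavefun \<Rightarrow> real^'d \<Rightarrow> ('d, 'v, 'm) wavefun" where
  "twist w k = (\<lambda>r. cis (- (k \<bullet> red r)) *\<^sub>v w r)"

lemma bloch_mult:
  assumes "f \<in> bloch L k" "c \<in> borel_measurable borel" "\<And>r. cmod (c r) \<le> K" "\<And>r R. R \<in> L \<Longrightarrow> c (r + R) = c r"
  shows "(\<lambda>r. c r *\<^sub>v f r) \<in> bloch L k"
proof (rule blochI)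
  show "(\<lambda>r. c r *\<^sub>v f r) \<in> l2loc" using assms(2,3) blochD(1)[OF assms(1)] by (intro l2loc_mult)
  fix R assume R: "R \<in> L"
  from blochD(2)[OF assms(1) R]
  show "AE r in lborel. c (r + R) *\<^sub>v f (r + R) = cis (k \<bullet> R) *\<^sub>v c r *\<^sub>v f r"
    by eventually_elim (simp add: assms(4)[OF R] val_scale_simps mult.commute)
qed

lemma cell_norm_mult_le:
  assumes f: "f \<in> l2loc" and c: "c \<in> borel_measurable borel" "\<And>r. cmod (c r) \<le> K"
  shows "cell_norm L (\<lambda>r. c r *\<^sub>v f r) \<le> K * cell_norm L f"
proof -
  have K: "0 \<le> K" using c(2)[of 0] norm_ge_zero order_trans by blast
  have "(LINT r:unit_cell L|lborel. (norm (c r *\<^sub>v f r))\<^sup>2) \<le> (LINT r:unit_cell L|lborel. K\<^sup>2 * (norm (f r))\<^sup>2)"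
  proof (rule set_integral_mono)
    show "set_integrable lborel (unit_cell L) (\<lambda>r. (norm (c r *\<^sub>v f r))\<^sup>2)"
      by (intro cell_integrable_square l2loc_mult[OF f c])
    show "set_integrable lborel (unit_cell L) (\<lambda>r. K\<^sup>2 * (norm (f r))\<^sup>2)"
      using cell_integrable_square[OF f] by simp
    show "(norm (c r *\<^sub>v f r))\<^sup>2 \<le> K\<^sup>2 * (norm (f r))\<^sup>2" for r
      using c(2)[of r] by (auto simp: norm_val_scale power_mult_distrib intro!: mult_right_mono power_mono)
  qed
  also have "\<dots> = K\<^sup>2 * (LINT r:unit_cell L|lborel. (norm (f r))\<^sup>2)" by simp
  finally show ?thesis
    unfolding cell_norm_def using K real_sqrt_le_mono by (fastforce simp: real_sqrt_mult)
qed

lemma red_component_measurable: "(\<lambda>r. red r $ i) \<in> borel_measurable borel"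
  using borel_measurable_continuous_onI[OF continuous_on_component[OF continuous_on_id]]
  by (rule measurable_compose[OF red_measurable])

lemma cis_red_measurable: "(\<lambda>r. cis (- (k \<bullet> red r))) \<in> borel_measurable borel"
  by (rule measurable_compose[OF red_measurable, of "\<lambda>r. cis (- (k \<bullet> r))"])
     (intro borel_measurable_continuous_onI continuous_intros)

lemma twist_bloch: "w \<in> bloch L q \<Longrightarrow> twist w k \<in> bloch L q"
  unfolding twist_def by (erule bloch_mult[where K=1, OF _ cis_red_measurable]) (auto simp: red_add)

lemma twist_add: "twist w (k + q) = twist (twist w k) q"
  by (simp add: twist_def fun_eq_iff val_scale_simps cis_mult inner_add_left add.commute)

lemma cell_norm_twist: "cell_norm L (twist w k) = cell_norm L w"
  by (simp add: cell_norm_def twist_def norm_val_scale)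

text \<open>\<open>r - red r\<close> is a lattice vector, so pairing with a reciprocal vector cannot
  tell \<open>red r\<close> from \<open>r\<close> modulo \<open>2 * pi\<close>.\<close>

lemma twist_reciprocal:
  assumes "K \<in> reciprocal_lattice L"
  shows "twist w (k + K) = phase (- K) (twist w k)"
proof -
  have "cis (- (K \<bullet> red r)) = cis (- (K \<bullet> r))" for r
  proof -
    obtain n :: int where "K \<bullet> (r - red r) = 2 * pi * of_int n"
      using assms red_diff[of r] unfolding reciprocal_lattice_def by blast
    then have "cis (K \<bullet> r - K \<bullet> red r) = 1" unfolding cis_eq_1_iff by (auto simp: inner_diff_right)
    then have "cis (- (K \<bullet> r)) * cis (K \<bullet> r - K \<bullet> red r) = cis (- (K \<bullet> r))" by simp
    then show ?thesis by (simp add: cis_mult)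
  qed
  then have "cis (- (K \<bullet> red r)) *\<^sub>v twist w k r = cis (- (K \<bullet> r)) *\<^sub>v twist w k r" for r by simp
  then show ?thesis unfolding twist_add by (simp add: twist_def[of _ K] phase_def fun_eq_iff)
qed

text \<open>The exponential is expanded in the components of \<open>k - k0\<close>. As
  \<open>red\<close> is bounded and periodic, the coefficients arise from \<open>v\<close> by
  multiplication with bounded periodic functions and are again Bloch functions; with
  \<open>r\<close> in place of \<open>red r\<close> both properties would fail.\<close>

lemma twist_analytic:
  assumes "w \<in> bloch L q"
  shows "analytic_near (bloch L q) (cell_norm L) (twist w) k0"
proof -
  define v where "v = twist w k0"
  have v: "v \<in> bloch L q" "v \<in> l2loc" unfolding v_def using twist_bloch[OF assms] blochD(1) by auto
  obtain b where b: "0 < b" "\<And>x. norm (red x) \<le> b" using red_bounded by blast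
  have comp: "\<bar>red r $ i\<bar> \<le> b" for r i using component_le_norm_cart b(2) order_trans by blast
  let ?b = "\<lambda>\<alpha>::'d \<Rightarrow> nat. \<Prod>i\<in>UNIV. b ^ \<alpha> i / fact (\<alpha> i)"
  \<comment> \<open>The Taylor coefficient of \<open>cis (- (x \<bullet> red r))\<close> in
    \<open>x\<close> at exponent \<open>\<alpha>\<close>.\<close>
  define m where "m \<alpha> r = (\<Prod>i\<in>UNIV. (- \<i> * of_real (red r $ i)) ^ \<alpha> i / fact (\<alpha> i))" for \<alpha> :: "'d \<Rightarrow> nat" and r
  define a where "a \<alpha> = (\<lambda>r. m \<alpha> r *\<^sub>v v r)" for \<alpha>
  have mm: "m \<alpha> \<in> borel_measurable borel" for \<alpha>
    unfolding m_def
    by (intro borel_measurable_prod borel_measurable_divide borel_measurable_power borel_measurable_times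
        borel_measurable_const measurable_compose[OF red_component_measurable borel_measurable_of_real])
  have mb: "cmod (m \<alpha> r) \<le> ?b \<alpha>" for \<alpha> r
    unfolding m_def using comp by (intro exp_coefficients_abs) (simp add: norm_mult)
  have aS: "a \<alpha> \<in> bloch L q" for \<alpha>
    unfolding a_def using v(1) mm mb by (rule bloch_mult) (simp add: m_def red_add)
  have an: "cell_norm L (a \<alpha>) \<le> ?b \<alpha> * cell_norm L v" for \<alpha>
    unfolding a_def using v(2) mm mb by (rule cell_norm_mult_le)
  have bs: "?b summable_on UNIV" using b by (intro exp_coefficients_summable) simp
  have "expansion (bloch L q) (cell_norm L) 1 (\<lambda>x. twist w (k0 + x)) a"
  proof (rule expansionI)
    show "(\<lambda>\<alpha>. cell_norm L (a \<alpha>) * 1 ^ deg \<alpha>) summable_on UNIV"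
      using an by (intro summable_on_comparison_test[OF summable_on_cmult_left[OF bs, of "cell_norm L v"]])
        (auto simp: cell_norm_nonneg)
    fix x :: "real^'d" assume x: "\<And>i. \<bar>x $ i\<bar> < 1"
    let ?tail = "\<lambda>F. (infsum ?b UNIV - sum ?b F) * cell_norm L v"
    have bound: "cell_norm L (twist w (k0 + x) - (\<Sum>\<alpha>\<in>F. mpow x \<alpha> *\<^sub>R a \<alpha>)) \<le> ?tail F" if F: "finite F" for F
    proof -
      define z where "z r i = - \<i> * of_real (x $ i * red r $ i)" for r i
      have zb: "cmod (z r i) \<le> b" for r i
      proof -
        have "\<bar>x $ i\<bar> * \<bar>red r $ i\<bar> \<le> 1 * b" using x[of i] comp by (intro mult_mono) auto
        then show ?thesis by (simp add: z_def norm_mult abs_mult)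
      qed
      let ?e = "\<lambda>r. exp (\<Sum>i\<in>UNIV. z r i) - (\<Sum>\<alpha>\<in>F. \<Prod>i\<in>UNIV. z r i ^ \<alpha> i / fact (\<alpha> i))"
      have zc: "exp (\<Sum>i\<in>UNIV. z r i) = cis (- (x \<bullet> red r))" for r
      proof -
        have "(\<Sum>i\<in>UNIV. z r i) = \<i> * of_real (- (x \<bullet> red r))"
          by (simp add: z_def inner_vec_def sum_negf sum_distrib_left)
        then show ?thesis by (simp add: cis_conv_exp)
      qed
      have zm: "(\<Prod>i\<in>UNIV. z r i ^ \<alpha> i / fact (\<alpha> i)) = of_real (mpow x \<alpha>) * m \<alpha> r" for r \<alpha>
      proof -
        have "z r i = of_real (x $ i) * (- \<i> * of_real (red r $ i))" for i by (simp add: z_def)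
        then show ?thesis
          unfolding m_def mpow_def of_real_prod prod.distrib[symmetric]
          by (intro prod.cong refl) (simp only: power_mult_distrib of_real_power times_divide_eq_right)
      qed
      have "twist w (k0 + x) - (\<Sum>\<alpha>\<in>F. mpow x \<alpha> *\<^sub>R a \<alpha>) = (\<lambda>r. ?e r *\<^sub>v v r)"
      proof
        fix r
        have "(\<Sum>\<alpha>\<in>F. mpow x \<alpha> *\<^sub>R a \<alpha>) r = (\<Sum>\<alpha>\<in>F. of_real (mpow x \<alpha>) * m \<alpha> r) *\<^sub>v v r"
          using F by (induction F rule: finite_induct)
            (simp_all add: val_scale_simps a_def scaleR_fun_def scaleR_eq_val_scale)
        then show "(twist w (k0 + x) - (\<Sum>\<alpha>\<in>F. mpow x \<alpha> *\<^sub>R a \<alpha>)) r = ?e r *\<^sub>v v r"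
          unfolding zm zc by (simp add: twist_add v_def[symmetric] twist_def[of v] val_eqI algebra_simps)
      qed
      moreover have "?e \<in> borel_measurable borel"
        unfolding zm zc
        by (intro borel_measurable_diff borel_measurable_sum borel_measurable_times borel_measurable_const mm cis_red_measurable)
      then have "cell_norm L (\<lambda>r. ?e r *\<^sub>v v r) \<le> (infsum ?b UNIV - sum ?b F) * cell_norm L v"
        using v(2) exp_multiseries_error[OF zb F] by (intro cell_norm_mult_le)
      ultimately show ?thesis by simp
    qed
    have "((\<lambda>F. ?tail F) \<longlongrightarrow> (infsum ?b UNIV - infsum ?b UNIV) * cell_norm L v) (finite_subsets_at_top UNIV)"
      using has_sum_infsum[OF bs] unfolding has_sum_def by (intro tendsto_intros)
    then have lim: "(?tail \<longlongrightarrow> 0) (finite_subsets_at_top UNIV)" by simp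
    show "((\<lambda>F. cell_norm L (twist w (k0 + x) - (\<Sum>\<alpha>\<in>F. mpow x \<alpha> *\<^sub>R a \<alpha>))) \<longlongrightarrow> 0) (finite_subsets_at_top UNIV)"
    proof (rule tendsto_sandwich[OF _ _ tendsto_const lim])
      show "\<forall>\<^sub>F F in finite_subsets_at_top UNIV. cell_norm L (twist w (k0 + x) - (\<Sum>\<alpha>\<in>F. mpow x \<alpha> *\<^sub>R a \<alpha>)) \<le> ?tail F"
        unfolding eventually_finite_subsets_at_top using bound by (intro exI[of _ "{}"]) simp
    qed (simp add: cell_norm_nonneg)
  qed (rule aS)
  then show ?thesis unfolding analytic_near_def normal_series_def by (intro exI[of _ 1]) auto
qed

end

subsection \<open>Bounded operators\<close>

context lattice_basis
begin

lemma bounded_opsD: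
  fixes T :: "('d, 'v::finite, 'm::finite) wavefun \<Rightarrow> ('d, 'v, 'm) wavefun"
  assumes "T \<in> bounded_ops L"
  shows "f \<in> bloch L 0 \<Longrightarrow> T f \<in> bloch L 0"
    "f \<in> bloch L 0 \<Longrightarrow> g \<in> bloch L 0 \<Longrightarrow> AE r in lborel. T (f + g) r = T f r + T g r"
    "f \<in> bloch L 0 \<Longrightarrow> AE r in lborel. T (\<lambda>x. c *\<^sub>v f x) r = c *\<^sub>v T f r"
    "\<exists>C. \<forall>f\<in>bloch L 0. cell_norm L (T f) \<le> C * cell_norm L f"
  using assms by (simp_all add: bounded_ops_def plus_fun_def)

lemma op_norm_bdd:
  fixes T :: "('d, 'v::finite, 'm::finite) wavefun \<Rightarrow> ('d, 'v, 'm) wavefun"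
  assumes "T \<in> bounded_ops L"
  shows "bdd_above ((\<lambda>f. cell_norm L (T f)) ` {f \<in> bloch L 0. cell_norm L f \<le> 1})"
proof -
  obtain C where C: "\<And>f. f \<in> bloch L 0 \<Longrightarrow> cell_norm L (T f) \<le> C * cell_norm L f"
    using bounded_opsD(4)[OF assms] by blast
  have "cell_norm L (T f) \<le> \<bar>C\<bar>" if "f \<in> bloch L 0" "cell_norm L f \<le> 1" for f
  proof -
    have "cell_norm L (T f) \<le> C * cell_norm L f" using that by (intro C)
    also have "\<dots> \<le> \<bar>C\<bar> * 1" using that cell_norm_nonneg by (intro mult_mono) auto
    finally show ?thesis by simp
  qed
  then show ?thesis by (intro bdd_aboveI2[where M="\<bar>C\<bar>"]) auto
qed

lemma cell_norm_le_op_norm: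
  fixes T :: "('d, 'v::finite, 'm::finite) wavefun \<Rightarrow> ('d, 'v, 'm) wavefun"
  assumes "T \<in> bounded_ops L" "f \<in> bloch L 0" "cell_norm L f \<le> 1"
  shows "cell_norm L (T f) \<le> op_norm L T"
  unfolding op_norm_def using assms by (intro cSUP_upper op_norm_bdd) auto

lemma op_norm_least:
  fixes T :: "('d, 'v::finite, 'm::finite) wavefun \<Rightarrow> ('d, 'v, 'm) wavefun"
  assumes "\<And>f. f \<in> bloch L 0 \<Longrightarrow> cell_norm L f \<le> 1 \<Longrightarrow> cell_norm L (T f) \<le> b"
  shows "op_norm L T \<le> b"
proof -
  have "cell_norm L (0 :: ('d, 'v, 'm) wavefun) = 0"
    by (rule seminormed.nrm_zero[OF seminormed_bloch])
  then have "0 \<in> {f \<in> bloch L 0. cell_norm L (f :: ('d, 'v, 'm) wavefun) \<le> 1}" by (simp add: bloch_zero)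
  then show ?thesis unfolding op_norm_def using assms by (intro cSUP_least) auto
qed

text \<open>A vector scaled to norm 1 is covered by the supremum. One of norm 0 cannot be scaled and
  is handled by the boundedness of \<open>T\<close>.\<close>

lemma op_norm_bound:
  fixes T :: "('d, 'v::finite, 'm::finite) wavefun \<Rightarrow> ('d, 'v, 'm) wavefun"
  assumes T: "T \<in> bounded_ops L" and f: "f \<in> bloch L 0"
  shows "cell_norm L (T f) \<le> op_norm L T * cell_norm L f"
proof (cases "cell_norm L f = 0")
  case True
  obtain C where "cell_norm L (T f) \<le> C * cell_norm L f" using bounded_opsD(4)[OF T] f by blast
  then show ?thesis by (simp add: True)
next
  case False
  let ?c = "cell_norm L f"
  have c: "0 < ?c" using False cell_norm_nonneg[of L f] by simp
  let ?g = "\<lambda>r. of_real (1 / ?c) *\<^sub>v f r"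
  have g: "?g \<in> bloch L 0" "cell_norm L ?g = 1"
    using f c by (auto simp: cell_norm_scale norm_divide intro: bloch_scale)
  have "cell_norm L (T ?g) = cell_norm L (\<lambda>r. of_real (1 / ?c) *\<^sub>v T f r)"
    using bounded_opsD(1,3)[OF T] f g(1)
    by (intro cell_norm_cong_AE l2locD(1) blochD(1)[of _ L 0] bloch_scale) auto
  also have "\<dots> = cell_norm L (T f) / ?c" using c by (simp add: cell_norm_scale norm_divide)
  finally show ?thesis
    using cell_norm_le_op_norm[OF T g(1)] g(2) c by (simp add: divide_le_eq)
qed

lemma seminormed_bounded_ops:
  "seminormed (bounded_ops L :: (('d, 'v::finite, 'm::finite) wavefun \<Rightarrow> _) set) (op_norm L)"
proof -
  interpret B: seminormed "bloch L 0 :: ('d, 'v, 'm) wavefun set" "cell_norm L" by (rule seminormed_bloch)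
  show ?thesis
  proof
    show "(0 :: ('d, 'v, 'm) wavefun \<Rightarrow> _) \<in> bounded_ops L"
      by (auto simp: bounded_ops_def bloch_zero B.nrm_zero val_scale_simps intro!: exI[of _ 0])
  next
    fix S T :: "('d, 'v, 'm) wavefun \<Rightarrow> ('d, 'v, 'm) wavefun"
    assume S: "S \<in> bounded_ops L" and T: "T \<in> bounded_ops L"
    show "S + T \<in> bounded_ops L"
      unfolding bounded_ops_def
    proof (intro CollectI conjI ballI allI)
      fix f g :: "('d, 'v, 'm) wavefun" and c assume f: "f \<in> bloch L 0"
      show "(S + T) f \<in> bloch L 0" using S T f by (simp add: bloch_plus bounded_opsD)
      show "AE r in lborel. (S + T) (\<lambda>x. c *\<^sub>v f x) r = c *\<^sub>v (S + T) f r"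
        using bounded_opsD(3)[OF S f, of c] bounded_opsD(3)[OF T f, of c]
        by eventually_elim (simp add: val_scale_simps)
      assume g: "g \<in> bloch L 0"
      show "AE r in lborel. (S + T) (\<lambda>x. f x + g x) r = (S + T) f r + (S + T) g r"
        using bounded_opsD(2)[OF S f g] bounded_opsD(2)[OF T f g]
        by eventually_elim (simp add: plus_fun_def)
    next
      obtain C C' where "\<And>f. f \<in> bloch L 0 \<Longrightarrow> cell_norm L (S f) \<le> C * cell_norm L f"
        "\<And>f. f \<in> bloch L 0 \<Longrightarrow> cell_norm L (T f) \<le> C' * cell_norm L f"
        using bounded_opsD(4)[OF S] bounded_opsD(4)[OF T] by blast
      then have "cell_norm L ((S + T) f) \<le> (C + C') * cell_norm L f" if "f \<in> bloch L 0" for f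
        using B.nrm_add[OF bounded_opsD(1)[OF S that] bounded_opsD(1)[OF T that]] that
        by (fastforce simp: distrib_right)
      then show "\<exists>C. \<forall>f\<in>bloch L 0. cell_norm L ((S + T) f) \<le> C * cell_norm L f" by blast
    qed
    show "op_norm L (S + T) \<le> op_norm L S + op_norm L T"
    proof (rule op_norm_least)
      fix f :: "('d, 'v, 'm) wavefun" assume f: "f \<in> bloch L 0" "cell_norm L f \<le> 1"
      show "cell_norm L ((S + T) f) \<le> op_norm L S + op_norm L T"
        using B.nrm_add[OF bounded_opsD(1)[OF S f(1)] bounded_opsD(1)[OF T f(1)]]
          cell_norm_le_op_norm[OF S f] cell_norm_le_op_norm[OF T f] by simp
    qed
  next
    fix T :: "('d, 'v, 'm) wavefun \<Rightarrow> ('d, 'v, 'm) wavefun" and t :: real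
    assume T: "T \<in> bounded_ops L"
    show "t *\<^sub>R T \<in> bounded_ops L"
      unfolding bounded_ops_def
    proof (intro CollectI conjI ballI allI)
      fix f g :: "('d, 'v, 'm) wavefun" and c assume f: "f \<in> bloch L 0"
      show "(t *\<^sub>R T) f \<in> bloch L 0" using T f by (simp add: scaleR_fun_def[of t T] bloch_scaleR bounded_opsD)
      show "AE r in lborel. (t *\<^sub>R T) (\<lambda>x. c *\<^sub>v f x) r = c *\<^sub>v (t *\<^sub>R T) f r"
        using bounded_opsD(3)[OF T f, of c]
        by eventually_elim (simp add: scaleR_fun_def scaleR_eq_val_scale val_scale_simps mult.commute)
      assume g: "g \<in> bloch L 0"
      show "AE r in lborel. (t *\<^sub>R T) (\<lambda>x. f x + g x) r = (t *\<^sub>R T) f r + (t *\<^sub>R T) g r"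
        using bounded_opsD(2)[OF T f g]
        by eventually_elim (simp add: plus_fun_def scaleR_fun_def scaleR_add_right)
    next
      obtain C where C: "\<And>f. f \<in> bloch L 0 \<Longrightarrow> cell_norm L (T f) \<le> C * cell_norm L f"
        using bounded_opsD(4)[OF T] by blast
      have "cell_norm L ((t *\<^sub>R T) f) \<le> (\<bar>t\<bar> * C) * cell_norm L f" if "f \<in> bloch L 0" for f
        using mult_left_mono[OF C[OF that], of "\<bar>t\<bar>"] by (simp add: scaleR_fun_def[of t T] cell_norm_scaleR mult.assoc)
      then show "\<exists>C. \<forall>f\<in>bloch L 0. cell_norm L ((t *\<^sub>R T) f) \<le> C * cell_norm L f" by blast
    qed
    show "op_norm L (t *\<^sub>R T) \<le> \<bar>t\<bar> * op_norm L T"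
    proof (rule op_norm_least)
      fix f :: "('d, 'v, 'm) wavefun" assume f: "f \<in> bloch L 0" "cell_norm L f \<le> 1"
      show "cell_norm L ((t *\<^sub>R T) f) \<le> \<bar>t\<bar> * op_norm L T"
        using mult_left_mono[OF cell_norm_le_op_norm[OF T f], of "\<bar>t\<bar>"]
        by (simp add: scaleR_fun_def[of t T] cell_norm_scaleR)
    qed
    show "0 \<le> op_norm L T"
      using cell_norm_le_op_norm[OF T bloch_zero] cell_norm_nonneg[of L "T 0"] by (simp add: B.nrm_zero)
  qed
qed

lemma null_bilinear_apply:
  "null_bilinear (bounded_ops L) (op_norm L) (bloch L 0) (cell_norm L) (bloch L 0) (cell_norm L)
     (\<lambda>T (f :: ('d, 'v::finite, 'm::finite) wavefun). T f) 1"
proof -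
  interpret B: seminormed "bloch L 0 :: ('d, 'v, 'm) wavefun set" "cell_norm L" by (rule seminormed_bloch)
  interpret O: seminormed "bounded_ops L :: (('d, 'v, 'm) wavefun \<Rightarrow> _) set" "op_norm L" by (rule seminormed_bounded_ops)
  have null: "cell_norm L f = 0" if "f \<in> bloch L 0" "AE r in lborel. f r = 0" for f :: "('d, 'v, 'm) wavefun"
  proof -
    have "cell_norm L f = cell_norm L (0 :: ('d, 'v, 'm) wavefun)"
      using that by (intro cell_norm_cong_AE l2locD(1) blochD(1)[of _ L 0] bloch_zero) auto
    then show ?thesis by (simp add: B.nrm_zero)
  qed
  show ?thesis
  proof
    fix T :: "('d, 'v, 'm) wavefun \<Rightarrow> ('d, 'v, 'm) wavefun" and f g :: "('d, 'v, 'm) wavefun" and t :: real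
    assume T: "T \<in> bounded_ops L" and f: "f \<in> bloch L 0"
    show "T f \<in> bloch L 0" using T f by (rule bounded_opsD)
    show "cell_norm L (T f) \<le> 1 * op_norm L T * cell_norm L f" using op_norm_bound[OF T f] by simp
    show "cell_norm L (T (t *\<^sub>R f) - t *\<^sub>R T f) = 0"
    proof (rule null)
      show "T (t *\<^sub>R f) - t *\<^sub>R T f \<in> bloch L 0" using f by (intro B.diff bounded_opsD(1)[OF T] B.scale)
      show "AE r in lborel. (T (t *\<^sub>R f) - t *\<^sub>R T f) r = 0"
        using bounded_opsD(3)[OF T f, of "of_real t"] by eventually_elim (simp add: scaleR_fun_def scaleR_eq_val_scale)
    qed
    assume g: "g \<in> bloch L 0"
    show "cell_norm L (T (f + g) - (T f + T g)) = 0"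
    proof (rule null)
      show "T (f + g) - (T f + T g) \<in> bloch L 0" using f g by (intro B.diff B.add bounded_opsD(1)[OF T])
      show "AE r in lborel. (T (f + g) - (T f + T g)) r = 0"
        using bounded_opsD(2)[OF T f g] by eventually_elim simp
    qed
  qed (simp_all add: scaleR_fun_def)
qed

subsection \<open>Trivial cocycles of phases\<close>

text \<open>A partition of unity kills the first cohomology of the lattice with values in continuous
  functions: the weighted average of \<open>f\<close> is a potential. A shift by \<open>K0\<close>
  renames the index, and the cocycle identity turns \<open>f (K - K0) (k + K0)\<close> into
  \<open>f K k - f K0 k\<close>.\<close>

lemma cocycle_trivial:
  fixes f :: "real^'d \<Rightarrow> real^'d \<Rightarrow> real"
  assumes cont: "\<And>K. K \<in> L \<Longrightarrow> continuous_on UNIV (f K)"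
    and cocycle: "\<And>K K' k. K \<in> L \<Longrightarrow> K' \<in> L \<Longrightarrow> f K' (k + K) - f (K + K') k + f K k = 0"
  shows "\<exists>h. continuous_on UNIV h \<and> (\<forall>k. \<forall>K\<in>L. h (k + K) = h k + f K k)"
proof -
  obtain b where b: "0 < b" "\<And>x. norm (red x) \<le> b" using red_bounded by blast
  \<comment> \<open>A tent that is positive on the ball of radius \<open>b\<close>, which contains a
    representative of every point, and zero beyond radius \<open>b + 1\<close>. The weights thus
    never vanish simultaneously, and only finitely many are nonzero.\<close>
  define w where "w x = max 0 (b + 1 - norm x)" for x :: "real^'d"
  define N where "N k = {K \<in> L. norm (k + K) < b + 1}" for k
  define S where "S q k = (\<Sum>K\<in>N k. w (k + K) * q K k)" for q :: "real^'d \<Rightarrow> real^'d \<Rightarrow> real" and k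
  have fin: "finite (N k)" for k
  proof (rule finite_subset[OF _ finite_bounded[of "norm k + b + 1"]])
    show "N k \<subseteq> {R \<in> L. norm R \<le> norm k + b + 1}"
    proof
      fix K assume "K \<in> N k"
      then show "K \<in> {R \<in> L. norm R \<le> norm k + b + 1}"
        using norm_triangle_ineq4[of "k + K" k] by (simp add: N_def)
    qed
  qed
  have S_superset: "S q k = (\<Sum>K\<in>F. w (k + K) * q K k)" if "finite F" "N k \<subseteq> F" "F \<subseteq> L" for q k F
    unfolding S_def using that by (intro sum.mono_neutral_left) (auto simp: N_def w_def)
  have S_cont: "continuous_on UNIV (S q)" if q: "\<And>K. K \<in> L \<Longrightarrow> continuous_on UNIV (q K)" for q
  proof -
    have "isCont (S q) k0" for k0
    proof -
      \<comment> \<open>For \<open>dist k k0 < 1\<close>, \<open>norm (k + K) < b + 1\<close> forces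
        \<open>norm K < norm k0 + b + 2\<close>. With this common finite index set
        \<open>S q\<close> is locally a finite sum of continuous functions.\<close>
      let ?F = "{K \<in> L. norm K \<le> norm k0 + b + 2}"
      have eq: "S q k = (\<Sum>K\<in>?F. w (k + K) * q K k)" if "dist k k0 < 1" for k
      proof (rule S_superset[OF finite_bounded])
        show "N k \<subseteq> ?F"
        proof
          fix K assume K: "K \<in> N k"
          have "norm K \<le> norm (k + K) + norm k" using norm_triangle_ineq4[of "k + K" k] by simp
          moreover have "norm k \<le> norm k0 + 1"
            using that norm_triangle_ineq2[of k k0] by (simp add: dist_norm)
          ultimately show "K \<in> ?F" using K by (simp add: N_def)
        qed
      qed auto
      have "isCont (q K) k" if "K \<in> L" for K k using q[OF that] by (simp add: continuous_on_eq_continuous_at)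
      then have "isCont (\<lambda>k. \<Sum>K\<in>?F. w (k + K) * q K k) k0"
        unfolding w_def by (intro continuous_intros) auto
      moreover have "\<forall>\<^sub>F k in nhds k0. S q k = (\<Sum>K\<in>?F. w (k + K) * q K k)"
        unfolding eventually_nhds_metric using eq by (intro exI[of _ 1]) auto
      from isCont_cong[OF this] calculation show ?thesis by simp
    qed
    then show ?thesis by (simp add: continuous_on_eq_continuous_at)
  qed
  have S_shift: "S q (k + K0) = S (\<lambda>K k. q (K - K0) (k + K0)) k" if "K0 \<in> L" for q k K0
    unfolding S_def
    by (rule sum.reindex_bij_witness[of _ "\<lambda>K. K - K0" "\<lambda>K. K + K0"])
      (use that in \<open>auto simp: N_def add_mem diff_mem algebra_simps\<close>)
  define Z where "Z = S (\<lambda>_ _. 1)"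
  have Z_pos: "0 < Z k" for k
  proof -
    \<comment> \<open>Translating \<open>k\<close> by this vector gives \<open>red k\<close>, where
      the weight is at least 1.\<close>
    have "- (k - red k) \<in> N k" using b(2)[of k] uminus_mem[OF red_diff[of k]] by (simp add: N_def)
    moreover have "0 < w (k + - (k - red k))" using b(2)[of k] by (simp add: w_def)
    ultimately show ?thesis
      unfolding Z_def S_def by (intro sum_pos2[OF fin]) (auto simp: w_def)
  qed
  have Z_shift: "Z (k + K) = Z k" if "K \<in> L" for k K unfolding Z_def using that by (rule S_shift)
  have f_shift: "S f (k + K0) = S f k - f K0 k * Z k" if K0: "K0 \<in> L" for k K0
  proof -
    have "w (k + K) * f (K - K0) (k + K0) = w (k + K) * f K k - f K0 k * (w (k + K) * 1)" if "K \<in> N k" for K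
    proof -
      have "K \<in> L" using that by (simp add: N_def)
      then have "f (K - K0) (k + K0) - f (K0 + (K - K0)) k + f K0 k = 0" using K0 by (intro cocycle diff_mem)
      then have "f (K - K0) (k + K0) = f K k - f K0 k" by simp
      then show ?thesis by (simp add: right_diff_distrib)
    qed
    then have "S (\<lambda>K k. f (K - K0) (k + K0)) k = (\<Sum>K\<in>N k. w (k + K) * f K k - f K0 k * (w (k + K) * 1))"
      unfolding S_def by (rule sum.cong[OF refl])
    also have "\<dots> = S f k - f K0 k * Z k"
      by (simp add: sum_subtractf S_def Z_def sum_distrib_left)
    finally show ?thesis unfolding S_shift[OF K0] .
  qed
  have "continuous_on UNIV (\<lambda>k. - S f k / Z k)"
    using Z_pos unfolding Z_def by (intro continuous_intros S_cont cont) (auto simp: less_imp_neq[symmetric])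
  moreover have "- S f (k + K) / Z (k + K) = - S f k / Z k + f K k" if "K \<in> L" for k K
    unfolding Z_shift[OF that] f_shift[OF that] using Z_pos[of k] by (simp add: field_simps)
  ultimately show ?thesis by (intro exI[of _ "\<lambda>k. - S f k / Z k"]) auto
qed

end

subsection \<open>Analytic frames of trivial line bundles\<close>

locale periodic_line_bundle = lattice_basis A A' L for A A' :: "real^'d^'d" and L :: "(real^'d) set" +
  fixes E :: "real^'d \<Rightarrow> ('d, 'v::finite, 'm::finite) wavefun set" and \<psi> :: "real^'d \<Rightarrow> ('d, 'v, 'm) wavefun"
  assumes E_bloch: "E k \<subseteq> bloch L k"
    and spans: "E k = {f \<in> l2loc. \<exists>c. AE r in lborel. f r = c *\<^sub>v \<psi> k r}"
    and mem_E: "\<psi> k \<in> E k"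
    and normalized: "cell_norm L (\<psi> k) = 1"
    and cont: "((\<lambda>k. cell_norm L (phase (- k) (\<psi> k) - phase (- k0) (\<psi> k0))) \<longlongrightarrow> 0) (at k0)"
    and periodic: "K \<in> reciprocal_lattice L \<Longrightarrow> AE r in lborel. \<psi> (k + K) r = \<psi> k r"
    and proj_analytic: "analytic_near (bounded_ops L) (op_norm L)
      (\<lambda>k f. phase (- k) (band_proj L E k (phase k f))) k0"
begin

definition u :: "real^'d \<Rightarrow> ('d, 'v, 'm) wavefun" where
  "u k = phase (- k) (\<psi> k)"

lemma psi_l2loc: "\<psi> k \<in> l2loc"
  using mem_E E_bloch blochD(1) by blast

lemma u_bloch: "u k \<in> bloch L 0"
  unfolding u_def using mem_E E_bloch by (intro bloch_phase_strip) blast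

lemma u_norm: "cell_norm L (u k) = 1"
  by (simp add: u_def cell_norm_phase normalized)

lemma psi_inner: "cell_inner L (\<psi> k) (\<psi> k) = 1"
  by (simp add: cell_inner_self normalized)

text \<open>\<open>band_proj\<close> is a choice. The rank-one formula provides a candidate, and
  orthogonality to \<open>\<psi> k\<close> forces the chosen function to agree with it almost
  everywhere.\<close>

lemma band_proj_eq:
  assumes F: "F \<in> l2loc"
  shows "band_proj L E k F \<in> E k"
    "AE r in lborel. band_proj L E k F r = cell_inner L (\<psi> k) F *\<^sub>v \<psi> k r"
proof -
  let ?P = "\<lambda>g. g \<in> E k \<and> (\<forall>h\<in>E k. cell_inner L h (\<lambda>r. F r - g r) = 0)"
  have inner_diff: "cell_inner L (\<psi> k) (\<lambda>r. F r - g r) = cell_inner L (\<psi> k) F - c"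
    if g: "g \<in> l2loc" "AE r in lborel. g r = c *\<^sub>v \<psi> k r" for g c
  proof -
    have "cell_inner L (\<psi> k) (\<lambda>r. F r - g r) = cell_inner L (\<psi> k) (F + (\<lambda>r. (- c) *\<^sub>v \<psi> k r))"
    proof (rule cell_inner_cong_AE)
      show "AE r in lborel. F r - g r = (F + (\<lambda>r. (- c) *\<^sub>v \<psi> k r)) r"
        using g(2) by eventually_elim (auto intro!: val_eqI)
      show "(\<lambda>r. F r - g r) \<in> borel_measurable borel"
        using F g(1) by (intro borel_measurable_diff l2locD)
    qed (use F psi_l2loc in \<open>auto intro!: l2locD l2loc_plus l2loc_scale\<close>)
    also have "\<dots> = cell_inner L (\<psi> k) F + (- c) * cell_inner L (\<psi> k) (\<psi> k)"
      by (subst cell_inner_add_right) (auto intro: F psi_l2loc l2loc_scale simp: cell_inner_scale_right)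
    finally show ?thesis by (simp add: psi_inner)
  qed
  let ?g = "\<lambda>r. cell_inner L (\<psi> k) F *\<^sub>v \<psi> k r"
  have gl: "?g \<in> l2loc" by (intro l2loc_scale psi_l2loc)
  have "?P ?g"
  proof (intro conjI ballI)
    show "?g \<in> E k" unfolding spans using gl by auto
    fix h assume "h \<in> E k"
    then obtain c where h: "h \<in> l2loc" "AE r in lborel. h r = c *\<^sub>v \<psi> k r" unfolding spans by blast
    have "cell_inner L h (\<lambda>r. F r - ?g r) = cell_inner L (\<lambda>r. c *\<^sub>v \<psi> k r) (\<lambda>r. F r - ?g r)"
      using h F gl psi_l2loc
      by (intro cell_inner_cong_AE borel_measurable_diff l2locD(1) l2loc_scale) auto
    also have "\<dots> = cnj c * (cell_inner L (\<psi> k) F - cell_inner L (\<psi> k) F)"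
      unfolding cell_inner_scale_left by (subst inner_diff[OF gl]) auto
    finally show "cell_inner L h (\<lambda>r. F r - ?g r) = 0" by simp
  qed
  then have P: "?P (band_proj L E k F)" unfolding band_proj_def by (rule someI[where P="?P"])
  then show "band_proj L E k F \<in> E k" by blast
  then obtain c where c: "band_proj L E k F \<in> l2loc" "AE r in lborel. band_proj L E k F r = c *\<^sub>v \<psi> k r"
    unfolding spans by blast
  have "cell_inner L (\<psi> k) F - c = 0" using inner_diff[OF c] P mem_E by simp
  with c(2) show "AE r in lborel. band_proj L E k F r = cell_inner L (\<psi> k) F *\<^sub>v \<psi> k r" by simp
qed

definition proj :: "real^'d \<Rightarrow> ('d, 'v, 'm) wavefun \<Rightarrow> ('d, 'v, 'm) wavefun" where
  "proj k f = phase (- k) (band_proj L E k (phase k f))"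

lemma proj_bloch: "f \<in> l2loc \<Longrightarrow> proj k f \<in> bloch L 0"
  unfolding proj_def using band_proj_eq(1)[OF l2loc_phase] E_bloch by (intro bloch_phase_strip) blast

lemma proj_AE:
  assumes "f \<in> l2loc"
  shows "AE r in lborel. proj k f r = cell_inner L (u k) f *\<^sub>v u k r"
proof -
  have "cell_inner L (\<psi> k) (phase k f) = cell_inner L (phase (- k) (\<psi> k)) (phase (- k) (phase k f))"
    by (rule cell_inner_phase[symmetric])
  then have "cell_inner L (\<psi> k) (phase k f) = cell_inner L (u k) f"
    by (simp add: u_def phase_phase phase_zero)
  then show ?thesis
    using band_proj_eq(2)[OF l2loc_phase[OF assms], of k k]
    by (auto simp: proj_def phase_def u_def val_scale_simps mult.commute elim!: eventually_mono)
qed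

lemma cell_norm_proj: "f \<in> l2loc \<Longrightarrow> cell_norm L (proj k f) = cmod (cell_inner L (u k) f)"
  using cell_norm_cong_AE[OF proj_AE, of f k] u_norm[of k]
  by (simp add: cell_norm_scale l2locD(1) blochD(1)[OF proj_bloch] l2loc_scale blochD(1)[OF u_bloch])

lemma proj_bounded: "proj k \<in> bounded_ops L"
  unfolding bounded_ops_def
proof (intro CollectI conjI ballI allI exI)
  fix f g :: "('d, 'v, 'm) wavefun" and c assume "f \<in> bloch L 0"
  then have f: "f \<in> l2loc" by (rule blochD)
  have ul: "u k \<in> l2loc" using u_bloch by (rule blochD)
  show "proj k f \<in> bloch L 0" using f by (rule proj_bloch)
  show "AE r in lborel. proj k (\<lambda>x. c *\<^sub>v f x) r = c *\<^sub>v proj k f r"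
    using proj_AE[OF f, of k] proj_AE[OF l2loc_scale[OF f, of c], of k]
    by eventually_elim (simp add: cell_inner_scale_right val_scale_simps)
  show "cell_norm L (proj k f) \<le> 1 * cell_norm L f"
    using cell_Cauchy_Schwarz[OF ul f] by (simp add: cell_norm_proj[OF f] u_norm)
  assume "g \<in> bloch L 0"
  then have g: "g \<in> l2loc" by (rule blochD)
  show "AE r in lborel. proj k (\<lambda>x. f x + g x) r = proj k f r + proj k g r"
    using proj_AE[OF f, of k] proj_AE[OF g, of k] proj_AE[OF l2loc_add[OF f g], of k]
    by eventually_elim (use cell_inner_add_right[OF ul f g] in \<open>simp add: plus_fun_def val_scale_simps\<close>)
qed

text \<open>The projections of the twisted \<open>u q\<close> are analytic periodic sections; the one with
  \<open>q = k\<close> does not vanish at \<open>k\<close>.\<close>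

definition sect :: "real^'d \<Rightarrow> real^'d \<Rightarrow> ('d, 'v, 'm) wavefun" where
  "sect q k = proj k (twist (u q) (k - q))"

definition coef :: "real^'d \<Rightarrow> real^'d \<Rightarrow> complex" where
  "coef q k = cell_inner L (u k) (twist (u q) (k - q))"

lemma twist_u_bloch: "twist (u q) k \<in> bloch L 0"
  by (intro twist_bloch u_bloch)

lemma twist_u_analytic: "analytic_near (bloch L 0) (cell_norm L) (\<lambda>k. twist (u q) (k - q)) k0"
proof -
  have "(\<lambda>k. twist (u q) (k - q)) = twist (twist (u q) (- q))"
    by (simp add: fun_eq_iff twist_add[symmetric])
  then show ?thesis using twist_analytic[OF twist_u_bloch] by simp
qed

lemma sect_bloch: "sect q k \<in> bloch L 0"
  unfolding sect_def by (intro proj_bloch blochD(1)[OF twist_u_bloch])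

lemma sect_AE: "AE r in lborel. sect q k r = coef q k *\<^sub>v u k r"
  unfolding sect_def coef_def by (intro proj_AE blochD(1)[OF twist_u_bloch])

lemma sect_analytic: "analytic_near (bloch L 0) (cell_norm L) (sect q) k0"
proof -
  interpret null_bilinear "bounded_ops L" "op_norm L" "bloch L 0" "cell_norm L" "bloch L 0" "cell_norm L"
    "\<lambda>T (f :: ('d, 'v, 'm) wavefun). T f" 1 by (rule null_bilinear_apply)
  have "analytic_near (bounded_ops L) (op_norm L) proj k0" using proj_analytic unfolding proj_def[abs_def] .
  then show ?thesis
    unfolding sect_def[abs_def] by (rule analytic_near_bilinear[OF _ twist_u_analytic proj_bounded twist_u_bloch])
qed

lemma coef_self: "coef q q = 1"
  by (simp add: coef_def twist_def val_scale_simps cell_inner_self u_norm)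

lemma norm_coef: "cmod (coef q k) \<le> 1"
  using cell_Cauchy_Schwarz[OF blochD(1)[OF u_bloch[of k]] blochD(1)[OF twist_u_bloch[of q "k - q"]]]
  by (simp add: coef_def u_norm cell_norm_twist)

text \<open>The section \<open>u\<close> is known to be continuous only, and \<open>coef\<close>
  inherits no more than that, although the sections \<open>sect q\<close> are analytic.\<close>

lemma coef_continuous: "continuous_on UNIV (coef q)"
proof -
  interpret null_bilinear "bloch L 0" "cell_norm L" "bloch L 0" "cell_norm L" UNIV norm
    "cell_inner L :: ('d, 'v, 'm) wavefun \<Rightarrow> _" 1 by (rule null_bilinear_cell_inner)
  have "isCont (coef q) k0" for k0
  proof -
    let ?v = "\<lambda>k. twist (u q) (k - q)"
    have "((\<lambda>k. cell_norm L (?v k - ?v k0)) \<longlongrightarrow> 0) (at k0)"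
      by (rule tendsto_mono[OF _ S1.analytic_near_continuous[OF twist_u_analytic twist_u_bloch]])
        (simp add: at_within_def)
    from tendsto_add[OF cont[of k0, folded u_def] this]
    have lim: "((\<lambda>k. cell_norm L (u k - u k0) + cell_norm L (?v k - ?v k0)) \<longlongrightarrow> 0) (at k0)" by simp
    have "norm (coef q k - coef q k0) \<le> cell_norm L (u k - u k0) + cell_norm L (?v k - ?v k0)" for k
      using diff_bound[OF u_bloch[of k] u_bloch[of k0] twist_u_bloch[of q "k - q"] twist_u_bloch[of q "k0 - q"]]
      by (simp add: coef_def cell_norm_twist u_norm)
    then have "\<forall>\<^sub>F k in at k0. norm (coef q k - coef q k0) \<le> cell_norm L (u k - u k0) + cell_norm L (?v k - ?v k0)"
      by (intro always_eventually allI)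
    then have "((\<lambda>k. coef q k - coef q k0) \<longlongrightarrow> 0) (at k0)" using lim by (rule Lim_null_comparison)
    then show ?thesis unfolding isCont_def by (rule LIM_zero_cancel)
  qed
  then show ?thesis by (simp add: continuous_on_eq_continuous_at)
qed

lemma u_shift:
  assumes "K \<in> reciprocal_lattice L"
  shows "AE r in lborel. u (k + K) r = phase (- K) (u k) r"
  using periodic[OF assms, of k]
  by eventually_elim (simp add: u_def phase_def val_scale_simps cis_mult inner_add_left inner_diff_left algebra_simps)

text \<open>Both arguments of the inner product acquire the same factor \<open>phase (- K)\<close>;
  this is the purpose of \<open>twist\<close>.\<close>

lemma coef_periodic:
  assumes "K \<in> reciprocal_lattice L"
  shows "coef q (k + K) = coef q k"
proof -
  have "twist (u q) (k + K - q) = phase (- K) (twist (u q) (k - q))"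
    using twist_reciprocal[OF assms, of "u q" "k - q"] by (simp add: algebra_simps)
  then have "coef q (k + K) = cell_inner L (u (k + K)) (phase (- K) (twist (u q) (k - q)))"
    by (simp add: coef_def)
  also have "\<dots> = cell_inner L (phase (- K) (u k)) (phase (- K) (twist (u q) (k - q)))"
    using u_shift[OF assms]
    by (intro cell_inner_cong_AE l2locD(1) l2loc_phase blochD(1)[OF u_bloch] blochD(1)[OF twist_u_bloch]) auto
  finally show ?thesis by (simp add: cell_inner_phase coef_def)
qed

text \<open>Since \<open>coef q q = 1\<close>, the sets where some \<open>coef q\<close> is nonzero
  cover the compact zone. Finitely many suffice, their sum of squares has a positive minimum there,
  and periodicity carries it to all wavevectors.\<close>

lemma nonvanishing_coefs:
  obtains J \<delta> where "finite J" "0 < \<delta>" "\<And>k. \<delta> \<le> (\<Sum>q\<in>J. (cmod (coef q k))\<^sup>2)"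
proof -
  interpret RB: lattice_basis "(2 * pi) *\<^sub>R transpose A'" "(1 / (2 * pi)) *\<^sub>R transpose A" "reciprocal_lattice L"
    by (rule reciprocal)
  let ?Z = "unit_cell (reciprocal_lattice L)"
  define U where "U q = {k. coef q k \<noteq> 0}" for q
  have "open (U q)" for q
  proof -
    have "U q = UNIV \<inter> coef q -` (- {0})" by (auto simp: U_def)
    moreover have "open (- {0 :: complex})" by (intro open_Compl closed_singleton)
    ultimately show ?thesis using continuous_open_preimage[OF coef_continuous open_UNIV, of "- {0}" q] by simp
  qed
  moreover have "?Z \<subseteq> (\<Union>q\<in>?Z. U q)" by (auto simp: U_def coef_self)
  ultimately obtain J where J: "J \<subseteq> ?Z" "finite J" "?Z \<subseteq> (\<Union>q\<in>J. U q)"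
    using compactE_image[OF RB.unit_cell_compact, of ?Z U] by metis
  define m where "m k = (\<Sum>q\<in>J. (cmod (coef q k))\<^sup>2)" for k
  have pos: "0 < m k" if k: "k \<in> ?Z" for k
  proof -
    obtain q where "q \<in> J" "coef q k \<noteq> 0" using J(3) k by (auto simp: U_def)
    then show ?thesis unfolding m_def by (intro sum_pos2[OF J(2)]) auto
  qed
  have mcont: "continuous_on S m" for S
  proof -
    have "continuous_on S (coef q)" for q using coef_continuous continuous_on_subset by blast
    then show ?thesis unfolding m_def by (intro continuous_intros)
  qed
  have "0 \<in> ?Z" by (simp add: unit_cell_def)
  then have "?Z \<noteq> {}" by blast
  then obtain k0 where k0: "k0 \<in> ?Z" "\<And>k. k \<in> ?Z \<Longrightarrow> m k0 \<le> m k"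
    using continuous_attains_inf[OF RB.unit_cell_compact _ mcont] by blast
  have "m k0 \<le> m k" for k
  proof -
    obtain K where K: "K \<in> reciprocal_lattice L" "k - K \<in> ?Z" using RB.unit_cell_cover by blast
    have "m k = m (k - K)" unfolding m_def using coef_periodic[OF K(1), of _ "k - K"] by simp
    then show ?thesis using k0(2)[OF K(2)] by simp
  qed
  then show thesis using that[OF J(2) pos[OF k0(1)]] unfolding m_def by blast
qed

text \<open>The weights \<open>cnj (coef q)\<close> would produce the factor
  \<open>(\<Sum>q\<in>J. (cmod (coef q k))\<^sup>2)\<close>, but they are not known to be analytic.
  Nearby trigonometric polynomials are, and still keep the factor \<open>M\<close> away from 0.
  Analyticity is obtained for \<open>S\<close>, not for \<open>M\<close>.\<close>

lemma analytic_nonvanishing_section: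
  obtains S M where "\<And>k0. analytic_near (bloch L 0) (cell_norm L) S k0" "\<And>k. S k \<in> bloch L 0"
    "\<And>k. AE r in lborel. S k r = M k *\<^sub>v u k r" "\<And>k. M k \<noteq> 0"
    "\<And>k K. K \<in> reciprocal_lattice L \<Longrightarrow> M (k + K) = M k"
proof -
  interpret RB: lattice_basis "(2 * pi) *\<^sub>R transpose A'" "(1 / (2 * pi)) *\<^sub>R transpose A" "reciprocal_lattice L"
    by (rule reciprocal)
  interpret V: null_bilinear UNIV norm "bloch L 0" "cell_norm L" "bloch L 0" "cell_norm L"
    "\<lambda>c (f :: ('d, 'v, 'm) wavefun) r. c *\<^sub>v f r" 1
    by (rule null_bilinear_val_scale)
  obtain J \<delta> where J: "finite J" "0 < \<delta>" "\<And>k. \<delta> \<le> (\<Sum>q\<in>J. (cmod (coef q k))\<^sup>2)"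
    by (rule nonvanishing_coefs) (rule that)
  \<comment> \<open>The denominator makes the total error of \<open>card J\<close> terms, each at
    most \<open>e\<close>, strictly smaller than \<open>\<delta>\<close>.\<close>
  define e where "e = \<delta> / (card J + 1)"
  have e: "0 < e" using J by (simp add: e_def)
  have "\<forall>q. \<exists>t. (\<forall>k0. canalytic t k0) \<and> (\<forall>k. \<forall>K\<in>reciprocal_lattice L. t (k + K) = t k) \<and>
      (\<forall>k. cmod (cnj (coef q k) - t k) < e)"
    using coef_periodic by (intro allI RB.periodic_approximation continuous_intros coef_continuous e) simp
  from choice[OF this] obtain t where t: "\<And>q k0. canalytic (t q) k0"
    "\<And>q k K. K \<in> reciprocal_lattice L \<Longrightarrow> t q (k + K) = t q k"
    "\<And>q k. cmod (cnj (coef q k) - t q k) < e" by blast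
  define S where "S k = (\<Sum>q\<in>J. (\<lambda>r. t q k *\<^sub>v sect q k r))" for k
  define M where "M k = (\<Sum>q\<in>J. t q k * coef q k)" for k
  have term_bloch: "(\<lambda>r. t q k *\<^sub>v sect q k r) \<in> bloch L 0" for q k by (intro bloch_scale sect_bloch)
  show thesis
  proof
    show "analytic_near (bloch L 0) (cell_norm L) S k0" for k0
      unfolding S_def[abs_def]
      by (intro V.S2.analytic_near_sum V.analytic_near_bilinear t sect_analytic sect_bloch term_bloch) simp_all
    show "S k \<in> bloch L 0" for k unfolding S_def by (intro V.S2.sum_mem term_bloch)
    show "AE r in lborel. S k r = M k *\<^sub>v u k r" for k
    proof -
      have "AE r in lborel. \<forall>q\<in>J. sect q k r = coef q k *\<^sub>v u k r"
        using J(1) sect_AE by (intro AE_finite_allI)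
      then show ?thesis
      proof eventually_elim
        case (elim r)
        have "S k r = (\<Sum>q\<in>J. t q k *\<^sub>v sect q k r)" by (simp add: S_def sum_apply)
        also have "\<dots> = (\<Sum>q\<in>J. (t q k * coef q k) *\<^sub>v u k r)"
          using elim by (intro sum.cong) (auto simp: val_scale_simps)
        also have "\<dots> = M k *\<^sub>v u k r"
          unfolding M_def by (induction J rule: infinite_finite_induct) (auto simp: val_scale_simps)
        finally show ?case .
      qed
    qed
    show "M (k + K) = M k" if "K \<in> reciprocal_lattice L" for k K
      by (simp add: M_def t(2)[OF that] coef_periodic[OF that])
    show "M k \<noteq> 0" for k
    proof
      assume M0: "M k = 0"
      \<comment> \<open>If \<open>M k\<close> vanished, the whole sum of squares would be
        approximation error, hence smaller than \<open>\<delta>\<close>.\<close>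
      have "complex_of_real (\<Sum>q\<in>J. (cmod (coef q k))\<^sup>2) = (\<Sum>q\<in>J. (cnj (coef q k) - t q k) * coef q k) + M k"
        unfolding M_def sum.distrib[symmetric] of_real_sum
        by (intro sum.cong refl) (simp only: complex_norm_square, simp add: algebra_simps)
      then have eq: "complex_of_real (\<Sum>q\<in>J. (cmod (coef q k))\<^sup>2) = (\<Sum>q\<in>J. (cnj (coef q k) - t q k) * coef q k)"
        using M0 by simp
      have "\<bar>\<Sum>q\<in>J. (cmod (coef q k))\<^sup>2\<bar> = cmod (\<Sum>q\<in>J. (cnj (coef q k) - t q k) * coef q k)"
        using arg_cong[OF eq, of cmod] by (simp only: norm_of_real)
      also have "\<dots> \<le> (\<Sum>q\<in>J. e * 1)"
      proof (rule order_trans[OF norm_sum], rule sum_mono)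
        fix q
        show "cmod ((cnj (coef q k) - t q k) * coef q k) \<le> e * 1"
          unfolding norm_mult using e by (intro mult_mono less_imp_le[OF t(3)] norm_coef) auto
      qed
      also have "\<dots> = card J * e" by simp
      also have "\<dots> < \<delta>" using J(2) by (simp add: e_def field_simps)
      finally show False using J(3)[of k] by simp
    qed
  qed
qed

text \<open>\<open>S\<close> is divided by its norm. The factor \<open>n\<close> is analytic because
  it is the inverse square root of the analytic positive function
  \<open>cell_inner L (S k) (S k)\<close>; the phase of \<open>M\<close> is left in the frame as
  \<open>\<nu>\<close> and is periodic along with \<open>M\<close>.\<close>

lemma localizable: "localizable L 1 E"
proof -
  interpret I: null_bilinear "bloch L 0" "cell_norm L" "bloch L 0" "cell_norm L" UNIV norm
    "cell_inner L :: ('d, 'v, 'm) wavefun \<Rightarrow> _" 1 by (rule null_bilinear_cell_inner)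
  interpret V: null_bilinear UNIV norm "bloch L 0" "cell_norm L" "bloch L 0" "cell_norm L"
    "\<lambda>c (f :: ('d, 'v, 'm) wavefun) r. c *\<^sub>v f r" 1
    by (rule null_bilinear_val_scale)
  obtain S M where S: "\<And>k0. analytic_near (bloch L 0) (cell_norm L) S k0" "\<And>k. S k \<in> bloch L 0"
    and SM: "\<And>k. AE r in lborel. S k r = M k *\<^sub>v u k r" and M0: "\<And>k. M k \<noteq> 0"
    and M_per: "\<And>k K. K \<in> reciprocal_lattice L \<Longrightarrow> M (k + K) = M k"
    by (rule analytic_nonvanishing_section) (rule that)
  define n where "n k = 1 / cmod (M k)" for k
  have npos: "0 < n k" for k using M0 by (simp add: n_def)
  have "cell_norm L (S k) = cmod (M k)" for k
    using cell_norm_cong_AE[OF SM, of k] u_norm[of k]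
    by (simp add: cell_norm_scale l2locD(1) blochD(1)[OF S(2)] l2loc_scale blochD(1)[OF u_bloch])
  then have SS: "cell_inner L (S k) (S k) = of_real ((cmod (M k))\<^sup>2)" for k
    by (simp add: cell_inner_self)
  have n_an: "canalytic (\<lambda>k. of_real (n k)) k0" for k0
  proof -
    \<comment> \<open>A holomorphic branch of the inverse square root. The ball around the positive
      number \<open>?N k0\<close> whose radius is that number lies in the right half-plane, away
      from the cut of \<open>Ln\<close>.\<close>
    let ?F = "\<lambda>z. exp (- Ln z / 2)" and ?N = "\<lambda>k. cell_inner L (S k) (S k)"
    have N: "canalytic ?N k0" by (intro I.analytic_near_bilinear S)
    have pos: "0 < (cmod (M k))\<^sup>2" for k using M0[of k] by simp
    have "?F holomorphic_on ball (?N k0) ((cmod (M k0))\<^sup>2)"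
    proof -
      have "z \<notin> \<real>\<^sub>\<le>\<^sub>0" if "z \<in> ball (?N k0) ((cmod (M k0))\<^sup>2)" for z
      proof
        assume "z \<in> \<real>\<^sub>\<le>\<^sub>0"
        then have "Re z \<le> 0" by (simp add: complex_nonpos_Reals_iff)
        moreover have "cmod (?N k0 - z) < (cmod (M k0))\<^sup>2" using that by (simp add: dist_norm)
        ultimately show False using complex_Re_le_cmod[of "?N k0 - z"] by (simp add: SS)
      qed
      then show ?thesis by (intro holomorphic_intros) auto
    qed
    then have "canalytic (\<lambda>k. ?F (?N k)) k0" using pos N by (rule canalytic_holomorphic_comp)
    moreover have "?F (?N k) = of_real (n k)" for k
    proof -
      have "- Ln (?N k) / 2 = of_real (- ln (cmod (M k)))"
        unfolding SS using pos[of k] M0[of k] by (simp add: Ln_of_real ln_realpow del: of_real_power)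
      then show ?thesis using M0[of k] by (simp add: exp_of_real exp_minus n_def inverse_eq_divide del: of_real_minus)
    qed
    ultimately show ?thesis by simp
  qed
  define \<phi> where "\<phi> k = phase k (\<lambda>r. of_real (n k) *\<^sub>v S k r)" for k
  define \<nu> where "\<nu> k = of_real (n k) * M k" for k
  have \<nu>: "cmod (\<nu> k) = 1" for k using M0[of k] by (simp add: \<nu>_def n_def norm_mult norm_divide)
  have \<phi>: "AE r in lborel. \<phi> k r = \<nu> k *\<^sub>v \<psi> k r" for k
    using SM[of k]
    by eventually_elim (simp add: \<phi>_def \<nu>_def u_def phase_def val_scale_simps mult.left_commute[of "cis _"] mult.assoc cis_mult)
  have \<phi>l: "\<phi> k \<in> l2loc" for k
    unfolding \<phi>_def by (intro l2loc_phase l2loc_scale blochD(1)[OF S(2)])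
  have \<phi>_norm: "cell_inner L (\<phi> k) (\<phi> k) = 1" for k
  proof -
    have "cell_norm L (\<phi> k) = 1"
      using cell_norm_cong_AE[OF \<phi>, of k] normalized[of k] \<nu>[of k]
      by (simp add: cell_norm_scale l2locD(1)[OF \<phi>l] l2locD(1)[OF l2loc_scale[OF psi_l2loc]])
    then show ?thesis by (simp add: cell_inner_self)
  qed
  have \<phi>_span: "E k = {f \<in> l2loc. \<exists>c. AE r in lborel. f r = c *\<^sub>v \<phi> k r}" for k
  proof -
    have "(\<exists>c. AE r in lborel. f r = c *\<^sub>v \<psi> k r) \<longleftrightarrow> (\<exists>c. AE r in lborel. f r = c *\<^sub>v \<phi> k r)" for f
    proof
      assume "\<exists>c. AE r in lborel. f r = c *\<^sub>v \<psi> k r"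
      then obtain c where "AE r in lborel. f r = c *\<^sub>v \<psi> k r" ..
      then have "AE r in lborel. f r = (c / \<nu> k) *\<^sub>v \<phi> k r"
        using \<phi>[of k] by eventually_elim (use \<nu>[of k] in \<open>auto simp: val_scale_simps\<close>)
      then show "\<exists>c. AE r in lborel. f r = c *\<^sub>v \<phi> k r" ..
    next
      assume "\<exists>c. AE r in lborel. f r = c *\<^sub>v \<phi> k r"
      then obtain c where "AE r in lborel. f r = c *\<^sub>v \<phi> k r" ..
      then have "AE r in lborel. f r = (c * \<nu> k) *\<^sub>v \<psi> k r"
        using \<phi>[of k] by eventually_elim (simp add: val_scale_simps)
      then show "\<exists>c. AE r in lborel. f r = c *\<^sub>v \<psi> k r" ..
    qed
    then show ?thesis unfolding spans by simp
  qed
  have \<phi>_mem: "\<phi> k \<in> E k" for k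
    unfolding \<phi>_span using \<phi>l by (auto intro!: exI[of _ 1] simp: val_scale_simps)
  show ?thesis
    unfolding localizable_def
  proof (intro exI conjI)
    show "orthonormal_frame L E {..<1::nat} (\<lambda>_. \<phi>)"
      unfolding orthonormal_frame_def lessThan_1 lspan_singleton
      by (intro allI conjI ballI \<phi>_mem \<phi>_span) (auto simp: \<phi>_norm)
    have "(\<lambda>k. phase (- k) (\<phi> k)) = (\<lambda>k r. of_real (n k) *\<^sub>v S k r)"
      by (simp add: \<phi>_def phase_phase phase_zero)
    then show "analytic_frame L {..<1::nat} (\<lambda>_. \<phi>)"
      unfolding analytic_frame_def real_analytic_in_iff
      using V.analytic_near_bilinear[OF n_an S(1) _ S(2)] by (intro ballI allI) simp
    show "periodic_frame L {..<1::nat} (\<lambda>_. \<phi>)"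
      unfolding periodic_frame_def
    proof (intro ballI allI)
      fix k K assume K: "K \<in> reciprocal_lattice L"
      have \<nu>K: "\<nu> (k + K) = \<nu> k" by (simp add: \<nu>_def n_def M_per[OF K])
      show "AE r in lborel. \<phi> (k + K) r = \<phi> k r"
        using \<phi>[of "k + K"] \<phi>[of k] periodic[OF K, of k] by eventually_elim (simp only: \<nu>K)
    qed
  qed
qed

end

section \<open>From a vanishing first Chern class to a localizable band\<close>

lemma trivial_chern_class_imp_localizable:
  fixes E :: "real^'d \<Rightarrow> ('d, 'v::finite, 'm::finite) wavefun set"
  assumes lb: "lattice_basis A A' L"
    and E: "\<And>k. E k \<subseteq> bloch L k" "\<And>k. has_cdim 1 (E k)"
    and an: "analytic_projection L E"
    and chern: "first_chern_class L E = coboundaries2 (reciprocal_lattice L)"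
  shows "localizable L 1 E"
proof -
  interpret lattice_basis A A' L by (rule lb)
  interpret RB: lattice_basis "(2 * pi) *\<^sub>R transpose A'" "(1 / (2 * pi)) *\<^sub>R transpose A" "reciprocal_lattice L"
    by (rule reciprocal)
  interpret V: null_bilinear UNIV norm "bloch L 0" "cell_norm L" "bloch L 0" "cell_norm L"
    "\<lambda>c (f :: ('d, 'v, 'm) wavefun) r. c *\<^sub>v f r" 1
    by (rule null_bilinear_val_scale)
  let ?RL = "reciprocal_lattice L"
  \<comment> \<open>The zero cochain, as a representative of the class, provides a section whose
    transition phases \<open>f\<close> satisfy the additive cocycle identity exactly.\<close>
  have "(\<lambda>_ _. 0) \<in> coboundaries2 ?RL" unfolding coboundaries2_def by (auto intro!: exI[of _ "\<lambda>_. 0"])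
  then have "(\<lambda>_ _. 0) \<in> first_chern_class L E" using chern by simp
  then obtain \<sigma> f where \<sigma>: "\<And>k. \<sigma> k \<in> E k" "\<And>k. cell_norm L (\<sigma> k) = 1"
    and cont: "\<And>k0. ((\<lambda>k. cell_norm L (phase (- k) (\<sigma> k) - phase (- k0) (\<sigma> k0))) \<longlongrightarrow> 0) (at k0)"
    and f: "\<And>K. K \<in> ?RL \<Longrightarrow> continuous_on UNIV (f K)"
    and trans: "\<And>K k. K \<in> ?RL \<Longrightarrow> AE r in lborel. \<sigma> (k + K) r = cis (2 * pi * f K k) *\<^sub>v \<sigma> k r"
    and cocycle: "\<And>K K' k. K \<in> ?RL \<Longrightarrow> K' \<in> ?RL \<Longrightarrow> f K' (k + K) - f (K + K') k + f K k = 0"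
    unfolding first_chern_class_def by fastforce
  obtain h where h: "continuous_on UNIV h" "\<And>k K. K \<in> ?RL \<Longrightarrow> h (k + K) = h k + f K k"
    using RB.cocycle_trivial[OF f cocycle] by blast
  have \<sigma>l: "\<sigma> k \<in> l2loc" for k using \<sigma>(1) E(1) blochD(1) by blast
  \<comment> \<open>A vector of norm 1 generates the line: its coefficient \<open>b\<close> with
    respect to the given generator cannot vanish.\<close>
  have span_\<sigma>: "E k = {g \<in> l2loc. \<exists>c. AE r in lborel. g r = c *\<^sub>v \<sigma> k r}" for k
  proof -
    obtain e :: "nat \<Rightarrow> _" where e: "e 0 \<in> l2loc" "E k = lspan {..<1} e"
      using E(2)[of k] unfolding has_cdim_def by auto
    have E_e: "E k = {g \<in> l2loc. \<exists>c. AE r in lborel. g r = c *\<^sub>v e 0 r}"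
      using e(2) unfolding lessThan_1 lspan_singleton .
    then obtain b where b: "AE r in lborel. \<sigma> k r = b *\<^sub>v e 0 r" using \<sigma>(1) by blast
    have "cell_norm L (\<sigma> k) = cell_norm L (\<lambda>r. b *\<^sub>v e 0 r)"
      using b by (rule cell_norm_cong_AE[OF _ l2locD(1)[OF \<sigma>l] l2locD(1)[OF l2loc_scale[OF e(1)]]])
    then have b0: "b \<noteq> 0" using \<sigma>(2)[of k] by (auto simp: cell_norm_scale)
    have "(\<exists>c. AE r in lborel. g r = c *\<^sub>v e 0 r) \<longleftrightarrow> (\<exists>c. AE r in lborel. g r = c *\<^sub>v \<sigma> k r)" for g
    proof
      assume "\<exists>c. AE r in lborel. g r = c *\<^sub>v e 0 r"
      then obtain c where "AE r in lborel. g r = c *\<^sub>v e 0 r" ..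
      then have "AE r in lborel. g r = (c / b) *\<^sub>v \<sigma> k r"
        using b by eventually_elim (simp add: val_scale_simps b0)
      then show "\<exists>c. AE r in lborel. g r = c *\<^sub>v \<sigma> k r" ..
    next
      assume "\<exists>c. AE r in lborel. g r = c *\<^sub>v \<sigma> k r"
      then obtain c where "AE r in lborel. g r = c *\<^sub>v \<sigma> k r" ..
      then have "AE r in lborel. g r = (c * b) *\<^sub>v e 0 r"
        using b by eventually_elim (simp add: val_scale_simps)
      then show "\<exists>c. AE r in lborel. g r = c *\<^sub>v e 0 r" ..
    qed
    then show ?thesis unfolding E_e by simp
  qed
  \<comment> \<open>By \<open>h (k + K) = h k + f K k\<close> this factor cancels the transition
    phase of \<open>\<sigma>\<close>.\<close>
  define \<psi> where "\<psi> k = (\<lambda>r. cis (- (2 * pi * h k)) *\<^sub>v \<sigma> k r)" for k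
  have "periodic_line_bundle A A' L E \<psi>"
  proof
    fix k k0 K
    show "E k \<subseteq> bloch L k" by (rule E)
    have "(\<exists>c. AE r in lborel. g r = c *\<^sub>v \<sigma> k r) \<longleftrightarrow> (\<exists>c. AE r in lborel. g r = c *\<^sub>v \<psi> k r)" for g
    proof
      assume "\<exists>c. AE r in lborel. g r = c *\<^sub>v \<sigma> k r"
      then obtain c where "AE r in lborel. g r = c *\<^sub>v \<sigma> k r" ..
      then have "AE r in lborel. g r = (c * cis (2 * pi * h k)) *\<^sub>v \<psi> k r"
        by (simp add: \<psi>_def val_scale_simps mult.assoc cis_mult)
      then show "\<exists>c. AE r in lborel. g r = c *\<^sub>v \<psi> k r" ..
    next
      assume "\<exists>c. AE r in lborel. g r = c *\<^sub>v \<psi> k r"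
      then show "\<exists>c. AE r in lborel. g r = c *\<^sub>v \<sigma> k r" unfolding \<psi>_def val_scale_simps by blast
    qed
    then show "E k = {g \<in> l2loc. \<exists>c. AE r in lborel. g r = c *\<^sub>v \<psi> k r}" unfolding span_\<sigma> by simp
    have "\<psi> k \<in> l2loc" unfolding \<psi>_def by (intro l2loc_scale \<sigma>l)
    then show "\<psi> k \<in> E k" unfolding span_\<sigma> \<psi>_def by blast
    show "cell_norm L (\<psi> k) = 1" by (simp add: \<psi>_def cell_norm_scale \<sigma>)
    show "AE r in lborel. \<psi> (k + K) r = \<psi> k r" if K: "K \<in> ?RL"
    proof -
      have c: "cis (- (2 * pi * h (k + K))) * cis (2 * pi * f K k) = cis (- (2 * pi * h k))"
        by (simp add: h(2)[OF K] cis_mult distrib_left)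
      show ?thesis
        using trans[OF K, of k] by eventually_elim (simp only: \<psi>_def val_scale_simps c)
    qed
    show "analytic_near (bounded_ops L) (op_norm L) (\<lambda>k f. phase (- k) (band_proj L E k (phase k f))) k0"
      using an unfolding analytic_projection_def real_analytic_in_iff by blast
    let ?c = "\<lambda>k. cis (- (2 * pi * h k))" and ?v = "\<lambda>k. phase (- k) (\<sigma> k)"
    have v: "?v k \<in> bloch L 0" for k using \<sigma>(1) E(1) by (intro bloch_phase_strip) blast
    have "continuous_on UNIV ?c" using h(1) by (intro continuous_intros)
    then have "isCont ?c k0" by (simp add: continuous_on_eq_continuous_at)
    then have "((\<lambda>k. norm (?c k - ?c k0)) \<longlongrightarrow> 0) (at k0)"
      unfolding isCont_def by (intro tendsto_norm_zero LIM_zero)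
    from tendsto_add[OF this cont[of k0]]
    have lim: "((\<lambda>k. norm (?c k - ?c k0) + cell_norm L (?v k - ?v k0)) \<longlongrightarrow> 0) (at k0)" by simp
    have eq: "phase (- k) (\<psi> k) = (\<lambda>r. ?c k *\<^sub>v ?v k r)" for k
      by (simp add: \<psi>_def phase_def fun_eq_iff val_scale_simps mult.commute)
    have "norm (cell_norm L (phase (- k) (\<psi> k) - phase (- k0) (\<psi> k0))) \<le>
       norm (?c k - ?c k0) + cell_norm L (?v k - ?v k0)" for k
      using V.diff_bound[OF _ _ v v, of "?c k" "?c k0" k k0] unfolding eq by (simp add: cell_norm_phase cell_norm_nonneg \<sigma>)
    then have "\<forall>\<^sub>F k in at k0. norm (cell_norm L (phase (- k) (\<psi> k) - phase (- k0) (\<psi> k0))) \<le>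
       norm (?c k - ?c k0) + cell_norm L (?v k - ?v k0)"
      by (intro always_eventually allI)
    then show "((\<lambda>k. cell_norm L (phase (- k) (\<psi> k) - phase (- k0) (\<psi> k0))) \<longlongrightarrow> 0) (at k0)"
      using lim by (rule Lim_null_comparison)
  qed
  then show ?thesis by (rule periodic_line_bundle.localizable)
qed

theorem mainTheorem2:
  fixes P :: "('p, 'b) monoid_scheme"
    and BL :: "(real^'d) set"
    and pc :: "'p \<Rightarrow> real^'d \<Rightarrow> real^'d"
    and s :: "'p \<Rightarrow> real"
    and D :: "'p \<Rightarrow> complex^'v \<Rightarrow> complex^'v"
  assumes "magnetic_space_group P BL pc s D"
    and "spinless P pc s D \<or> spinful P pc s D"
  shows "(\<forall>E :: real^'d \<Rightarrow> ('d, 'v, 'm::finite) wavefun set.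
            \<not> localizable_topological P BL pc s D 1 E) \<and>
         (\<forall>E :: real^'d \<Rightarrow> ('d, 'v, 'm) wavefun set.
            simple_band P BL pc s D E \<longrightarrow> localizable BL 1 E \<longrightarrow> band_representation P BL pc D E) \<and>
         (\<forall>N. \<forall>E :: real^'d \<Rightarrow> ('d, 'v, 'm) wavefun set.
            localizable_topological P BL pc s D N E \<longrightarrow> 2 \<le> N) \<and>
         (\<forall>E :: real^'d \<Rightarrow> ('d, 'v, 'm) wavefun set.
            simple_band P BL pc s D E \<longrightarrow> analytic_projection BL E \<longrightarrow>
            \<not> band_representation P BL pc D E \<longrightarrow>
            first_chern_class BL E \<noteq> coboundaries2 (reciprocal_lattice BL))"
proof -
  interpret G: magnetic_space_group P BL pc s D by (rule assms(1))
  obtain A A' where lb: "lattice_basis A A' BL" using full_rank_lattice_basis[OF G.lattice] by blast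
  have main: "band_representation P BL pc D E"
    if "simple_band P BL pc s D E" "localizable BL 1 E" for E :: "real^'d \<Rightarrow> ('d, 'v, 'm) wavefun set"
    using that by (rule G.localizable_imp_band_representation)
  have "\<not> localizable_topological P BL pc s D 1 E" for E :: "real^'d \<Rightarrow> ('d, 'v, 'm) wavefun set"
    using main unfolding localizable_topological_def by blast
  moreover have "2 \<le> N" if loc: "localizable_topological P BL pc s D N E"
    for N and E :: "real^'d \<Rightarrow> ('d, 'v, 'm) wavefun set"
  proof (rule ccontr)
    assume "\<not> 2 \<le> N"
    then consider "N = 0" | "N = 1" by linarith
    then show False
      using loc main G.rank_zero_band_representation unfolding localizable_topological_def by cases blast+
  qed
  moreover have "first_chern_class BL E \<noteq> coboundaries2 (reciprocal_lattice BL)"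
    if sb: "simple_band P BL pc s D E" and an: "analytic_projection BL E" and nr: "\<not> band_representation P BL pc D E"
    for E :: "real^'d \<Rightarrow> ('d, 'v, 'm) wavefun set"
  proof
    assume "first_chern_class BL E = coboundaries2 (reciprocal_lattice BL)"
    then have "localizable BL 1 E"
      using sb unfolding band_def by (intro trivial_chern_class_imp_localizable[OF lb _ _ an]) auto
    then show False using main[OF sb] nr by blast
  qed
  ultimately show ?thesis using main by blast
qed

end
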